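(* Let $V$ be a scheme of finite type over $\mathbb Z$ and $V=\bigcup_{i\in I}U_i$ a finite open cover. Suppose given varieties $X_i$ ($i\in I$) and $X_{ij}=X_{ji}$ ($i\ne j$) over $\mathbb F_1$ and immersions $X_{ij}\to X_i$ and $X_i\to V$ in $\mathcal O$ whose extensions to $\mathbb Z$ are the inclusions $U_i\cap U_j\to U_i$ and $U_i\to V$. Suppose moreover that, for $i\neq j$, the composite immersion $X_{ij}\to X_i\to V$ coincides with $X_{ij}\to X_j\to V$. For every $A\in\mathcal A$ put $$\underline{\underline X}(A)=\bigcup_i\underline{\underline{X_i}}(A)$$ (union inside $\underline{\underline V}(A)$), and let $a_X$ be the subalgebra of $\prod_{i\in I}a_{X_i}$ consisting of the families $(\alpha_i)_{i\in I}$ such that, whenever $i\ne j$, the images of $\alpha_i$ and $\alpha_j$ in $a_{X_{ij}}$ coincide. Then the object $X=(\underline{\underline X},a_X)$ over $\mathbb F_1$ (with the evident evaluation morphisms) is a variety over $\mathbb F_1$ such that $X\otimes_{\mathbb F_1}\mathbb Z=V$.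
   Context: **Gadgets.** $\mathcal R$ is the category of commutative unital rings whose additive group is a free $\mathbb Z$-module of finite type; $\mathcal Ens$ is the category of sets. A *gadget over $\mathbb F_1$* is a pair $X=(\underline X,a_X)$ of a covariant functor $\underline X:\mathcal R\to\mathcal Ens$ and a $\mathbb C$-algebra $a_X$, together with, for every $R\in\mathcal R$, every unital ring morphism $\sigma:R\to\mathbb C$ and every $x\in\underline X(R)$, an algebra morphism (evaluation) $e_{x,\sigma}:a_X\to\mathbb C$, such that for every morphism $f:R'\to R$ of $\mathcal R$, every $y\in\underline X(R')$ and every $\sigma:R\to\mathbb C$ one has $e_{f(y),\sigma}=e_{y,\sigma\circ f}$. It is *finite* if all sets $\underline X(R)$ are finite. A *morphism* $\varphi:X\to Y$ of gadgets is a pair of a natural transformation $\underline\varphi:\underline X\to\underline Y$ and an algebra morphism $\varphi^*:a_Y\to a_X$ such that $e_{\underline\varphi(x),\sigma}(\alpha)=e_{x,\sigma}(\varphi^*(\alpha))$ for all $R$, $\sigma$, $x\in\underline X(R)$, $\alpha\in a_Y$. It is an *immersion* if $\varphi^*$ and all maps $\underline\varphi:\underline X(R)\to\underline Y(R)$ are injective. $\mathcal T$ is the category of gadgets. Every scheme $V$ of finite type over $\mathbb Z$ defines a gadget, still denoted $V$: $\underline V(R)=\mathrm{Hom}_{\mathbb Z}(\mathrm{Spec}\,R,V)$, algebra $\mathcal O(V_{\mathbb C})$ of global functions on $V_{\mathbb C}=V\otimes_{\mathbb Z}\mathbb C$, and $e_{x,\sigma}$ = evaluation at the point $\sigma(x)\in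 V(\mathbb C)$. **Affine varieties over $\mathbb F_1$.** An *affine variety over $\mathbb F_1$* is a finite gadget $X$ such that there exist an affine scheme $X_{\mathbb Z}$ of finite type over $\mathbb Z$ and an immersion $i:X\to X_{\mathbb Z}$ in $\mathcal T$ such that for every affine scheme $V$ of finite type over $\mathbb Z$ and every morphism $\varphi:X\to V$ of $\mathcal T$ there is a unique morphism of schemes $\varphi_{\mathbb Z}:X_{\mathbb Z}\to V$ with $\varphi=\varphi_{\mathbb Z}\circ i$. A morphism $f:X\to Y$ of affine varieties over $\mathbb F_1$ (in $\mathcal T$) extends to a unique $f_{\mathbb Z}:X_{\mathbb Z}\to Y_{\mathbb Z}$. $\mathcal A\subset\mathcal T$ is the full subcategory of affine varieties over $\mathbb F_1$. **Objects and varieties over $\mathbb F_1$.** An *object over $\mathbb F_1$* is a pair $X=(\underline{\underline X},a_X)$ of a contravariant functor $\underline{\underline X}:\mathcal A\to\mathcal Ens$ and a $\mathbb C$-algebra $a_X$, together with, for every $A\in\mathcal A$ and $x\in\underline{\underline X}(A)$, an algebra morphism $e_x:a_X\to a_A$, such that for every $f:A\to B$ in $\mathcal A$ and $x\in\underline{\underline X}(B)$ one has $e_{f^*(x)}=f^*\circ e_x$, where $f^*(x)=\underline{\underline X}(f)(x)$. A *morphism* $\varphi:X\to Y$ of objects is a natural transformation $\underline{\underline\varphi}:\underline{\underline X}\to\underline{\underline Y}$ with an algebra morphism $\varphi^*:a_Y\to a_X$ such that $e_{\underline{\underline\varphi}(x)}=e_x\circ\varphi^*$ for all $A$, $x\in\underline{\underline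 X}(A)$; it is an *immersion* if $\underline{\underline\varphi}$ and $\varphi^*$ are injective. $\mathcal O$ is the category of objects over $\mathbb F_1$. A scheme $V$ of finite type over $\mathbb Z$ defines an object $V=(\underline{\underline V},\mathcal O(V_{\mathbb C}))$ with $\underline{\underline V}(A)=\mathrm{Hom}_{\mathbb Z}(A_{\mathbb Z},V)$ and $e_x=i^*\circ x^*:\mathcal O(V_{\mathbb C})\to\mathcal O(A_{\mathbb C})\to a_A$, where $i:A\to A_{\mathbb Z}$ is the immersion attached to $A$. A *variety over $\mathbb F_1$* is an object $X$ over $\mathbb F_1$ such that there exist a scheme $X_{\mathbb Z}$ of finite type over $\mathbb Z$ and an immersion $i:X\to X_{\mathbb Z}$ in $\mathcal O$ such that for every scheme $V$ of finite type over $\mathbb Z$ and every morphism $\varphi:X\to V$ in $\mathcal O$ there is a unique morphism of schemes $\varphi_{\mathbb Z}:X_{\mathbb Z}\to V$ with $\varphi=\varphi_{\mathbb Z}\circ i$; one writes $X_{\mathbb Z}=X\otimes_{\mathbb F_1}\mathbb Z$ (extension of scalars to $\mathbb Z$). A morphism $f:X\to Y$ of varieties over $\mathbb F_1$ extends uniquely to $f_{\mathbb Z}:X_{\mathbb Z}\to Y_{\mathbb Z}$; the "extension to $\mathbb Z$" of a morphism $\varphi$ from a variety $X$ over $\mathbb F_1$ to a scheme $V$ of finite type over $\mathbb Z$ is $\varphi_{\mathbb Z}:X_{\mathbb Z}\to V$. In the hypothesis of the claim, $X_i\otimes_{\mathbb F_1}\mathbb Z=U_i$ and $X_{ij}\otimes_{\mathbb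 F_1}\mathbb Z=U_i\cap U_j$. **Evident evaluations.** If $x\in\underline{\underline X}(A)$ lies in $\underline{\underline{X_i}}(A)$, then $e_x:a_X\to a_A$ is the projection $a_X\to a_{X_i}$ followed by the evaluation $e_x:a_{X_i}\to a_A$ of $X_i$.
   Formalization: It is assumed that the evident evaluations are well defined, i.e. at a point of X(A) lying in both X_i(A) and X_j(A) the evaluations through a_{X_i} and a_{X_j} agree on a_X; this does not follow from the other hypotheses, since such a point need not lie in X_ij(A). *)

theory Defs
  imports
    "HOL-Algebra.Algebraic_Closure_Type"
    "HOL-Algebra.Free_Abelian_Groups"
    "HOL-Algebra.Generated_Rings"
    "HOL-Algebra.Module"
    "HOL-Analysis.Function_Topology"
begin

no_notation var (\<open>X\<index>\<close>)

section \<open>Commutative algebra\<close>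

text \<open>All homomorphisms are extensional functions on the carrier of their source, so that HOL
  equality of homomorphisms is equality of maps between carriers. \<open>ring_hom\<close> preserves the unit.\<close>

definition rhom :: "('a, 'm) ring_scheme \<Rightarrow> ('b, 'n) ring_scheme \<Rightarrow> ('a \<Rightarrow> 'b) set" where
  "rhom A B = ring_hom A B \<inter> extensional (carrier A)"

abbreviation CC :: "complex ring" where
  "CC \<equiv> ring_of_type_algebra"

text \<open>The locale \<open>algebra\<close> asks for commutativity. This excludes no variety over \<open>\<bbbF>\<^sub>1\<close>: see the remark on
  the universe \<open>'u\<close> below.\<close>

definition C_algebra :: "(complex, 'a) module \<Rightarrow> bool" where
  "C_algebra A \<longleftrightarrow> algebra CC A"

definition alg_hom :: "(complex, 'a) module \<Rightarrow> (complex, 'b) module \<Rightarrow> ('a \<Rightarrow> 'b) set" where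
  "alg_hom A B = {h \<in> rhom A B. \<forall>z. \<forall>a \<in> carrier A. h (z \<odot>\<^bsub>A\<^esub> a) = z \<odot>\<^bsub>B\<^esub> h a}"

definition CC_alg :: "(complex, complex) module" where
  "CC_alg = ring.extend CC (module.fields (*))"

definition prod_ring :: "'i set \<Rightarrow> ('i \<Rightarrow> ('a, 'm) ring_scheme) \<Rightarrow> ('i \<Rightarrow> 'a) ring" where
  "prod_ring I L =
    \<lparr>carrier = (\<Pi>\<^sub>E i \<in> I. carrier (L i)),
     monoid.mult = (\<lambda>s t. \<lambda>i \<in> I. s i \<otimes>\<^bsub>L i\<^esub> t i),
     one = (\<lambda>i \<in> I. \<one>\<^bsub>L i\<^esub>),
     ring.zero = (\<lambda>i \<in> I. \<zero>\<^bsub>L i\<^esub>),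
     add = (\<lambda>s t. \<lambda>i \<in> I. s i \<oplus>\<^bsub>L i\<^esub> t i)\<rparr>"

definition prod_alg :: "'i set \<Rightarrow> ('i \<Rightarrow> (complex, 'a) module) \<Rightarrow> (complex, 'i \<Rightarrow> 'a) module" where
  "prod_alg I L = ring.extend (prod_ring I L) (module.fields (\<lambda>z s. \<lambda>i \<in> I. z \<odot>\<^bsub>L i\<^esub> s i))"

definition local_ring :: "('a, 'm) ring_scheme \<Rightarrow> bool" where
  "local_ring R \<longleftrightarrow> cring R \<and> (\<exists>!M. maximalideal M R)"

subsection \<open>Localisation at a prime ideal\<close>

text \<open>The fraction \<open>a / b\<close> with \<open>b\<close> outside the prime ideal \<open>P\<close>, as a class of pairs.\<close>

definition loc_frac :: "('a, 'm) ring_scheme \<Rightarrow> 'a set \<Rightarrow> 'a \<Rightarrow> 'a \<Rightarrow> ('a \<times> 'a) set" where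
  "loc_frac R P a b =
    {(c, d). c \<in> carrier R \<and> d \<in> carrier R - P \<and>
      (\<exists>t \<in> carrier R - P. t \<otimes>\<^bsub>R\<^esub> (a \<otimes>\<^bsub>R\<^esub> d) = t \<otimes>\<^bsub>R\<^esub> (c \<otimes>\<^bsub>R\<^esub> b))}"

text \<open>Here and below, an operation on classes is the union, over all representatives, of the class
  of the result; this union is the common class, as the result does not depend on the choices.\<close>

definition localisation :: "('a, 'm) ring_scheme \<Rightarrow> 'a set \<Rightarrow> ('a \<times> 'a) set ring" where
  "localisation R P =
    \<lparr>carrier = {loc_frac R P a b | a b. a \<in> carrier R \<and> b \<in> carrier R - P},
     monoid.mult = (\<lambda>x y. \<Union>(a, b) \<in> x. \<Union>(c, d) \<in> y. loc_frac R P (a \<otimes>\<^bsub>R\<^esub> c) (b \<otimes>\<^bsub>R\<^esub> d)),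
     one = loc_frac R P \<one>\<^bsub>R\<^esub> \<one>\<^bsub>R\<^esub>,
     ring.zero = loc_frac R P \<zero>\<^bsub>R\<^esub> \<one>\<^bsub>R\<^esub>,
     add = (\<lambda>x y. \<Union>(a, b) \<in> x. \<Union>(c, d) \<in> y.
              loc_frac R P ((a \<otimes>\<^bsub>R\<^esub> d) \<oplus>\<^bsub>R\<^esub> (c \<otimes>\<^bsub>R\<^esub> b)) (b \<otimes>\<^bsub>R\<^esub> d))\<rparr>"

text \<open>The map from the localisation of \<open>R\<close> at the preimage of \<open>Q\<close> to that of \<open>S\<close> at \<open>Q\<close>
  induced by \<open>h : R \<rightarrow> S\<close>.\<close>

definition loc_map ::
  "('b, 'n) ring_scheme \<Rightarrow> 'b set \<Rightarrow> ('a \<Rightarrow> 'b) \<Rightarrow> ('a \<times> 'a) set \<Rightarrow> ('b \<times> 'b) set" where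
  "loc_map S Q h x = (\<Union>(a, b) \<in> x. loc_frac S Q (h a) (h b))"

subsection \<open>The complexification \<open>A \<otimes> \<complex>\<close> (over the integers) of a commutative ring \<open>A\<close>\<close>

text \<open>It is the quotient of the \<open>\<complex>\<close>-algebra of the multiplicative monoid of \<open>A\<close> by the ideal generated
  by the elements \<open>[a + b] - [a] - [b]\<close>: a morphism from this quotient to a commutative
  \<open>\<complex>\<close>-algebra \<open>B\<close> is the same thing as a ring morphism \<open>A \<rightarrow> B\<close>.\<close>

definition supp :: "('a \<Rightarrow> complex) \<Rightarrow> 'a set" where
  "supp \<phi> = {a. \<phi> a \<noteq> 0}"

definition single :: "complex \<Rightarrow> 'a \<Rightarrow> 'a \<Rightarrow> complex" where
  "single z a = (\<lambda>x. if x = a then z else 0)"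

definition monoid_alg :: "('a, 'm) ring_scheme \<Rightarrow> ('a \<Rightarrow> complex) ring" where
  "monoid_alg A =
    \<lparr>carrier = {\<phi>. finite (supp \<phi>) \<and> supp \<phi> \<subseteq> carrier A},
     monoid.mult = (\<lambda>\<phi> \<psi>. \<lambda>c. \<Sum>(a, b) \<in> {(a, b) \<in> supp \<phi> \<times> supp \<psi>. a \<otimes>\<^bsub>A\<^esub> b = c}. \<phi> a * \<psi> b),
     one = single 1 \<one>\<^bsub>A\<^esub>,
     ring.zero = (\<lambda>_. 0),
     add = (\<lambda>\<phi> \<psi>. \<lambda>c. \<phi> c + \<psi> c)\<rparr>"

definition cplx_ideal :: "('a, 'm) ring_scheme \<Rightarrow> ('a \<Rightarrow> complex) set" where
  "cplx_ideal A = genideal (monoid_alg A)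
    {\<lambda>c. single 1 (a \<oplus>\<^bsub>A\<^esub> b) c - single 1 a c - single 1 b c | a b.
      a \<in> carrier A \<and> b \<in> carrier A}"

definition cplx :: "('a, 'm) ring_scheme \<Rightarrow> ('a \<Rightarrow> complex) set ring" where
  "cplx A = monoid_alg A Quot cplx_ideal A"

definition cplx_class :: "('a, 'm) ring_scheme \<Rightarrow> ('a \<Rightarrow> complex) \<Rightarrow> ('a \<Rightarrow> complex) set" where
  "cplx_class A \<phi> = cplx_ideal A +>\<^bsub>monoid_alg A\<^esub> \<phi>"

text \<open>\<open>h \<otimes> \<complex> : A \<otimes> \<complex> \<rightarrow> B \<otimes> \<complex>\<close> for \<open>h : A \<rightarrow> B\<close>.\<close>

definition cplx_map ::
  "('b, 'n) ring_scheme \<Rightarrow> ('a \<Rightarrow> 'b) \<Rightarrow> ('a \<Rightarrow> complex) set \<Rightarrow> ('b \<Rightarrow> complex) set" where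
  "cplx_map B h k = (\<Union>\<phi> \<in> k. cplx_class B (\<lambda>b. \<Sum>a \<in> {a \<in> supp \<phi>. h a = b}. \<phi> a))"

text \<open>The \<open>\<complex>\<close>-algebra morphism \<open>A \<otimes> \<complex> \<rightarrow> \<complex>\<close> extending \<open>\<epsilon> : A \<rightarrow> \<complex>\<close>.\<close>

definition cplx_eval :: "('a \<Rightarrow> complex) \<Rightarrow> ('a \<Rightarrow> complex) set \<Rightarrow> complex" where
  "cplx_eval \<epsilon> k = the_elem ((\<lambda>\<phi>. \<Sum>a \<in> supp \<phi>. \<phi> a * \<epsilon> a) ` k)"

section \<open>Locally ringed spaces and schemes\<close>

record ('p, 'r) rspace =
  base :: "'p topology"
  sec :: "'p set \<Rightarrow> 'r ring"
  res :: "'p set \<Rightarrow> 'p set \<Rightarrow> 'r \<Rightarrow> 'r"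

abbreviation pts :: "('p, 'r) rspace \<Rightarrow> 'p set" where
  "pts X \<equiv> topspace (base X)"

abbreviation opn :: "('p, 'r) rspace \<Rightarrow> 'p set \<Rightarrow> bool" where
  "opn X \<equiv> openin (base X)"

definition ringed_space :: "('p, 'r) rspace \<Rightarrow> bool" where
  "ringed_space X \<longleftrightarrow>
    (\<forall>U. opn X U \<longrightarrow> cring (sec X U)) \<and>
    (\<forall>U W. opn X U \<and> opn X W \<and> W \<subseteq> U \<longrightarrow> res X U W \<in> ring_hom (sec X U) (sec X W)) \<and>
    (\<forall>U. opn X U \<longrightarrow> (\<forall>s \<in> carrier (sec X U). res X U U s = s)) \<and>
    (\<forall>U W N. opn X U \<and> opn X W \<and> opn X N \<and> N \<subseteq> W \<and> W \<subseteq> U \<longrightarrow>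
      (\<forall>s \<in> carrier (sec X U). res X W N (res X U W s) = res X U N s)) \<and>
    (\<forall>\<U> s. (\<forall>U \<in> \<U>. opn X U \<and> s U \<in> carrier (sec X U)) \<and>
        (\<forall>U \<in> \<U>. \<forall>W \<in> \<U>. res X U (U \<inter> W) (s U) = res X W (U \<inter> W) (s W)) \<longrightarrow>
      (\<exists>!t. t \<in> carrier (sec X (\<Union>\<U>)) \<and> (\<forall>U \<in> \<U>. res X (\<Union>\<U>) U t = s U)))"

text \<open>The germ at \<open>x\<close> of a section \<open>s\<close> over \<open>U\<close>.\<close>

definition germ :: "('p, 'r) rspace \<Rightarrow> 'p \<Rightarrow> 'p set \<Rightarrow> 'r \<Rightarrow> ('p set \<times> 'r) set" where
  "germ X x U s =
    {(W, t). opn X W \<and> x \<in> W \<and> t \<in> carrier (sec X W) \<and>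
      (\<exists>N. opn X N \<and> x \<in> N \<and> N \<subseteq> U \<inter> W \<and> res X U N s = res X W N t)}"

definition stalk :: "('p, 'r) rspace \<Rightarrow> 'p \<Rightarrow> ('p set \<times> 'r) set ring" where
  "stalk X x =
    \<lparr>carrier = {germ X x U s | U s. opn X U \<and> x \<in> U \<and> s \<in> carrier (sec X U)},
     monoid.mult = (\<lambda>a b. \<Union>(U, s) \<in> a. \<Union>(W, t) \<in> b.
       germ X x (U \<inter> W) (res X U (U \<inter> W) s \<otimes>\<^bsub>sec X (U \<inter> W)\<^esub> res X W (U \<inter> W) t)),
     one = germ X x (pts X) \<one>\<^bsub>sec X (pts X)\<^esub>,
     ring.zero = germ X x (pts X) \<zero>\<^bsub>sec X (pts X)\<^esub>,
     add = (\<lambda>a b. \<Union>(U, s) \<in> a. \<Union>(W, t) \<in> b.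
       germ X x (U \<inter> W) (res X U (U \<inter> W) s \<oplus>\<^bsub>sec X (U \<inter> W)\<^esub> res X W (U \<inter> W) t))\<rparr>"

definition locally_ringed :: "('p, 'r) rspace \<Rightarrow> bool" where
  "locally_ringed X \<longleftrightarrow> ringed_space X \<and> (\<forall>x \<in> pts X. local_ring (stalk X x))"

subsection \<open>Morphisms\<close>

text \<open>For \<open>f : X \<rightarrow> Y\<close> and \<open>W\<close> open in \<open>Y\<close>, \<open>sh f W\<close> goes from the sections of \<open>Y\<close> over \<open>W\<close> to the
  sections of \<open>X\<close> over the preimage of \<open>W\<close>.\<close>

record ('p, 'r, 'q, 's) smor =
  pt :: "'p \<Rightarrow> 'q"
  sh :: "'q set \<Rightarrow> 's \<Rightarrow> 'r"

definition preim :: "('p, 'r) rspace \<Rightarrow> ('p, 'r, 'q, 's) smor \<Rightarrow> 'q set \<Rightarrow> 'p set" where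
  "preim X f W = {x \<in> pts X. pt f x \<in> W}"

definition stalk_map ::
  "('p, 'r) rspace \<Rightarrow> ('p, 'r, 'q, 's) smor \<Rightarrow> 'p \<Rightarrow> ('q set \<times> 's) set \<Rightarrow> ('p set \<times> 'r) set" where
  "stalk_map X f x a = (\<Union>(W, t) \<in> a. germ X x (preim X f W) (sh f W t))"

definition sch_hom :: "('p, 'r) rspace \<Rightarrow> ('q, 's) rspace \<Rightarrow> ('p, 'r, 'q, 's) smor set" where
  "sch_hom X Y = {f.
    pt f \<in> extensional (pts X) \<and> continuous_map (base X) (base Y) (pt f) \<and>
    sh f \<in> extensional {W. opn Y W} \<and>
    (\<forall>W. opn Y W \<longrightarrow> sh f W \<in> rhom (sec Y W) (sec X (preim X f W))) \<and>
    (\<forall>W N. opn Y W \<and> opn Y N \<and> N \<subseteq> W \<longrightarrow>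
      (\<forall>t \<in> carrier (sec Y W).
        sh f N (res Y W N t) = res X (preim X f W) (preim X f N) (sh f W t))) \<and>
    (\<forall>x \<in> pts X. \<forall>a \<in> carrier (stalk Y (pt f x)).
      stalk_map X f x a \<in> Units (stalk X x) \<longrightarrow> a \<in> Units (stalk Y (pt f x)))}"

definition sch_id :: "('p, 'r) rspace \<Rightarrow> ('p, 'r, 'p, 'r) smor" where
  "sch_id X =
    \<lparr>pt = (\<lambda>x \<in> pts X. x),
     sh = (\<lambda>W \<in> {W. opn X W}. \<lambda>s \<in> carrier (sec X W). s)\<rparr>"

text \<open>The composite of \<open>f : X \<rightarrow> Y\<close> and \<open>g : Y \<rightarrow> Z\<close>.\<close>

definition sch_comp ::
  "('p, 'r) rspace \<Rightarrow> ('q, 's) rspace \<Rightarrow> ('o, 't) rspace \<Rightarrow>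
    ('q, 's, 'o, 't) smor \<Rightarrow> ('p, 'r, 'q, 's) smor \<Rightarrow> ('p, 'r, 'o, 't) smor" where
  "sch_comp X Y Z g f =
    \<lparr>pt = compose (pts X) (pt g) (pt f),
     sh = (\<lambda>W \<in> {W. opn Z W}. compose (carrier (sec Z W)) (sh f (preim Y g W)) (sh g W))\<rparr>"

definition sch_iso :: "('p, 'r) rspace \<Rightarrow> ('q, 's) rspace \<Rightarrow> bool" where
  "sch_iso X Y \<longleftrightarrow> (\<exists>f \<in> sch_hom X Y. \<exists>g \<in> sch_hom Y X.
    sch_comp X Y X g f = sch_id X \<and> sch_comp Y X Y f g = sch_id Y)"

definition open_sub :: "('p, 'r) rspace \<Rightarrow> 'p set \<Rightarrow> ('p, 'r) rspace" where
  "open_sub X U = \<lparr>base = subtopology (base X) U, sec = sec X, res = res X\<rparr>"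

text \<open>The inclusion of the open subspace \<open>U\<close> into \<open>X\<close>.\<close>

definition open_incl :: "('p, 'r) rspace \<Rightarrow> 'p set \<Rightarrow> ('p, 'r, 'p, 'r) smor" where
  "open_incl X U =
    \<lparr>pt = (\<lambda>x \<in> U. x),
     sh = (\<lambda>W \<in> {W. opn X W}. \<lambda>s \<in> carrier (sec X W). res X W (W \<inter> U) s)\<rparr>"

subsection \<open>Spectra and schemes\<close>

definition spec_pts :: "('a, 'm) ring_scheme \<Rightarrow> 'a set set" where
  "spec_pts R = {P. primeideal P R}"

definition spec_top :: "('a, 'm) ring_scheme \<Rightarrow> 'a set topology" where
  "spec_top R = topology_generated_by {{P \<in> spec_pts R. a \<notin> P} | a. a \<in> carrier R}"

definition Spec :: "('a, 'm) ring_scheme \<Rightarrow> ('a set, 'a set \<Rightarrow> ('a \<times> 'a) set) rspace" where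
  "Spec R =
    \<lparr>base = spec_top R,
     sec = (\<lambda>U. (prod_ring U (localisation R))\<lparr>carrier :=
       {s \<in> (\<Pi>\<^sub>E P \<in> U. carrier (localisation R P)).
         \<forall>P \<in> U. \<exists>N a b. openin (spec_top R) N \<and> P \<in> N \<and> N \<subseteq> U \<and>
           a \<in> carrier R \<and> b \<in> carrier R \<and> (\<forall>Q \<in> N. b \<notin> Q \<and> s Q = loc_frac R Q a b)}\<rparr>),
     res = (\<lambda>U W s. restrict s W)\<rparr>"

text \<open>\<open>Spec S \<rightarrow> Spec R\<close> for \<open>h : R \<rightarrow> S\<close>.\<close>

definition Spec_map ::
  "('a, 'm) ring_scheme \<Rightarrow> ('b, 'n) ring_scheme \<Rightarrow> ('a \<Rightarrow> 'b) \<Rightarrow>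
    ('b set, 'b set \<Rightarrow> ('b \<times> 'b) set, 'a set, 'a set \<Rightarrow> ('a \<times> 'a) set) smor" where
  "Spec_map R S h =
    (let p = (\<lambda>Q \<in> spec_pts S. {a \<in> carrier R. h a \<in> Q}) in
    \<lparr>pt = p,
     sh = (\<lambda>W \<in> {W. opn (Spec R) W}. \<lambda>s \<in> carrier (sec (Spec R) W).
       \<lambda>Q \<in> {Q \<in> spec_pts S. p Q \<in> W}. loc_map S Q h (s (p Q)))\<rparr>)"

text \<open>In \<open>affine_scheme\<close> and \<open>ft_scheme\<close> the ring \<open>R\<close> can be taken on the type of the sections of \<open>X\<close>,
  because it is isomorphic to the ring of global sections of its spectrum.\<close>

definition affine_scheme :: "('p, 'r) rspace \<Rightarrow> bool" where
  "affine_scheme X \<longleftrightarrow> locally_ringed X \<and> (\<exists>R :: 'r ring. cring R \<and> sch_iso X (Spec R))"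

definition is_scheme :: "('p, 'r) rspace \<Rightarrow> bool" where
  "is_scheme X \<longleftrightarrow> locally_ringed X \<and>
    (\<forall>x \<in> pts X. \<exists>U. opn X U \<and> x \<in> U \<and> affine_scheme (open_sub X U))"

definition fin_gen_ring :: "('a, 'm) ring_scheme \<Rightarrow> bool" where
  "fin_gen_ring R \<longleftrightarrow> (\<exists>S. finite S \<and> S \<subseteq> carrier R \<and> generate_ring R S = carrier R)"

definition ft_scheme :: "('p, 'r) rspace \<Rightarrow> bool" where
  "ft_scheme X \<longleftrightarrow> is_scheme X \<and>
    (\<exists>\<U>. finite \<U> \<and> \<Union>\<U> = pts X \<and>
      (\<forall>U \<in> \<U>. opn X U \<and>
        (\<exists>R :: 'r ring. cring R \<and> fin_gen_ring R \<and> sch_iso (open_sub X U) (Spec R))))"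

subsection \<open>The base change \<open>X\<^sub>\<complex>\<close> and its global functions\<close>

text \<open>\<open>X\<^sub>\<complex> = X \<times> Spec \<complex>\<close> over \<open>Spec \<int>\<close>, by the explicit construction of fibre products of locally ringed
  spaces: a point is a point \<open>x\<close> of \<open>X\<close> with a prime ideal of \<open>stalk X x \<otimes> \<complex>\<close> that lies over the
  maximal ideal of the stalk (its preimage in \<open>\<complex>\<close> is automatically zero); the topology is generated
  by the loci where an element of \<open>sec X U \<otimes> \<complex>\<close> does not vanish; sections are locally fractions of
  such elements.\<close>

definition bc_pts :: "('p, 'r) rspace \<Rightarrow> ('p \<times> (('p set \<times> 'r) set \<Rightarrow> complex) set set) set" where
  "bc_pts X = {(x, P). x \<in> pts X \<and> primeideal P (cplx (stalk X x)) \<and>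
    {a \<in> carrier (stalk X x). cplx_class (stalk X x) (single 1 a) \<in> P} =
      carrier (stalk X x) - Units (stalk X x)}"

definition bc_germ ::
  "('p, 'r) rspace \<Rightarrow> 'p \<Rightarrow> 'p set \<Rightarrow> ('r \<Rightarrow> complex) set \<Rightarrow> (('p set \<times> 'r) set \<Rightarrow> complex) set" where
  "bc_germ X x U g = cplx_map (stalk X x) (germ X x U) g"

definition bc_top ::
  "('p, 'r) rspace \<Rightarrow> ('p \<times> (('p set \<times> 'r) set \<Rightarrow> complex) set set) topology" where
  "bc_top X = topology_generated_by
    {{(x, P) \<in> bc_pts X. x \<in> U \<and> bc_germ X x U g \<notin> P} | U g.
      opn X U \<and> g \<in> carrier (cplx (sec X U))}"

definition bc_loc ::
  "('p, 'r) rspace \<Rightarrow> 'p \<times> (('p set \<times> 'r) set \<Rightarrow> complex) set set \<Rightarrow>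
    ((('p set \<times> 'r) set \<Rightarrow> complex) set \<times> (('p set \<times> 'r) set \<Rightarrow> complex) set) set ring" where
  "bc_loc X = (\<lambda>(x, P). localisation (cplx (stalk X x)) P)"

definition base_change ::
  "('p, 'r) rspace \<Rightarrow>
    ('p \<times> (('p set \<times> 'r) set \<Rightarrow> complex) set set,
     'p \<times> (('p set \<times> 'r) set \<Rightarrow> complex) set set \<Rightarrow>
       ((('p set \<times> 'r) set \<Rightarrow> complex) set \<times> (('p set \<times> 'r) set \<Rightarrow> complex) set) set) rspace" where
  "base_change X =
    \<lparr>base = bc_top X,
     sec = (\<lambda>D. (prod_ring D (bc_loc X))\<lparr>carrier :=
       {s \<in> (\<Pi>\<^sub>E q \<in> D. carrier (bc_loc X q)).
         \<forall>q \<in> D. \<exists>N U a b. openin (bc_top X) N \<and> q \<in> N \<and> N \<subseteq> D \<and> opn X U \<and>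
           a \<in> carrier (cplx (sec X U)) \<and> b \<in> carrier (cplx (sec X U)) \<and>
           (\<forall>(y, Q) \<in> N. y \<in> U \<and> bc_germ X y U b \<notin> Q \<and>
             s (y, Q) = loc_frac (cplx (stalk X y)) Q (bc_germ X y U a) (bc_germ X y U b))}\<rparr>),
     res = (\<lambda>D E s. restrict s E)\<rparr>"

type_synonym ('p, 'r) bc_fun =
  "'p \<times> (('p set \<times> 'r) set \<Rightarrow> complex) set set \<Rightarrow>
    ((('p set \<times> 'r) set \<Rightarrow> complex) set \<times> (('p set \<times> 'r) set \<Rightarrow> complex) set) set"

text \<open>The \<open>\<complex>\<close>-algebra of global functions on \<open>X\<^sub>\<complex>\<close>; a scalar \<open>z\<close> acts as \<open>1 \<otimes> z\<close>.\<close>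

definition fun_alg :: "('p, 'r) rspace \<Rightarrow> (complex, ('p, 'r) bc_fun) module" where
  "fun_alg X = ring.extend (sec (base_change X) (pts (base_change X))) (module.fields
    (\<lambda>z s. \<lambda>(x, P) \<in> pts (base_change X).
      loc_frac (cplx (stalk X x)) P (cplx_class (stalk X x) (single z \<one>\<^bsub>stalk X x\<^esub>)) \<one>\<^bsub>cplx (stalk X x)\<^esub>
        \<otimes>\<^bsub>bc_loc X (x, P)\<^esub> s (x, P)))"

text \<open>The pullback of global functions along \<open>f\<^sub>\<complex> : X\<^sub>\<complex> \<rightarrow> Y\<^sub>\<complex>\<close>.\<close>

definition fun_pull ::
  "('p, 'r) rspace \<Rightarrow> ('q, 's) rspace \<Rightarrow> ('p, 'r, 'q, 's) smor \<Rightarrow>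
    ('q, 's) bc_fun \<Rightarrow> ('p, 'r) bc_fun" where
  "fun_pull X Y f = (\<lambda>s \<in> carrier (fun_alg Y). \<lambda>(x, P) \<in> pts (base_change X).
    let h = cplx_map (stalk X x) (stalk_map X f x);
        Q = {k \<in> carrier (cplx (stalk Y (pt f x))). h k \<in> P}
    in loc_map (cplx (stalk X x)) P h (s (pt f x, Q)))"

text \<open>The value of a global function \<open>s\<close> on \<open>X\<^sub>\<complex>\<close> at a point \<open>y : Spec \<complex> \<rightarrow> X\<close> of \<open>X(\<complex>)\<close>. With \<open>x\<close> the
  image of \<open>y\<close>, \<open>\<epsilon> : stalk X x \<rightarrow> \<complex>\<close> is the morphism induced by \<open>y\<close>, where a section of \<open>Spec \<complex>\<close> at its
  only point \<open>{0}\<close> is a fraction \<open>a / b\<close> of complex numbers.\<close>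

definition C_value :: "(complex \<times> complex) set \<Rightarrow> complex" where
  "C_value k = the_elem ((\<lambda>(a, b). a / b) ` k)"

definition eval_at ::
  "('p, 'r) rspace \<Rightarrow> (complex set, complex set \<Rightarrow> (complex \<times> complex) set, 'p, 'r) smor \<Rightarrow>
    ('p, 'r) bc_fun \<Rightarrow> complex" where
  "eval_at X y = (\<lambda>s \<in> carrier (fun_alg X).
    let x = pt y {0};
        \<epsilon> = (\<lambda>a. the_elem ((\<lambda>(W, t). C_value (sh y W t {0})) ` a));
        P = {k \<in> carrier (cplx (stalk X x)). cplx_eval \<epsilon> k = 0}
    in the_elem ((\<lambda>(a, b). cplx_eval \<epsilon> a / cplx_eval \<epsilon> b) ` s (x, P)))"

section \<open>Gadgets over \<open>\<bbbF>\<^sub>1\<close>\<close>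

text \<open>The type variable \<open>'u\<close> plays the part of a universe: the rings, the schemes that occur in the
  universal properties, and the affine varieties over \<open>\<bbbF>\<^sub>1\<close> live on subsets of \<open>'u\<close>. As soon as \<open>'u\<close>
  has the cardinality of the continuum it contains an isomorphic copy of every ring that is a free
  module of finite type, of every scheme of finite type over \<open>\<int>\<close> (its points, open sets and sections
  are countable) and of every affine variety \<open>A\<close> over \<open>\<bbbF>\<^sub>1\<close>: the evaluations of \<open>a\<^sub>A\<close> are jointly
  injective (if they vanish on \<open>\<kappa>\<close>, all multiples \<open>z \<kappa>\<close> give morphisms to the affine line with the
  same zero map on points, hence come from the countable ring of functions on \<open>A\<^sub>\<int>\<close>), so \<open>a\<^sub>A\<close> embeds
  in a countable power of \<open>\<complex>\<close>. In particular \<open>a\<^sub>A\<close> is commutative, and the same argument embeds the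
  algebra of a variety over \<open>\<bbbF>\<^sub>1\<close> in a product of algebras \<open>a\<^sub>A\<close>.\<close>

definition RZ :: "'u ring set" where
  "RZ = {R. cring R \<and> (\<exists>S :: nat set. finite S \<and> add_monoid R \<cong> free_Abelian_group S)}"

record ('u, 's, 'a) gadget =
  gfun :: "'u ring \<Rightarrow> 's set"
  gmap :: "'u ring \<Rightarrow> 'u ring \<Rightarrow> ('u \<Rightarrow> 'u) \<Rightarrow> 's \<Rightarrow> 's"
  galg :: "(complex, 'a) module"
  gev :: "'u ring \<Rightarrow> 's \<Rightarrow> ('u \<Rightarrow> complex) \<Rightarrow> 'a \<Rightarrow> complex"

definition is_gadget :: "('u, 's, 'a) gadget \<Rightarrow> bool" where
  "is_gadget X \<longleftrightarrow>
    (\<forall>R' \<in> RZ. \<forall>R \<in> RZ. \<forall>f \<in> rhom R' R. \<forall>x \<in> gfun X R'. gmap X R' R f x \<in> gfun X R) \<and>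
    (\<forall>R \<in> RZ. \<forall>x \<in> gfun X R. gmap X R R (\<lambda>a \<in> carrier R. a) x = x) \<and>
    (\<forall>R'' \<in> RZ. \<forall>R' \<in> RZ. \<forall>R \<in> RZ. \<forall>f \<in> rhom R'' R'. \<forall>g \<in> rhom R' R. \<forall>x \<in> gfun X R''.
      gmap X R'' R (compose (carrier R'') g f) x = gmap X R' R g (gmap X R'' R' f x)) \<and>
    C_algebra (galg X) \<and>
    (\<forall>R \<in> RZ. \<forall>\<sigma> \<in> rhom R CC. \<forall>x \<in> gfun X R. gev X R x \<sigma> \<in> alg_hom (galg X) CC_alg) \<and>
    (\<forall>R' \<in> RZ. \<forall>R \<in> RZ. \<forall>f \<in> rhom R' R. \<forall>y \<in> gfun X R'. \<forall>\<sigma> \<in> rhom R CC.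
      gev X R (gmap X R' R f y) \<sigma> = gev X R' y (compose (carrier R') \<sigma> f))"

definition finite_gadget :: "('u, 's, 'a) gadget \<Rightarrow> bool" where
  "finite_gadget X \<longleftrightarrow> is_gadget X \<and> (\<forall>R \<in> RZ. finite (gfun X R))"

record ('u, 's, 't, 'a, 'b) gmor =
  gtr :: "'u ring \<Rightarrow> 's \<Rightarrow> 't"
  gpull :: "'b \<Rightarrow> 'a"

definition gadget_hom ::
  "('u, 's, 'a) gadget \<Rightarrow> ('u, 't, 'b) gadget \<Rightarrow> ('u, 's, 't, 'a, 'b) gmor set" where
  "gadget_hom X Y = {\<phi>.
    gtr \<phi> \<in> (\<Pi>\<^sub>E R \<in> RZ. gfun X R \<rightarrow>\<^sub>E gfun Y R) \<and>
    (\<forall>R' \<in> RZ. \<forall>R \<in> RZ. \<forall>f \<in> rhom R' R. \<forall>x \<in> gfun X R'.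
      gtr \<phi> R (gmap X R' R f x) = gmap Y R' R f (gtr \<phi> R' x)) \<and>
    gpull \<phi> \<in> alg_hom (galg Y) (galg X) \<and>
    (\<forall>R \<in> RZ. \<forall>\<sigma> \<in> rhom R CC. \<forall>x \<in> gfun X R. \<forall>\<alpha> \<in> carrier (galg Y).
      gev Y R (gtr \<phi> R x) \<sigma> \<alpha> = gev X R x \<sigma> (gpull \<phi> \<alpha>))}"

definition gadget_immersion ::
  "('u, 's, 'a) gadget \<Rightarrow> ('u, 't, 'b) gadget \<Rightarrow> ('u, 's, 't, 'a, 'b) gmor \<Rightarrow> bool" where
  "gadget_immersion X Y \<phi> \<longleftrightarrow> \<phi> \<in> gadget_hom X Y \<and>
    (\<forall>R \<in> RZ. inj_on (gtr \<phi> R) (gfun X R)) \<and> inj_on (gpull \<phi>) (carrier (galg Y))"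

definition gadget_id :: "('u, 's, 'a) gadget \<Rightarrow> ('u, 's, 's, 'a, 'a) gmor" where
  "gadget_id X =
    \<lparr>gtr = (\<lambda>R \<in> RZ. \<lambda>x \<in> gfun X R. x), gpull = (\<lambda>\<alpha> \<in> carrier (galg X). \<alpha>)\<rparr>"

text \<open>The composite of \<open>\<phi> : X \<rightarrow> Y\<close> and \<open>\<psi> : Y \<rightarrow> Z\<close>; it depends on \<open>Y\<close> only through them.\<close>

definition gadget_comp ::
  "('u, 's, 'a) gadget \<Rightarrow> ('u, 'v, 'c) gadget \<Rightarrow>
    ('u, 't, 'v, 'b, 'c) gmor \<Rightarrow> ('u, 's, 't, 'a, 'b) gmor \<Rightarrow> ('u, 's, 'v, 'a, 'c) gmor" where
  "gadget_comp X Z \<psi> \<phi> =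
    \<lparr>gtr = (\<lambda>R \<in> RZ. compose (gfun X R) (gtr \<psi> R) (gtr \<phi> R)),
     gpull = compose (carrier (galg Z)) (gpull \<phi>) (gpull \<psi>)\<rparr>"

text \<open>The gadget of a scheme of finite type over \<open>\<int>\<close>. Every morphism of schemes is one over \<open>\<int>\<close>.\<close>

definition sch_gadget ::
  "('p, 'r) rspace \<Rightarrow>
    ('u, ('u set, 'u set \<Rightarrow> ('u \<times> 'u) set, 'p, 'r) smor, ('p, 'r) bc_fun) gadget" where
  "sch_gadget V =
    \<lparr>gfun = (\<lambda>R. sch_hom (Spec R) V),
     gmap = (\<lambda>R' R f x. sch_comp (Spec R) (Spec R') V x (Spec_map R' R f)),
     galg = fun_alg V,
     gev = (\<lambda>R x \<sigma>. eval_at V (sch_comp (Spec CC) (Spec R) V x (Spec_map R CC \<sigma>)))\<rparr>"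

definition sch_gmor ::
  "('p, 'r) rspace \<Rightarrow> ('q, 's) rspace \<Rightarrow> ('p, 'r, 'q, 's) smor \<Rightarrow>
    ('u, ('u set, 'u set \<Rightarrow> ('u \<times> 'u) set, 'p, 'r) smor,
         ('u set, 'u set \<Rightarrow> ('u \<times> 'u) set, 'q, 's) smor,
         ('p, 'r) bc_fun, ('q, 's) bc_fun) gmor" where
  "sch_gmor V W g =
    \<lparr>gtr = (\<lambda>R \<in> RZ. \<lambda>x \<in> sch_hom (Spec R) V. sch_comp (Spec R) V W g x),
     gpull = fun_pull V W g\<rparr>"

subsection \<open>Affine varieties over \<open>\<bbbF>\<^sub>1\<close>\<close>

type_synonym 'u sch = "('u, 'u) rspace"

type_synonym 'u sch_mor = "('u, 'u, 'u, 'u) smor"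

type_synonym 'u agad = "('u, 'u, 'u) gadget"

type_synonym 'u agad_mor = "('u, 'u, 'u, 'u, 'u) gmor"

type_synonym 'u agad_imm =
  "('u, 'u, ('u set, 'u set \<Rightarrow> ('u \<times> 'u) set, 'u, 'u) smor, 'u, ('u, 'u) bc_fun) gmor"

definition affine_ext :: "'u agad \<Rightarrow> 'u sch \<Rightarrow> 'u agad_imm \<Rightarrow> bool" where
  "affine_ext A Z i \<longleftrightarrow>
    affine_scheme Z \<and> ft_scheme Z \<and> gadget_immersion A (sch_gadget Z) i \<and>
    (\<forall>V :: 'u sch. affine_scheme V \<and> ft_scheme V \<longrightarrow>
      (\<forall>\<phi> \<in> gadget_hom A (sch_gadget V).
        \<exists>!\<psi>. \<psi> \<in> sch_hom Z V \<and> \<phi> = gadget_comp A (sch_gadget V) (sch_gmor Z V \<psi>) i))"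

definition AffF1 :: "'u agad set" where
  "AffF1 = {A. finite_gadget A \<and> (\<exists>Z i. affine_ext A Z i)}"

text \<open>The attached scheme and immersion are unique up to unique isomorphism; one choice is fixed.\<close>

definition aff_Z :: "'u agad \<Rightarrow> 'u sch" where
  "aff_Z A = fst (SOME (Z, i). affine_ext A Z i)"

definition aff_imm :: "'u agad \<Rightarrow> 'u agad_imm" where
  "aff_imm A = snd (SOME (Z, i). affine_ext A Z i)"

definition aff_mor_Z :: "'u agad \<Rightarrow> 'u agad \<Rightarrow> 'u agad_mor \<Rightarrow> 'u sch_mor" where
  "aff_mor_Z A B f = (THE g. g \<in> sch_hom (aff_Z A) (aff_Z B) \<and>
    gadget_comp A (sch_gadget (aff_Z B)) (aff_imm B) f =
    gadget_comp A (sch_gadget (aff_Z B)) (sch_gmor (aff_Z A) (aff_Z B) g) (aff_imm A))"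

section \<open>Objects and varieties over \<open>\<bbbF>\<^sub>1\<close>\<close>

record ('u, 's, 'a) fobj =
  ofun :: "'u agad \<Rightarrow> 's set"
  omap :: "'u agad \<Rightarrow> 'u agad \<Rightarrow> 'u agad_mor \<Rightarrow> 's \<Rightarrow> 's"
  oalg :: "(complex, 'a) module"
  oev :: "'u agad \<Rightarrow> 's \<Rightarrow> 'a \<Rightarrow> 'u"

text \<open>\<open>omap X A B f\<close> is the map from \<open>ofun X B\<close> to \<open>ofun X A\<close> attached to \<open>f : A \<rightarrow> B\<close>.\<close>

definition is_object :: "('u, 's, 'a) fobj \<Rightarrow> bool" where
  "is_object X \<longleftrightarrow>
    (\<forall>A \<in> AffF1. \<forall>B \<in> AffF1. \<forall>f \<in> gadget_hom A B. \<forall>x \<in> ofun X B. omap X A B f x \<in> ofun X A) \<and>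
    (\<forall>A \<in> AffF1. \<forall>x \<in> ofun X A. omap X A A (gadget_id A) x = x) \<and>
    (\<forall>A \<in> AffF1. \<forall>B \<in> AffF1. \<forall>C \<in> AffF1. \<forall>f \<in> gadget_hom A B. \<forall>g \<in> gadget_hom B C.
      \<forall>x \<in> ofun X C. omap X A C (gadget_comp A C g f) x = omap X A B f (omap X B C g x)) \<and>
    C_algebra (oalg X) \<and>
    (\<forall>A \<in> AffF1. \<forall>x \<in> ofun X A. oev X A x \<in> alg_hom (oalg X) (galg A)) \<and>
    (\<forall>A \<in> AffF1. \<forall>B \<in> AffF1. \<forall>f \<in> gadget_hom A B. \<forall>x \<in> ofun X B.
      oev X A (omap X A B f x) = compose (carrier (oalg X)) (gpull f) (oev X B x))"

record ('u, 's, 't, 'a, 'b) omor =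
  otr :: "'u agad \<Rightarrow> 's \<Rightarrow> 't"
  opull :: "'b \<Rightarrow> 'a"

definition obj_hom ::
  "('u, 's, 'a) fobj \<Rightarrow> ('u, 't, 'b) fobj \<Rightarrow> ('u, 's, 't, 'a, 'b) omor set" where
  "obj_hom X Y = {\<phi>.
    otr \<phi> \<in> (\<Pi>\<^sub>E A \<in> AffF1. ofun X A \<rightarrow>\<^sub>E ofun Y A) \<and>
    (\<forall>A \<in> AffF1. \<forall>B \<in> AffF1. \<forall>f \<in> gadget_hom A B. \<forall>x \<in> ofun X B.
      otr \<phi> A (omap X A B f x) = omap Y A B f (otr \<phi> B x)) \<and>
    opull \<phi> \<in> alg_hom (oalg Y) (oalg X) \<and>
    (\<forall>A \<in> AffF1. \<forall>x \<in> ofun X A.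
      oev Y A (otr \<phi> A x) = compose (carrier (oalg Y)) (oev X A x) (opull \<phi>))}"

definition obj_immersion ::
  "('u, 's, 'a) fobj \<Rightarrow> ('u, 't, 'b) fobj \<Rightarrow> ('u, 's, 't, 'a, 'b) omor \<Rightarrow> bool" where
  "obj_immersion X Y \<phi> \<longleftrightarrow> \<phi> \<in> obj_hom X Y \<and>
    (\<forall>A \<in> AffF1. inj_on (otr \<phi> A) (ofun X A)) \<and> inj_on (opull \<phi>) (carrier (oalg Y))"

text \<open>The composite of \<open>\<phi> : X \<rightarrow> Y\<close> and \<open>\<psi> : Y \<rightarrow> Z\<close>.\<close>

definition obj_comp ::
  "('u, 's, 'a) fobj \<Rightarrow> ('u, 'v, 'c) fobj \<Rightarrow>
    ('u, 't, 'v, 'b, 'c) omor \<Rightarrow> ('u, 's, 't, 'a, 'b) omor \<Rightarrow> ('u, 's, 'v, 'a, 'c) omor" where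
  "obj_comp X Z \<psi> \<phi> =
    \<lparr>otr = (\<lambda>A \<in> AffF1. compose (ofun X A) (otr \<psi> A) (otr \<phi> A)),
     opull = compose (carrier (oalg Z)) (opull \<phi>) (opull \<psi>)\<rparr>"

definition sch_obj :: "'u sch \<Rightarrow> ('u, 'u sch_mor, ('u, 'u) bc_fun) fobj" where
  "sch_obj V =
    \<lparr>ofun = (\<lambda>A. sch_hom (aff_Z A) V),
     omap = (\<lambda>A B f x. sch_comp (aff_Z A) (aff_Z B) V x (aff_mor_Z A B f)),
     oalg = fun_alg V,
     oev = (\<lambda>A x. compose (carrier (fun_alg V)) (gpull (aff_imm A)) (fun_pull (aff_Z A) V x))\<rparr>"

type_synonym ('u, 's, 'a) to_sch = "('u, 's, 'u sch_mor, 'a, ('u, 'u) bc_fun) omor"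

definition sch_omor ::
  "'u sch \<Rightarrow> 'u sch \<Rightarrow> 'u sch_mor \<Rightarrow> ('u, 'u sch_mor, ('u, 'u) bc_fun) to_sch" where
  "sch_omor V W g =
    \<lparr>otr = (\<lambda>A \<in> AffF1. \<lambda>x \<in> sch_hom (aff_Z A) V. sch_comp (aff_Z A) V W g x),
     opull = fun_pull V W g\<rparr>"

text \<open>\<open>Z\<close>, with the immersion \<open>i : X \<rightarrow> Z\<close>, is the extension of scalars of \<open>X\<close> to \<open>\<int>\<close>.\<close>

definition scalar_ext ::
  "('u, 's, 'a) fobj \<Rightarrow> 'u sch \<Rightarrow> ('u, 's, 'a) to_sch \<Rightarrow> bool" where
  "scalar_ext X Z i \<longleftrightarrow>
    ft_scheme Z \<and> obj_immersion X (sch_obj Z) i \<and>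
    (\<forall>V :: 'u sch. ft_scheme V \<longrightarrow>
      (\<forall>\<phi> \<in> obj_hom X (sch_obj V).
        \<exists>!\<psi>. \<psi> \<in> sch_hom Z V \<and> \<phi> = obj_comp X (sch_obj V) (sch_omor Z V \<psi>) i))"

definition variety_F1 :: "('u, 's, 'a) fobj \<Rightarrow> bool" where
  "variety_F1 X \<longleftrightarrow> is_object X \<and> (\<exists>Z i. scalar_ext X Z i)"

text \<open>The extension to \<open>\<int>\<close> of \<open>\<phi> : X \<rightarrow> V\<close>, and of a morphism \<open>f : X \<rightarrow> Y\<close> of varieties, where
  \<open>i : X \<rightarrow> Z\<close> and \<open>j : Y \<rightarrow> T\<close> are the extensions of scalars of \<open>X\<close> and \<open>Y\<close>.\<close>

definition ext_to_sch ::
  "('u, 's, 'a) fobj \<Rightarrow> 'u sch \<Rightarrow> ('u, 's, 'a) to_sch \<Rightarrow> 'u sch \<Rightarrow> ('u, 's, 'a) to_sch \<Rightarrow>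
    'u sch_mor" where
  "ext_to_sch X Z i V \<phi> =
    (THE \<psi>. \<psi> \<in> sch_hom Z V \<and> \<phi> = obj_comp X (sch_obj V) (sch_omor Z V \<psi>) i)"

definition ext_mor ::
  "('u, 's, 'a) fobj \<Rightarrow> 'u sch \<Rightarrow> ('u, 's, 'a) to_sch \<Rightarrow> 'u sch \<Rightarrow> ('u, 't, 'b) to_sch \<Rightarrow>
    ('u, 's, 't, 'a, 'b) omor \<Rightarrow> 'u sch_mor" where
  "ext_mor X Z i T j f = ext_to_sch X Z i T (obj_comp X (sch_obj T) j f)"

section \<open>Gluing\<close>

text \<open>\<open>\<phi> i\<close> is the immersion of the \<open>i\<close>-th variety in \<open>V\<close>, and \<open>\<kappa> i j\<close> the one of the \<open>(i, j)\<close>-th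
  variety in the \<open>i\<close>-th variety.\<close>

definition glued_alg ::
  "'i set \<Rightarrow> ('i \<Rightarrow> ('u, 's, 'a) fobj) \<Rightarrow> ('i \<Rightarrow> 'i \<Rightarrow> ('u, 't, 's, 'b, 'a) omor) \<Rightarrow>
    (complex, 'i \<Rightarrow> 'a) module" where
  "glued_alg I X \<kappa> = (prod_alg I (\<lambda>i. oalg (X i)))\<lparr>carrier :=
    {\<alpha> \<in> (\<Pi>\<^sub>E i \<in> I. carrier (oalg (X i))).
      \<forall>i \<in> I. \<forall>j \<in> I. i \<noteq> j \<longrightarrow> opull (\<kappa> i j) (\<alpha> i) = opull (\<kappa> j i) (\<alpha> j)}\<rparr>"

definition glued_obj ::
  "'u sch \<Rightarrow> 'i set \<Rightarrow> ('i \<Rightarrow> ('u, 's, 'a) fobj) \<Rightarrow> ('i \<Rightarrow> ('u, 's, 'a) to_sch) \<Rightarrow>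
    ('i \<Rightarrow> 'i \<Rightarrow> ('u, 't, 's, 'b, 'a) omor) \<Rightarrow> ('u agad \<Rightarrow> 'u sch_mor \<Rightarrow> ('i \<Rightarrow> 'a) \<Rightarrow> 'u) \<Rightarrow>
    ('u, 'u sch_mor, 'i \<Rightarrow> 'a) fobj" where
  "glued_obj V I X \<phi> \<kappa> e =
    \<lparr>ofun = (\<lambda>A. \<Union>i \<in> I. otr (\<phi> i) A ` ofun (X i) A),
     omap = omap (sch_obj V),
     oalg = glued_alg I X \<kappa>,
     oev = e\<rparr>"

text \<open>The inclusion of the union in \<open>V\<close>, with the restriction of functions on \<open>V\<^sub>\<complex>\<close> to the pieces.\<close>

definition glued_incl ::
  "'u sch \<Rightarrow> 'i set \<Rightarrow> ('i \<Rightarrow> ('u, 's, 'a) fobj) \<Rightarrow> ('i \<Rightarrow> ('u, 's, 'a) to_sch) \<Rightarrow>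
    ('u, 'u sch_mor, 'i \<Rightarrow> 'a) to_sch" where
  "glued_incl V I X \<phi> =
    \<lparr>otr = (\<lambda>A \<in> AffF1. \<lambda>x \<in> (\<Union>i \<in> I. otr (\<phi> i) A ` ofun (X i) A). x),
     opull = (\<lambda>\<beta> \<in> carrier (fun_alg V). \<lambda>i \<in> I. opull (\<phi> i) \<beta>)\<rparr>"

text \<open>At a point of the union that lies in the \<open>i\<close>-th piece, the evaluation is the \<open>i\<close>-th projection
  followed by the evaluation of the \<open>i\<close>-th variety. This determines \<open>e\<close> on the union. It is a
  condition on \<open>e\<close> and not a definition, because a point of two pieces need not be a point of the
  variety on their overlap, so that two projections could a priori give different values there.\<close>

definition evident_evaluation ::
  "'i set \<Rightarrow> ('i \<Rightarrow> ('u, 's, 'a) fobj) \<Rightarrow> ('i \<Rightarrow> ('u, 's, 'a) to_sch) \<Rightarrow>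
    ('i \<Rightarrow> 'i \<Rightarrow> ('u, 't, 's, 'b, 'a) omor) \<Rightarrow>
    ('u agad \<Rightarrow> 'u sch_mor \<Rightarrow> ('i \<Rightarrow> 'a) \<Rightarrow> 'u) \<Rightarrow> bool" where
  "evident_evaluation I X \<phi> \<kappa> e \<longleftrightarrow>
    (\<forall>i \<in> I. \<forall>A \<in> AffF1. \<forall>x \<in> ofun (X i) A.
      e A (otr (\<phi> i) A x) = compose (carrier (glued_alg I X \<kappa>)) (oev (X i) A x) (\<lambda>\<alpha>. \<alpha> i))"

end

theory Submission
  imports Defs
begin

text \<open>Each immersion \<open>\<phi> i\<close> is \<open>\<iota> i\<close> followed by the open inclusion of \<open>U i\<close> in \<open>V\<close>. A morphism from the glued
  object to a scheme \<open>W\<close> restricts to the pieces \<open>X\<^sub>i\<close>, and these restrictions extend to morphisms of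
  schemes \<open>g i : U i \<rightarrow> W\<close>. On \<open>U i \<inter> U j\<close> both \<open>g i\<close> and \<open>g j\<close> extend the same morphism from \<open>X\<^sub>i\<^sub>j\<close> to \<open>W\<close>,
  so they agree there and glue to a unique morphism \<open>V \<rightarrow> W\<close>. Restriction of functions to the
  pieces is injective because a single \<open>\<phi> i\<close> is already an immersion. The geometric input is
  the functoriality of stalk maps and of the pullback of functions on complexifications, and the
  gluing of local morphisms.\<close>

section \<open>Complexification\<close>

text \<open>The condition that cuts \<open>glued_alg\<close> out of the product has a double role.
  It is the algebra half of the statement that the restrictions of a morphism along two pieces agree
  on their overlap, the half on points being supplied by \<open>agree\<close>; and
  \<open>agree\<close> in turn makes every function on the complexification of V restrict to a
  family satisfying the condition. That \<open>U i\<close> and the overlaps are schemes, and that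
  the inclusions are morphisms of schemes, is read off from the hypotheses on extensions of scalars.
  Two features of the encoding shape the rest. Stalks, localisations and complexifications consist
  of classes, with operations given by unions over representatives, so each operation must be shown
  constant on classes before it can be used. And morphisms of objects are pairs of extensional
  functions, so equality of composites is traded for the pointwise relation
  \<open>factors_via\<close>: its half on points moves along composites by associativity, its half
  on functions by \<open>fun_pull_comp\<close>.\<close>

text \<open>Pairing with arbitrary test functions F turns convolutions and image sums into iterated
  finite sums, so that identities in the monoid algebra are proved by exchanging sums instead of
  comparing coefficients.\<close>

definition lin :: "('a \<Rightarrow> complex) \<Rightarrow> ('a \<Rightarrow> complex) \<Rightarrow> complex" where
  "lin \<phi> F = (\<Sum>a \<in> supp \<phi>. \<phi> a * F a)"

text \<open>The image of a formal sum under h, which is the sum occurring inside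
  \<open>cplx_map\<close>.\<close>

definition push :: "('a \<Rightarrow> 'b) \<Rightarrow> ('a \<Rightarrow> complex) \<Rightarrow> 'b \<Rightarrow> complex" where
  "push h \<phi> = (\<lambda>b. \<Sum>a \<in> {a \<in> supp \<phi>. h a = b}. \<phi> a)"

lemma lin_superset:
  assumes "finite S" "supp \<phi> \<subseteq> S"
  shows "lin \<phi> F = (\<Sum>a \<in> S. \<phi> a * F a)"
  unfolding lin_def using assms by (intro sum.mono_neutral_left) (auto simp: supp_def)

lemma lin_cong:
  "(\<And>a. a \<in> supp \<phi> \<Longrightarrow> F a = G a) \<Longrightarrow> lin \<phi> F = lin \<phi> G"
  unfolding lin_def by (auto intro: sum.cong)

lemma lin_swap: "lin \<phi> (\<lambda>a. lin \<psi> (\<lambda>b. F a b)) = lin \<psi> (\<lambda>b. lin \<phi> (\<lambda>a. F a b))"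
  unfolding lin_def sum_distrib_left
  by (subst sum.swap) (simp add: mult.left_commute)

lemma lin_indicator: "finite (supp \<phi>) \<Longrightarrow> lin \<phi> (\<lambda>a. of_bool (a = c)) = \<phi> c"
  unfolding lin_def by (simp add: of_bool_def if_distrib cong: if_cong) (simp add: supp_def)

text \<open>Indicator functions among the F recover the individual coefficients.\<close>

lemma lin_eqI:
  "finite (supp \<phi>) \<Longrightarrow> finite (supp \<psi>) \<Longrightarrow> (\<And>F. lin \<phi> F = lin \<psi> F) \<Longrightarrow> \<phi> = \<psi>"
  by (metis ext lin_indicator)

lemma lin_add:
  assumes "finite (supp \<phi>)" "finite (supp \<psi>)"
  shows "lin (\<lambda>c. \<phi> c + \<psi> c) F = lin \<phi> F + lin \<psi> F"
proof -
  have S: "finite (supp \<phi> \<union> supp \<psi>)" using assms by simp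
  have "supp (\<lambda>c. \<phi> c + \<psi> c) \<subseteq> supp \<phi> \<union> supp \<psi>" by (auto simp: supp_def)
  then show ?thesis
    by (simp add: lin_superset[OF S] sum.distrib[symmetric] algebra_simps)
qed

lemma supp_single: "supp (single z a) \<subseteq> {a}"
  by (auto simp: supp_def single_def)

lemma lin_single [simp]: "lin (single z a) F = z * F a"
  using lin_superset[of "{a}" "single z a" F] supp_single[of z a] by (simp add: single_def)

lemma finite_supp_single [simp]: "finite (supp (single z a))"
  by (rule finite_subset[OF supp_single]) simp

lemma finite_supp_diff: "finite (supp \<phi>) \<Longrightarrow> finite (supp \<psi>) \<Longrightarrow> finite (supp (\<lambda>c. \<phi> c - \<psi> c))"
  by (rule finite_subset[of _ "supp \<phi> \<union> supp \<psi>"]) (auto simp: supp_def)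

lemma lin_diff:
  assumes "finite (supp \<phi>)" "finite (supp \<psi>)"
  shows "lin (\<lambda>c. \<phi> c - \<psi> c) F = lin \<phi> F - lin \<psi> F"
proof -
  have S: "finite (supp \<phi> \<union> supp \<psi>)" using assms by simp
  have "supp (\<lambda>c. \<phi> c - \<psi> c) \<subseteq> supp \<phi> \<union> supp \<psi>" by (auto simp: supp_def)
  then show ?thesis
    by (simp add: lin_superset[OF S] sum_subtractf[symmetric] algebra_simps)
qed

lemma push_eq: "finite (supp \<phi>) \<Longrightarrow> push h \<phi> b = lin \<phi> (\<lambda>a. of_bool (h a = b))"
  unfolding push_def lin_def
  by (simp add: of_bool_def if_distrib sum.inter_filter cong: if_cong)

lemma supp_push: "supp (push h \<phi>) \<subseteq> h ` supp \<phi>"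
proof
  fix b assume "b \<in> supp (push h \<phi>)"
  then have "{a \<in> supp \<phi>. h a = b} \<noteq> {}"
    unfolding supp_def push_def by (metis (mono_tags, lifting) mem_Collect_eq sum.empty)
  then show "b \<in> h ` supp \<phi>" by blast
qed

lemma finite_supp_push: "finite (supp \<phi>) \<Longrightarrow> finite (supp (push h \<phi>))"
  by (meson finite_imageI finite_subset supp_push)

text \<open>Change of variables: the sum over the support is grouped by the fibres of h.\<close>

lemma lin_push:
  assumes "finite (supp \<phi>)"
  shows "lin (push h \<phi>) F = lin \<phi> (\<lambda>a. F (h a))"
proof -
  have "lin (push h \<phi>) F = (\<Sum>b \<in> h ` supp \<phi>. push h \<phi> b * F b)"
    using assms supp_push[of h \<phi>] by (intro lin_superset) auto
  also have "\<dots> = (\<Sum>b \<in> h ` supp \<phi>. \<Sum>a \<in> {a \<in> supp \<phi>. h a = b}. \<phi> a * F (h a))"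
    unfolding push_def sum_distrib_right by (intro sum.cong) auto
  also have "\<dots> = lin \<phi> (\<lambda>a. F (h a))"
    unfolding lin_def using assms by (rule sum.image_gen[symmetric])
  finally show ?thesis .
qed

lemma push_cong: "(\<And>a. a \<in> supp \<phi> \<Longrightarrow> h a = k a) \<Longrightarrow> push h \<phi> = push k \<phi>"
  unfolding push_def by (intro ext sum.cong) auto

lemma push_comp: "finite (supp \<phi>) \<Longrightarrow> push g (push h \<phi>) = push (\<lambda>a. g (h a)) \<phi>"
  by (intro lin_eqI) (simp_all add: finite_supp_push lin_push)

lemma push_single: "push h (single z a) = single z (h a)"
  by (intro lin_eqI) (simp_all add: finite_supp_push lin_push)

section \<open>The monoid algebra of a commutative ring\<close>

lemma monoid_alg_carrier: "\<phi> \<in> carrier (monoid_alg A) \<longleftrightarrow> finite (supp \<phi>) \<and> supp \<phi> \<subseteq> carrier A"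
  by (simp add: monoid_alg_def)

lemma monoid_alg_add: "\<phi> \<oplus>\<^bsub>monoid_alg A\<^esub> \<psi> = (\<lambda>c. \<phi> c + \<psi> c)"
  by (simp add: monoid_alg_def)

lemma monoid_alg_zero: "\<zero>\<^bsub>monoid_alg A\<^esub> = (\<lambda>_. 0)"
  by (simp add: monoid_alg_def)

lemma monoid_alg_one: "\<one>\<^bsub>monoid_alg A\<^esub> = single 1 \<one>\<^bsub>A\<^esub>"
  by (simp add: monoid_alg_def)

lemma monoid_alg_mult:
  assumes "finite (supp \<phi>)" "finite (supp \<psi>)"
  shows "(\<phi> \<otimes>\<^bsub>monoid_alg A\<^esub> \<psi>) c = lin \<phi> (\<lambda>a. lin \<psi> (\<lambda>b. of_bool (a \<otimes>\<^bsub>A\<^esub> b = c)))"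
proof -
  have "(\<phi> \<otimes>\<^bsub>monoid_alg A\<^esub> \<psi>) c =
      (\<Sum>p \<in> {p \<in> supp \<phi> \<times> supp \<psi>. fst p \<otimes>\<^bsub>A\<^esub> snd p = c}. \<phi> (fst p) * \<psi> (snd p))"
    unfolding monoid_alg_def by (auto intro!: sum.cong)
  also have "\<dots> = (\<Sum>p \<in> supp \<phi> \<times> supp \<psi>. \<phi> (fst p) * \<psi> (snd p) * of_bool (fst p \<otimes>\<^bsub>A\<^esub> snd p = c))"
    using assms by (subst sum.inter_filter) (simp_all add: of_bool_def if_distrib cong: if_cong)
  also have "\<dots> = lin \<phi> (\<lambda>a. lin \<psi> (\<lambda>b. of_bool (a \<otimes>\<^bsub>A\<^esub> b = c)))"
    unfolding lin_def sum_distrib_left sum.cartesian_product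
    by (auto intro!: sum.cong)
  finally show ?thesis .
qed

lemma supp_mult:
  assumes "finite (supp \<phi>)" "finite (supp \<psi>)"
  shows "supp (\<phi> \<otimes>\<^bsub>monoid_alg A\<^esub> \<psi>) \<subseteq> (\<lambda>(a, b). a \<otimes>\<^bsub>A\<^esub> b) ` (supp \<phi> \<times> supp \<psi>)"
proof
  fix c assume c: "c \<in> supp (\<phi> \<otimes>\<^bsub>monoid_alg A\<^esub> \<psi>)"
  show "c \<in> (\<lambda>(a, b). a \<otimes>\<^bsub>A\<^esub> b) ` (supp \<phi> \<times> supp \<psi>)"
  proof (rule ccontr)
    assume "\<not> ?thesis"
    then have "\<And>a b. a \<in> supp \<phi> \<Longrightarrow> b \<in> supp \<psi> \<Longrightarrow> a \<otimes>\<^bsub>A\<^esub> b \<noteq> c" by force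
    then have "(\<phi> \<otimes>\<^bsub>monoid_alg A\<^esub> \<psi>) c = 0"
      unfolding monoid_alg_mult[OF assms] by (simp add: lin_def)
    with c show False by (simp add: supp_def)
  qed
qed

lemma finite_supp_mult:
  assumes "finite (supp \<phi>)" "finite (supp \<psi>)"
  shows "finite (supp (\<phi> \<otimes>\<^bsub>monoid_alg A\<^esub> \<psi>))"
  using supp_mult[OF assms, of A] assms by (meson finite_SigmaI finite_imageI finite_subset)

text \<open>The product is the image of the product measure under multiplication of A, so pairing it
  with F is a double pairing. From this form the ring axioms follow from those of A.\<close>

lemma lin_mult:
  assumes "finite (supp \<phi>)" "finite (supp \<psi>)"
  shows "lin (\<phi> \<otimes>\<^bsub>monoid_alg A\<^esub> \<psi>) F = lin \<phi> (\<lambda>a. lin \<psi> (\<lambda>b. F (a \<otimes>\<^bsub>A\<^esub> b)))"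
proof -
  \<comment> \<open>A finite set containing the support of the product; summing over it lets the
    indicator of \<open>a \<otimes> b = c\<close> collapse the sum over c.\<close>
  let ?S = "(\<lambda>(a, b). a \<otimes>\<^bsub>A\<^esub> b) ` (supp \<phi> \<times> supp \<psi>)"
  have S: "finite ?S" using assms by blast
  have "lin (\<phi> \<otimes>\<^bsub>monoid_alg A\<^esub> \<psi>) F =
      (\<Sum>c \<in> ?S. \<Sum>a \<in> supp \<phi>. \<Sum>b \<in> supp \<psi>. \<phi> a * (\<psi> b * (of_bool (a \<otimes>\<^bsub>A\<^esub> b = c) * F c)))"
    unfolding lin_superset[OF S supp_mult[OF assms]] monoid_alg_mult[OF assms]
    by (simp add: lin_def sum_distrib_left sum_distrib_right mult.assoc)
  also have "\<dots> = (\<Sum>a \<in> supp \<phi>. \<Sum>b \<in> supp \<psi>. \<Sum>c \<in> ?S. \<phi> a * (\<psi> b * (of_bool (a \<otimes>\<^bsub>A\<^esub> b = c) * F c)))"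
    by (subst sum.swap, rule sum.cong[OF refl], subst sum.swap) (rule refl)
  also have "\<dots> = (\<Sum>a \<in> supp \<phi>. \<Sum>b \<in> supp \<psi>. \<phi> a * (\<psi> b * F (a \<otimes>\<^bsub>A\<^esub> b)))"
  proof (intro sum.cong refl)
    fix a b assume "a \<in> supp \<phi>" "b \<in> supp \<psi>"
    then have m: "a \<otimes>\<^bsub>A\<^esub> b \<in> ?S" by force
    have "(\<Sum>c \<in> ?S. \<phi> a * (\<psi> b * (of_bool (a \<otimes>\<^bsub>A\<^esub> b = c) * F c))) =
        (\<Sum>c \<in> ?S. if a \<otimes>\<^bsub>A\<^esub> b = c then \<phi> a * (\<psi> b * F c) else 0)"
      by (intro sum.cong) auto
    then show "(\<Sum>c \<in> ?S. \<phi> a * (\<psi> b * (of_bool (a \<otimes>\<^bsub>A\<^esub> b = c) * F c))) = \<phi> a * (\<psi> b * F (a \<otimes>\<^bsub>A\<^esub> b))"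
      using S m by simp
  qed
  also have "\<dots> = lin \<phi> (\<lambda>a. lin \<psi> (\<lambda>b. F (a \<otimes>\<^bsub>A\<^esub> b)))"
    by (simp add: lin_def sum_distrib_left)
  finally show ?thesis .
qed

lemma monoid_alg_cring:
  assumes "cring A"
  shows "cring (monoid_alg A)"
proof -
  interpret A: cring A by fact
  note C = monoid_alg_carrier
  have closed: "\<phi> \<otimes>\<^bsub>monoid_alg A\<^esub> \<psi> \<in> carrier (monoid_alg A)"
    if "\<phi> \<in> carrier (monoid_alg A)" "\<psi> \<in> carrier (monoid_alg A)" for \<phi> \<psi>
  proof -
    have f: "finite (supp \<phi>)" "finite (supp \<psi>)" and s: "supp \<phi> \<subseteq> carrier A" "supp \<psi> \<subseteq> carrier A"
      using that by (auto simp: C)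
    have "(\<lambda>(a, b). a \<otimes>\<^bsub>A\<^esub> b) ` (supp \<phi> \<times> supp \<psi>) \<subseteq> carrier A"
      using s by (auto intro!: A.m_closed)
    then show ?thesis
      using supp_mult[OF f, of A] finite_supp_mult[OF f, of A] unfolding C by blast
  qed
  have add_closed: "(\<lambda>c. \<phi> c + \<psi> c) \<in> carrier (monoid_alg A)"
    if "\<phi> \<in> carrier (monoid_alg A)" "\<psi> \<in> carrier (monoid_alg A)" for \<phi> \<psi>
  proof -
    have "supp (\<lambda>c. \<phi> c + \<psi> c) \<subseteq> supp \<phi> \<union> supp \<psi>" by (auto simp: supp_def)
    then show ?thesis using that unfolding C by (meson Un_least finite_Un finite_subset subset_trans)
  qed
  have one: "single 1 \<one>\<^bsub>A\<^esub> \<in> carrier (monoid_alg A)"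
    using supp_single[of 1 "\<one>\<^bsub>A\<^esub>"] unfolding C
    by (meson A.one_closed empty_subsetI finite.emptyI finite.insertI finite_subset insert_subset subset_trans)
  have eqI: "\<phi> = \<psi>" if "\<phi> \<in> carrier (monoid_alg A)" "\<psi> \<in> carrier (monoid_alg A)"
    "\<And>F. lin \<phi> F = lin \<psi> F" for \<phi> \<psi>
    using that lin_eqI by (auto simp: C)
  have fin: "finite (supp \<phi>)" if "\<phi> \<in> carrier (monoid_alg A)" for \<phi>
    using that by (simp add: C)
  \<comment> \<open>The laws of A hold on its carrier only; supports stay inside it, so they can be
    applied under \<open>lin_cong\<close>.\<close>
  have car: "a \<in> carrier A" if "\<phi> \<in> carrier (monoid_alg A)" "a \<in> supp \<phi>" for \<phi> a
    using that by (auto simp: C)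
  show ?thesis
  proof (intro cringI abelian_groupI comm_monoidI)
    fix \<phi> \<psi> \<chi> assume p: "\<phi> \<in> carrier (monoid_alg A)" "\<psi> \<in> carrier (monoid_alg A)" "\<chi> \<in> carrier (monoid_alg A)"
    show "\<phi> \<otimes>\<^bsub>monoid_alg A\<^esub> \<psi> \<otimes>\<^bsub>monoid_alg A\<^esub> \<chi> = \<phi> \<otimes>\<^bsub>monoid_alg A\<^esub> (\<psi> \<otimes>\<^bsub>monoid_alg A\<^esub> \<chi>)"
      using p by (intro eqI closed)
        (auto simp: lin_mult fin finite_supp_mult A.m_assoc car intro!: lin_cong)
    show "(\<phi> \<oplus>\<^bsub>monoid_alg A\<^esub> \<psi>) \<otimes>\<^bsub>monoid_alg A\<^esub> \<chi> =
        \<phi> \<otimes>\<^bsub>monoid_alg A\<^esub> \<chi> \<oplus>\<^bsub>monoid_alg A\<^esub> \<psi> \<otimes>\<^bsub>monoid_alg A\<^esub> \<chi>"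
      unfolding monoid_alg_add using p
      by (intro eqI closed add_closed) (auto simp: lin_mult lin_add fin add_closed closed)
  next
    fix \<phi> \<psi> assume p: "\<phi> \<in> carrier (monoid_alg A)" "\<psi> \<in> carrier (monoid_alg A)"
    show "\<phi> \<otimes>\<^bsub>monoid_alg A\<^esub> \<psi> = \<psi> \<otimes>\<^bsub>monoid_alg A\<^esub> \<phi>"
    proof (intro eqI closed p)
      fix F
      show "lin (\<phi> \<otimes>\<^bsub>monoid_alg A\<^esub> \<psi>) F = lin (\<psi> \<otimes>\<^bsub>monoid_alg A\<^esub> \<phi>) F"
        using p by (auto simp: lin_mult fin lin_swap[of \<psi>] A.m_comm car intro!: lin_cong)
    qed
  next
    fix \<phi> assume p: "\<phi> \<in> carrier (monoid_alg A)"
    show "\<one>\<^bsub>monoid_alg A\<^esub> \<otimes>\<^bsub>monoid_alg A\<^esub> \<phi> = \<phi>"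
      unfolding monoid_alg_one using p one
      by (intro eqI closed) (auto simp: lin_mult fin car intro!: lin_cong)
    show "\<exists>y\<in>carrier (monoid_alg A). y \<oplus>\<^bsub>monoid_alg A\<^esub> \<phi> = \<zero>\<^bsub>monoid_alg A\<^esub>"
      using p by (intro bexI[of _ "\<lambda>c. - \<phi> c"]) (auto simp: monoid_alg_def supp_def)
  qed (auto simp: monoid_alg_add monoid_alg_zero monoid_alg_one closed add_closed one add_ac
      intro!: closed add_closed one, auto simp: C supp_def)
qed

text \<open>Tested against F, multiplicativity of \<open>push h\<close> is multiplicativity of h on
  pairs of points of the supports.\<close>

lemma push_hom:
  assumes "cring A" "cring B" "h \<in> ring_hom A B"
  shows "push h \<in> ring_hom (monoid_alg A) (monoid_alg B)"
proof (rule ring_hom_memI)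
  note hc = ring_hom_closed[OF assms(3)]
  show "push h \<phi> \<in> carrier (monoid_alg B)" if "\<phi> \<in> carrier (monoid_alg A)" for \<phi>
    using that supp_push[of h \<phi>] hc unfolding monoid_alg_carrier by (auto simp: finite_supp_push)
  fix \<phi> \<psi> assume p: "\<phi> \<in> carrier (monoid_alg A)" "\<psi> \<in> carrier (monoid_alg A)"
  then have f: "finite (supp \<phi>)" "finite (supp \<psi>)" by (auto simp: monoid_alg_carrier)
  show "push h (\<phi> \<otimes>\<^bsub>monoid_alg A\<^esub> \<psi>) = push h \<phi> \<otimes>\<^bsub>monoid_alg B\<^esub> push h \<psi>"
  proof (rule lin_eqI)
    fix F
    show "lin (push h (\<phi> \<otimes>\<^bsub>monoid_alg A\<^esub> \<psi>)) F = lin (push h \<phi> \<otimes>\<^bsub>monoid_alg B\<^esub> push h \<psi>) F"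
      using p f by (auto simp: lin_push lin_mult finite_supp_push finite_supp_mult
          ring_hom_mult[OF assms(3)] monoid_alg_carrier subset_iff intro!: lin_cong)
  qed (simp_all add: f finite_supp_push finite_supp_mult)
  have "finite (supp (\<lambda>c. \<phi> c + \<psi> c))"
    by (rule finite_subset[of _ "supp \<phi> \<union> supp \<psi>"]) (auto simp: supp_def f[unfolded supp_def])
  then show "push h (\<phi> \<oplus>\<^bsub>monoid_alg A\<^esub> \<psi>) = push h \<phi> \<oplus>\<^bsub>monoid_alg B\<^esub> push h \<psi>"
    unfolding monoid_alg_add using f
    by (auto simp: push_eq lin_add)
next
  show "push h \<one>\<^bsub>monoid_alg A\<^esub> = \<one>\<^bsub>monoid_alg B\<^esub>"
    by (simp add: monoid_alg_one push_single ring_hom_one[OF assms(3)])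
qed

section \<open>The additivity ideal and functoriality of complexification\<close>

lemma cplx_gen_subset:
  assumes "cring A"
  shows "{\<lambda>c. single 1 (a \<oplus>\<^bsub>A\<^esub> b) c - single 1 a c - single 1 b c | a b.
      a \<in> carrier A \<and> b \<in> carrier A} \<subseteq> carrier (monoid_alg A)"
proof clarify
  interpret A: cring A by fact
  fix a b assume ab: "a \<in> carrier A" "b \<in> carrier A"
  have "supp (\<lambda>c. single 1 (a \<oplus>\<^bsub>A\<^esub> b) c - single 1 a c - single 1 b c) \<subseteq> {a \<oplus>\<^bsub>A\<^esub> b, a, b}"
    by (auto simp: supp_def single_def split: if_splits)
  then show "(\<lambda>c. single 1 (a \<oplus>\<^bsub>A\<^esub> b) c - single 1 a c - single 1 b c) \<in> carrier (monoid_alg A)"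
    unfolding monoid_alg_carrier using ab
    by (meson A.add.m_closed empty_subsetI finite.emptyI finite.insertI finite_subset insert_subset subset_trans)
qed

lemma cplx_ideal_ideal:
  assumes "cring A"
  shows "ideal (cplx_ideal A) (monoid_alg A)"
proof -
  interpret cring "monoid_alg A" by (rule monoid_alg_cring) fact
  show ?thesis
    unfolding cplx_ideal_def by (rule genideal_ideal) (rule cplx_gen_subset[OF assms])
qed

lemma cplx_cring: "cring A \<Longrightarrow> cring (cplx A)"
  unfolding cplx_def by (intro ideal.quotient_is_cring cplx_ideal_ideal monoid_alg_cring)

lemma cplx_class_hom:
  assumes "cring A"
  shows "cplx_class A \<in> ring_hom (monoid_alg A) (cplx A)"
  using ideal.rcos_ring_hom[OF cplx_ideal_ideal[OF assms]]
  unfolding cplx_class_def[abs_def] cplx_def by simp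

lemma cplx_carrierE:
  assumes "k \<in> carrier (cplx A)"
  obtains \<phi> where "\<phi> \<in> carrier (monoid_alg A)" "k = cplx_class A \<phi>"
  using assms unfolding cplx_def cplx_class_def FactRing_simps by auto

text \<open>The preimage of the ideal of B is an ideal of the monoid algebra of A; it contains the
  generators, hence the ideal they generate.\<close>

lemma push_cplx_ideal:
  assumes "cring A" "cring B" "h \<in> ring_hom A B" "\<phi> \<in> cplx_ideal A"
  shows "push h \<phi> \<in> cplx_ideal B"
proof -
  interpret A: cring "monoid_alg A" by (rule monoid_alg_cring) fact
  interpret B: cring "monoid_alg B" by (rule monoid_alg_cring) fact
  interpret A0: cring A by fact
  interpret H: ring_hom_ring "monoid_alg A" "monoid_alg B" "push h"
    by (rule ring_hom_ringI2[OF A.ring_axioms B.ring_axioms push_hom[OF assms(1-3)]])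
  let ?J = "{r \<in> carrier (monoid_alg A). push h r \<in> cplx_ideal B}"
  have J: "ideal ?J (monoid_alg A)"
    by (rule H.ideal_vimage) (rule cplx_ideal_ideal[OF assms(2)])
  have "cplx_ideal A \<subseteq> ?J"
    unfolding cplx_ideal_def[of A]
  proof (rule A.genideal_minimal[OF J], clarify, rule conjI)
    fix a b assume ab: "a \<in> carrier A" "b \<in> carrier A"
    let ?g = "\<lambda>c. single 1 (a \<oplus>\<^bsub>A\<^esub> b) c - single 1 a c - single 1 b c"
    let ?k = "\<lambda>c. single 1 (h a \<oplus>\<^bsub>B\<^esub> h b) c - single 1 (h a) c - single 1 (h b) c"
    show gc: "?g \<in> carrier (monoid_alg A)" using cplx_gen_subset[OF assms(1)] ab by blast
    have kc: "?k \<in> carrier (monoid_alg B)"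
      using cplx_gen_subset[OF assms(2)] ab ring_hom_closed[OF assms(3)] by blast
    have gl: "lin ?g F = F (a \<oplus>\<^bsub>A\<^esub> b) - F a - F b" for F
      by (simp add: lin_diff finite_supp_diff)
    have kl: "lin ?k F = F (h a \<oplus>\<^bsub>B\<^esub> h b) - F (h a) - F (h b)" for F
      by (simp add: lin_diff finite_supp_diff)
    \<comment> \<open>Additivity of h carries the generator of the pair (a, b) to the generator of
      (h a, h b).\<close>
    have "push h ?g = ?k"
    proof (rule lin_eqI)
      fix F show "lin (push h ?g) F = lin ?k F"
        using gc unfolding kl by (simp add: lin_push monoid_alg_carrier gl ring_hom_add[OF assms(3) ab])
    qed (use gc kc in \<open>auto simp: monoid_alg_carrier finite_supp_push\<close>)
    moreover have "?k \<in> cplx_ideal B"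
      unfolding cplx_ideal_def
      by (rule subsetD[OF B.genideal_self[OF cplx_gen_subset[OF assms(2)]]])
        (use ab ring_hom_closed[OF assms(3)] in blast)
    ultimately show "push h ?g \<in> cplx_ideal B" by simp
  qed
  then show ?thesis using assms(4) by blast
qed

lemma cplx_class_eq_iff:
  assumes "cring A" "\<phi> \<in> carrier (monoid_alg A)" "\<psi> \<in> carrier (monoid_alg A)"
  shows "cplx_class A \<phi> = cplx_class A \<psi> \<longleftrightarrow> \<phi> \<ominus>\<^bsub>monoid_alg A\<^esub> \<psi> \<in> cplx_ideal A"
  unfolding cplx_class_def
  by (rule ring.quotient_eq_iff_same_a_r_cos[OF cring.axioms(1)[OF monoid_alg_cring[OF assms(1)]]
        cplx_ideal_ideal[OF assms(1)] assms(2,3), symmetric])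

lemma cplx_class_memD:
  assumes "cring A" "\<phi> \<in> carrier (monoid_alg A)" "\<psi> \<in> cplx_class A \<phi>"
  shows "\<psi> \<in> carrier (monoid_alg A) \<and> cplx_class A \<psi> = cplx_class A \<phi>"
proof -
  interpret I: ideal "cplx_ideal A" "monoid_alg A" by (rule cplx_ideal_ideal) fact
  show ?thesis
    using I.a_repr_independence'[OF assms(3)[unfolded cplx_class_def] assms(2)]
      I.a_elemrcos_carrier[OF assms(2) assms(3)[unfolded cplx_class_def]]
    unfolding cplx_class_def by simp
qed

text \<open>Well-definedness: all representatives of a class have images differing by elements of
  the ideal of B, so the union defining \<open>cplx_map\<close> is a union of copies of one
  class.\<close>

lemma cplx_map_class:
  assumes "cring A" "cring B" "h \<in> ring_hom A B" "\<phi> \<in> carrier (monoid_alg A)"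
  shows "cplx_map B h (cplx_class A \<phi>) = cplx_class B (push h \<phi>)"
proof -
  interpret A: cring "monoid_alg A" by (rule monoid_alg_cring) fact
  interpret B: cring "monoid_alg B" by (rule monoid_alg_cring) fact
  interpret H: ring_hom_ring "monoid_alg A" "monoid_alg B" "push h"
    by (rule ring_hom_ringI2[OF A.ring_axioms B.ring_axioms push_hom[OF assms(1-3)]])
  interpret I: ideal "cplx_ideal A" "monoid_alg A" by (rule cplx_ideal_ideal) fact
  have same: "cplx_class B (push h \<psi>) = cplx_class B (push h \<phi>)" if "\<psi> \<in> cplx_class A \<phi>" for \<psi>
  proof -
    have p: "\<psi> \<in> carrier (monoid_alg A)" "cplx_class A \<psi> = cplx_class A \<phi>"
      using cplx_class_memD[OF assms(1,4) that] by auto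
    then have "push h (\<psi> \<ominus>\<^bsub>monoid_alg A\<^esub> \<phi>) \<in> cplx_ideal B"
      using push_cplx_ideal[OF assms(1-3)] cplx_class_eq_iff[OF assms(1) _ assms(4)] by blast
    moreover have "push h (\<psi> \<ominus>\<^bsub>monoid_alg A\<^esub> \<phi>) = push h \<psi> \<ominus>\<^bsub>monoid_alg B\<^esub> push h \<phi>"
      using p assms(4) by (simp add: a_minus_def)
    ultimately show ?thesis
      using cplx_class_eq_iff[OF assms(2)] p assms(4) by simp
  qed
  have "\<phi> \<in> cplx_class A \<phi>"
    unfolding cplx_class_def using assms(4) I.a_rcos_self by blast
  then have "(\<Union>\<psi> \<in> cplx_class A \<phi>. cplx_class B (push h \<psi>)) = cplx_class B (push h \<phi>)"
    using same by blast
  then show ?thesis by (simp add: cplx_map_def push_def)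
qed

lemma cplx_map_hom:
  assumes "cring A" "cring B" "h \<in> ring_hom A B"
  shows "cplx_map B h \<in> ring_hom (cplx A) (cplx B)"
proof (rule ring_hom_memI)
  note P = push_hom[OF assms] and KA = cplx_class_hom[OF assms(1)] and KB = cplx_class_hom[OF assms(2)]
  interpret A: cring "monoid_alg A" by (rule monoid_alg_cring) fact
  note M = cplx_map_class[OF assms]
  show "cplx_map B h k \<in> carrier (cplx B)" if "k \<in> carrier (cplx A)" for k
    using that by (elim cplx_carrierE) (simp add: M ring_hom_closed[OF P] ring_hom_closed[OF KB])
  fix k l assume "k \<in> carrier (cplx A)" "l \<in> carrier (cplx A)"
  then obtain \<phi> \<psi> where p: "\<phi> \<in> carrier (monoid_alg A)" "\<psi> \<in> carrier (monoid_alg A)"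
    and e: "k = cplx_class A \<phi>" "l = cplx_class A \<psi>" by (metis cplx_carrierE)
  note c = ring_hom_closed[OF P p(1)] ring_hom_closed[OF P p(2)]
  show "cplx_map B h (k \<otimes>\<^bsub>cplx A\<^esub> l) = cplx_map B h k \<otimes>\<^bsub>cplx B\<^esub> cplx_map B h l"
    unfolding e using p
    by (simp add: M ring_hom_mult[OF KA, symmetric] ring_hom_mult[OF KB, symmetric] c ring_hom_mult[OF P])
  show "cplx_map B h (k \<oplus>\<^bsub>cplx A\<^esub> l) = cplx_map B h k \<oplus>\<^bsub>cplx B\<^esub> cplx_map B h l"
    unfolding e using p
    by (simp add: M ring_hom_add[OF KA, symmetric] ring_hom_add[OF KB, symmetric] c ring_hom_add[OF P])
next
  interpret A: cring "monoid_alg A" by (rule monoid_alg_cring) fact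
  show "cplx_map B h \<one>\<^bsub>cplx A\<^esub> = \<one>\<^bsub>cplx B\<^esub>"
    using cplx_map_class[OF assms A.one_closed] ring_hom_one[OF cplx_class_hom[OF assms(1)]]
      ring_hom_one[OF cplx_class_hom[OF assms(2)]] ring_hom_one[OF push_hom[OF assms]] by simp
qed

text \<open>The composite enters as a separate k that agrees with \<open>g \<circ> h\<close> on the
  carrier: stalk maps and germ maps satisfy their composition laws only there.\<close>

lemma cplx_map_comp:
  assumes "cring A" "cring B" "cring C" "h \<in> ring_hom A B" "g \<in> ring_hom B C"
    and "k \<in> ring_hom A C" "\<And>a. a \<in> carrier A \<Longrightarrow> k a = g (h a)" "x \<in> carrier (cplx A)"
  shows "cplx_map C k x = cplx_map C g (cplx_map B h x)"
proof -
  obtain \<phi> where p: "\<phi> \<in> carrier (monoid_alg A)" "x = cplx_class A \<phi>"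
    using assms(8) by (rule cplx_carrierE)
  have "push k \<phi> = push g (push h \<phi>)"
    using p(1) assms(7) by (subst push_comp) (auto simp: monoid_alg_carrier intro!: push_cong)
  then show ?thesis
    using p assms ring_hom_closed[OF push_hom[OF assms(1,2,4)] p(1)] by (simp add: cplx_map_class)
qed

lemma single_closed:
  assumes "a \<in> carrier A"
  shows "single z a \<in> carrier (monoid_alg A)"
  using supp_single[of z a] assms
  unfolding monoid_alg_carrier by auto

section \<open>Localisation\<close>

text \<open>The common form of all well-definedness arguments: a union over representatives equals
  the common value, given one representative p.\<close>

lemma UN_pair_eqI:
  "p \<in> A \<Longrightarrow> (\<And>a b. (a, b) \<in> A \<Longrightarrow> F a b = C) \<Longrightarrow> (\<Union>(a, b) \<in> A. F a b) = C"
  by (rule UN_constant_eq) auto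

lemma loc_frac_self:
  assumes "primeideal P R" "a \<in> carrier R" "b \<in> carrier R - P"
  shows "(a, b) \<in> loc_frac R P a b"
proof -
  interpret primeideal P R by fact
  have "\<one>\<^bsub>R\<^esub> \<notin> P" using I_notcarr one_imp_carrier by blast
  then show ?thesis using assms(2,3) unfolding loc_frac_def by blast
qed

text \<open>\<open>loc_frac\<close> is the class of a fraction for an equivalence relation whose
  only delicate property is transitivity; symmetry is built into the proof by running it in both
  directions.\<close>

lemma loc_frac_eqI:
  assumes P: "primeideal P R" and a: "a \<in> carrier R" "b \<in> carrier R - P"
    and cd: "(c, d) \<in> loc_frac R P a b"
  shows "loc_frac R P c d = loc_frac R P a b"
proof -
  interpret primeideal P R by fact
  have mclosed: "s \<otimes>\<^bsub>R\<^esub> t \<in> carrier R - P" if "s \<in> carrier R - P" "t \<in> carrier R - P" for s t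
    using that I_prime by auto
  have trans: "\<exists>t \<in> carrier R - P. t \<otimes>\<^bsub>R\<^esub> (a \<otimes>\<^bsub>R\<^esub> f) = t \<otimes>\<^bsub>R\<^esub> (e \<otimes>\<^bsub>R\<^esub> b)"
    if c: "a \<in> carrier R" "c \<in> carrier R" "e \<in> carrier R"
        "b \<in> carrier R - P" "d \<in> carrier R - P" "f \<in> carrier R - P"
        "t \<in> carrier R - P" "u \<in> carrier R - P"
      and e: "t \<otimes>\<^bsub>R\<^esub> (a \<otimes>\<^bsub>R\<^esub> d) = t \<otimes>\<^bsub>R\<^esub> (c \<otimes>\<^bsub>R\<^esub> b)"
        "u \<otimes>\<^bsub>R\<^esub> (c \<otimes>\<^bsub>R\<^esub> f) = u \<otimes>\<^bsub>R\<^esub> (e \<otimes>\<^bsub>R\<^esub> d)" for a b c d e f t u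
  proof -
    have k: "b \<in> carrier R" "d \<in> carrier R" "f \<in> carrier R" "t \<in> carrier R" "u \<in> carrier R"
      using c by auto
    \<comment> \<open>The multiplier is t u d: t and u activate the two given equations, and the
      middle denominator d is the factor left over. It avoids P because P is prime.\<close>
    have "(t \<otimes>\<^bsub>R\<^esub> (u \<otimes>\<^bsub>R\<^esub> d)) \<otimes>\<^bsub>R\<^esub> (a \<otimes>\<^bsub>R\<^esub> f) = (u \<otimes>\<^bsub>R\<^esub> f) \<otimes>\<^bsub>R\<^esub> (t \<otimes>\<^bsub>R\<^esub> (a \<otimes>\<^bsub>R\<^esub> d))"
      using c k by (simp add: m_ac)
    also have "\<dots> = (t \<otimes>\<^bsub>R\<^esub> b) \<otimes>\<^bsub>R\<^esub> (u \<otimes>\<^bsub>R\<^esub> (c \<otimes>\<^bsub>R\<^esub> f))"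
      unfolding e(1) using c k by (simp add: m_ac)
    also have "\<dots> = (t \<otimes>\<^bsub>R\<^esub> (u \<otimes>\<^bsub>R\<^esub> d)) \<otimes>\<^bsub>R\<^esub> (e \<otimes>\<^bsub>R\<^esub> b)"
      unfolding e(2) using c k by (simp add: m_ac)
    finally show ?thesis
      using mclosed[OF c(7) mclosed[OF c(8) c(5)]] by (rule bexI)
  qed
  obtain t where cd': "c \<in> carrier R" "d \<in> carrier R - P" "t \<in> carrier R - P"
    and t: "t \<otimes>\<^bsub>R\<^esub> (a \<otimes>\<^bsub>R\<^esub> d) = t \<otimes>\<^bsub>R\<^esub> (c \<otimes>\<^bsub>R\<^esub> b)"
    using cd unfolding loc_frac_def by blast
  show ?thesis
  proof (intro subset_antisym subrelI)
    fix e f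
    show "(e, f) \<in> loc_frac R P a b" if "(e, f) \<in> loc_frac R P c d"
      using that trans[OF a(1) cd'(1) _ a(2) cd'(2) _ cd'(3) _ t] unfolding loc_frac_def by auto
    show "(e, f) \<in> loc_frac R P c d" if "(e, f) \<in> loc_frac R P a b"
      using that trans[OF cd'(1) a(1) _ cd'(2) a(2) _ cd'(3) _ t[symmetric]] unfolding loc_frac_def by auto
  qed
qed

text \<open>With P the preimage of Q, denominators and multipliers outside P map outside Q, so
  equivalent fractions have equivalent images.\<close>

lemma loc_map_frac:
  assumes Q: "primeideal Q S" and R: "cring R" and h: "h \<in> ring_hom R S"
    and P: "P = {a \<in> carrier R. h a \<in> Q}"
    and a: "a \<in> carrier R" "b \<in> carrier R - P"
  shows "loc_map S Q h (loc_frac R P a b) = loc_frac S Q (h a) (h b)"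
proof -
  interpret Q: primeideal Q S by fact
  interpret R: cring R by fact
  interpret H: ring_hom_ring R S h by (rule ring_hom_ringI2[OF R.ring_axioms Q.ring_axioms h])
  have P': "primeideal P R" unfolding P by (rule H.primeideal_vimage[OF R Q])
  have b': "h b \<in> carrier S - Q" using a P by auto
  have "loc_frac S Q (h c) (h d) = loc_frac S Q (h a) (h b)" if cd: "(c, d) \<in> loc_frac R P a b" for c d
  proof (rule loc_frac_eqI[OF Q _ b'])
    obtain t where t: "c \<in> carrier R" "d \<in> carrier R - P" "t \<in> carrier R - P"
      "t \<otimes>\<^bsub>R\<^esub> (a \<otimes>\<^bsub>R\<^esub> d) = t \<otimes>\<^bsub>R\<^esub> (c \<otimes>\<^bsub>R\<^esub> b)"
      using cd unfolding loc_frac_def by blast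
    have "h t \<otimes>\<^bsub>S\<^esub> (h a \<otimes>\<^bsub>S\<^esub> h d) = h t \<otimes>\<^bsub>S\<^esub> (h c \<otimes>\<^bsub>S\<^esub> h b)"
      using arg_cong[OF t(4), of h] t(1-3) a by simp
    moreover have "h t \<in> carrier S - Q" "h d \<in> carrier S - Q" "h c \<in> carrier S"
      using t P by auto
    ultimately show "(h c, h d) \<in> loc_frac S Q (h a) (h b)" unfolding loc_frac_def by blast
  qed (use a in auto)
  moreover have "(a, b) \<in> loc_frac R P a b" by (rule loc_frac_self[OF P' a])
  ultimately show ?thesis unfolding loc_map_def by (intro UN_pair_eqI)
qed

section \<open>Stalks and morphisms of locally ringed spaces\<close>

lemma locally_ringed_ringed: "locally_ringed X \<Longrightarrow> ringed_space X"
  by (simp add: locally_ringed_def)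

section \<open>Ringed spaces: gluing sections over indexed covers\<close>

context
  fixes X :: "('p, 'r) rspace"
  assumes X: "ringed_space X"
begin

lemma sec_cring: "opn X U \<Longrightarrow> cring (sec X U)"
  using conjunct1[OF X[unfolded ringed_space_def]] by simp

lemma res_hom: "opn X U \<Longrightarrow> opn X W \<Longrightarrow> W \<subseteq> U \<Longrightarrow> res X U W \<in> ring_hom (sec X U) (sec X W)"
  using X[unfolded ringed_space_def, THEN conjunct2, THEN conjunct1] by simp

lemma res_closed: "opn X U \<Longrightarrow> opn X W \<Longrightarrow> W \<subseteq> U \<Longrightarrow> s \<in> carrier (sec X U) \<Longrightarrow> res X U W s \<in> carrier (sec X W)"
  by (rule ring_hom_closed[OF res_hom])

lemma res_self: "opn X U \<Longrightarrow> s \<in> carrier (sec X U) \<Longrightarrow> res X U U s = s"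
  using X[unfolded ringed_space_def, THEN conjunct2, THEN conjunct2, THEN conjunct1] by simp

lemma res_res:
  "opn X U \<Longrightarrow> opn X W \<Longrightarrow> opn X N \<Longrightarrow> N \<subseteq> W \<Longrightarrow> W \<subseteq> U \<Longrightarrow> s \<in> carrier (sec X U) \<Longrightarrow>
    res X W N (res X U W s) = res X U N s"
  using X[unfolded ringed_space_def, THEN conjunct2, THEN conjunct2, THEN conjunct2, THEN conjunct1] by simp

text \<open>The sheaf axiom speaks of families of sections indexed by the open sets themselves; this
  is the version for an arbitrary index set, where several indices may give the same open
  set.\<close>

lemma glue_sections:
  assumes "\<And>i. i \<in> I \<Longrightarrow> opn X (N i)" "\<And>i. i \<in> I \<Longrightarrow> s i \<in> carrier (sec X (N i))"
    and compat: "\<And>i j. i \<in> I \<Longrightarrow> j \<in> I \<Longrightarrow>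
      res X (N i) (N i \<inter> N j) (s i) = res X (N j) (N i \<inter> N j) (s j)"
  shows "\<exists>!t. t \<in> carrier (sec X (\<Union>i \<in> I. N i)) \<and> (\<forall>i \<in> I. res X (\<Union>i \<in> I. N i) (N i) t = s i)"
proof -
  \<comment> \<open>One index is chosen for each open set. If \<open>N j = N i\<close>,
    compatibility over \<open>N i \<inter> N j\<close> forces \<open>s j = s i\<close>, so the
    choice is harmless.\<close>
  define s' where "s' M = s (SOME i. i \<in> I \<and> N i = M)" for M
  have s': "\<exists>j \<in> I. N j = N i \<and> s' (N i) = s j" if "i \<in> I" for i
    using someI[of "\<lambda>j. j \<in> I \<and> N j = N i" i] that unfolding s'_def by blast
  have eq: "s' (N i) = s i" if i: "i \<in> I" for i
  proof -
    obtain j where j: "j \<in> I" "N j = N i" "s' (N i) = s j" using s'[OF i] by blast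
    have "s j = s i"
      using compat[OF j(1) i] j(2) assms(1)[OF i] assms(2)[OF i] assms(2)[OF j(1)] by (simp add: res_self)
    with j show ?thesis by simp
  qed
  let ?U = "N ` I"
  have "\<forall>U \<in> ?U. opn X U \<and> s' U \<in> carrier (sec X U)"
    using assms(1,2) eq by simp
  moreover have "\<forall>U \<in> ?U. \<forall>W \<in> ?U. res X U (U \<inter> W) (s' U) = res X W (U \<inter> W) (s' W)"
  proof (intro ballI, elim imageE)
    fix U W i j assume "U = N i" "i \<in> I" "W = N j" "j \<in> I"
    then show "res X U (U \<inter> W) (s' U) = res X W (U \<inter> W) (s' W)"
      using compat[of i j] eq by simp
  qed
  ultimately have "\<exists>!t. t \<in> carrier (sec X (\<Union>?U)) \<and> (\<forall>U \<in> ?U. res X (\<Union>?U) U t = s' U)"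
    using X[unfolded ringed_space_def, THEN conjunct2, THEN conjunct2, THEN conjunct2, THEN conjunct2,
        rule_format, of ?U s'] by (rule_tac mp) auto
  then show ?thesis using eq by simp
qed

text \<open>The restrictions of s form a compatible family of which both s and t are gluings;
  uniqueness of gluing concludes.\<close>

lemma section_eqI:
  assumes "\<And>i. i \<in> I \<Longrightarrow> opn X (N i)" "U = (\<Union>i \<in> I. N i)"
    and "s \<in> carrier (sec X U)" "t \<in> carrier (sec X U)"
    and "\<And>i. i \<in> I \<Longrightarrow> res X U (N i) s = res X U (N i) t"
  shows "s = t"
proof -
  have U: "opn X U" using assms(1,2) by auto
  have sub: "N i \<subseteq> U" if "i \<in> I" for i using that assms(2) by auto
  have opi: "opn X (N i \<inter> N j)" if "i \<in> I" "j \<in> I" for i j using that assms(1) by (simp add: openin_Int)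
  have "\<exists>!t. t \<in> carrier (sec X U) \<and> (\<forall>i \<in> I. res X U (N i) t = res X U (N i) s)"
    unfolding assms(2)
  proof (rule glue_sections)
    fix i j assume ij: "i \<in> I" "j \<in> I"
    show "res X (N i) (N i \<inter> N j) (res X (\<Union> (N ` I)) (N i) s) = res X (N j) (N i \<inter> N j) (res X (\<Union> (N ` I)) (N j) s)"
      unfolding assms(2)[symmetric]
      using ij assms(1) U sub opi assms(3) by (subst (1 2) res_res) auto
  next
    fix i assume "i \<in> I"
    then show "res X (\<Union> (N ` I)) (N i) s \<in> carrier (sec X (N i))"
      unfolding assms(2)[symmetric] using res_closed[OF U _ sub] assms(1,3) by blast
  qed (use assms(1) in blast)
  then show ?thesis using assms(3-5) by metis
qed

section \<open>Germs and the ring structure of a stalk\<close>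

lemma germ_self: "opn X U \<Longrightarrow> x \<in> U \<Longrightarrow> s \<in> carrier (sec X U) \<Longrightarrow> (U, s) \<in> germ X x U s"
  unfolding germ_def by blast

lemma germ_eqI:
  assumes "opn X U" "s \<in> carrier (sec X U)" "opn X W" "t \<in> carrier (sec X W)"
    and N: "opn X N" "x \<in> N" "N \<subseteq> U \<inter> W" "res X U N s = res X W N t"
  shows "germ X x U s = germ X x W t"
proof -
  have sub: "germ X x U s \<subseteq> germ X x W t"
    if "opn X U" "s \<in> carrier (sec X U)" "opn X W" "t \<in> carrier (sec X W)"
      "N \<subseteq> U \<inter> W" "res X U N s = res X W N t" for U W s t
  proof clarify
    fix M u assume "(M, u) \<in> germ X x U s"
    then obtain K where M: "opn X M" "x \<in> M" "u \<in> carrier (sec X M)"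
      and K: "opn X K" "x \<in> K" "K \<subseteq> U \<inter> M" "res X U K s = res X M K u"
      unfolding germ_def by auto
    have o: "opn X (N \<inter> K)" using N K by (simp add: openin_Int)
    have "res X W (N \<inter> K) t = res X N (N \<inter> K) (res X W N t)"
      using res_res[of W N "N \<inter> K" t] that N o by auto
    also have "\<dots> = res X U (N \<inter> K) s"
      using res_res[of U N "N \<inter> K" s] that N o by auto
    also have "\<dots> = res X K (N \<inter> K) (res X U K s)"
      using res_res[of U K "N \<inter> K" s] that K o by auto
    also have "\<dots> = res X M (N \<inter> K) u"
      using res_res[of M K "N \<inter> K" u] M K o by auto
    finally have "res X W (N \<inter> K) t = res X M (N \<inter> K) u" .
    moreover have "N \<inter> K \<subseteq> W \<inter> M" "x \<in> N \<inter> K" using that K N by auto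
    ultimately show "(M, u) \<in> germ X x W t" unfolding germ_def using M o by auto
  qed
  show ?thesis
    using sub[of U s W t] sub[of W t U s] assms by auto
qed

lemma germ_memD:
  assumes "opn X U" "s \<in> carrier (sec X U)" "(W, t) \<in> germ X x U s"
  shows "opn X W" "x \<in> W" "t \<in> carrier (sec X W)" "germ X x W t = germ X x U s"
proof -
  obtain N where N: "opn X W" "x \<in> W" "t \<in> carrier (sec X W)" "opn X N" "x \<in> N" "N \<subseteq> U \<inter> W"
    "res X U N s = res X W N t" using assms(3) unfolding germ_def by blast
  then show "opn X W" "x \<in> W" "t \<in> carrier (sec X W)" by simp_all
  show "germ X x W t = germ X x U s"
    by (rule germ_eqI[of _ _ _ _ N]) (use N assms in auto)
qed

lemma germ_eqE:
  assumes "opn X U" "x \<in> U" "s \<in> carrier (sec X U)" "germ X x W t = germ X x U s"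
  obtains N where "opn X N" "x \<in> N" "N \<subseteq> U \<inter> W" "res X U N s = res X W N t"
  using germ_self[OF assms(1-3)] unfolding assms(4)[symmetric] unfolding germ_def by (auto simp: Int_commute)

lemma germ_res:
  assumes "opn X U" "opn X W" "x \<in> W" "W \<subseteq> U" "s \<in> carrier (sec X U)"
  shows "germ X x W (res X U W s) = germ X x U s"
  by (rule germ_eqI[of _ _ _ _ W]) (use assms in \<open>auto simp: res_closed res_self\<close>)

lemma stalk_carrierE:
  assumes "a \<in> carrier (stalk X x)"
  obtains U s where "opn X U" "x \<in> U" "s \<in> carrier (sec X U)" "a = germ X x U s"
  using assms unfolding stalk_def by auto

lemma germ_closed:
  "opn X U \<Longrightarrow> x \<in> U \<Longrightarrow> s \<in> carrier (sec X U) \<Longrightarrow> germ X x U s \<in> carrier (stalk X x)"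
  unfolding stalk_def by auto

text \<open>Stated for any binary operation f on sections that is compatible with restriction, so
  that it yields products and sums in the stalk at once. Two choices of representatives are compared
  on \<open>N \<inter> M\<close>, where both pairs already coincide.\<close>

lemma UN_germ_pairs:
  assumes "opn X U" "x \<in> U" "s \<in> carrier (sec X U)" "opn X W" "x \<in> W" "t \<in> carrier (sec X W)"
    and f: "\<And>M. opn X M \<Longrightarrow> \<forall>p \<in> carrier (sec X M). \<forall>q \<in> carrier (sec X M). f M p q \<in> carrier (sec X M)"
    and fr: "\<And>M N p q. opn X M \<Longrightarrow> opn X N \<Longrightarrow> N \<subseteq> M \<Longrightarrow> p \<in> carrier (sec X M) \<Longrightarrow> q \<in> carrier (sec X M) \<Longrightarrow>
      res X M N (f M p q) = f N (res X M N p) (res X M N q)"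
  shows "(\<Union>(U', s') \<in> germ X x U s. \<Union>(W', t') \<in> germ X x W t.
      germ X x (U' \<inter> W') (f (U' \<inter> W') (res X U' (U' \<inter> W') s') (res X W' (U' \<inter> W') t')))
    = germ X x (U \<inter> W) (f (U \<inter> W) (res X U (U \<inter> W) s) (res X W (U \<inter> W) t))"
proof -
  have same: "germ X x (U' \<inter> W') (f (U' \<inter> W') (res X U' (U' \<inter> W') s') (res X W' (U' \<inter> W') t'))
      = germ X x (U \<inter> W) (f (U \<inter> W) (res X U (U \<inter> W) s) (res X W (U \<inter> W) t))"
    if m: "(U', s') \<in> germ X x U s" "(W', t') \<in> germ X x W t" for U' s' W' t'
  proof -
    note a = germ_memD[OF assms(1,3) m(1)] and b = germ_memD[OF assms(4,6) m(2)]
    obtain N where N: "opn X N" "x \<in> N" "N \<subseteq> U \<inter> U'" "res X U N s = res X U' N s'"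
      using germ_eqE[OF assms(1-3) a(4)] .
    obtain M where M: "opn X M" "x \<in> M" "M \<subseteq> W \<inter> W'" "res X W M t = res X W' M t'"
      using germ_eqE[OF assms(4-6) b(4)] .
    have o: "opn X (U \<inter> W)" "opn X (U' \<inter> W')" "opn X (N \<inter> M)"
      using assms a b N M by (auto simp: openin_Int)
    have c: "res X U (U \<inter> W) s \<in> carrier (sec X (U \<inter> W))" "res X W (U \<inter> W) t \<in> carrier (sec X (U \<inter> W))"
      "res X U' (U' \<inter> W') s' \<in> carrier (sec X (U' \<inter> W'))" "res X W' (U' \<inter> W') t' \<in> carrier (sec X (U' \<inter> W'))"
      using assms a b o by (auto intro: res_closed)
    have sub: "N \<inter> M \<subseteq> U \<inter> W" "N \<inter> M \<subseteq> U' \<inter> W'" using N M by auto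
    have e1: "res X U (N \<inter> M) s = res X U' (N \<inter> M) s'"
      using res_res[of U N "N \<inter> M" s] res_res[of U' N "N \<inter> M" s'] assms a N o by auto
    have e2: "res X W (N \<inter> M) t = res X W' (N \<inter> M) t'"
      using res_res[of W M "N \<inter> M" t] res_res[of W' M "N \<inter> M" t'] assms b M o by auto
    show ?thesis
    proof (rule germ_eqI[of _ _ _ _ "N \<inter> M"])
      show "res X (U' \<inter> W') (N \<inter> M) (f (U' \<inter> W') (res X U' (U' \<inter> W') s') (res X W' (U' \<inter> W') t')) =
          res X (U \<inter> W) (N \<inter> M) (f (U \<inter> W) (res X U (U \<inter> W) s) (res X W (U \<inter> W) t))"
        using o c assms(1-6) a b e1 e2 sub by (simp add: fr res_res)
    qed (use o f c N M in auto)
  qed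
  show ?thesis
    by (intro UN_pair_eqI[OF germ_self[OF assms(1-3)]] UN_pair_eqI[OF germ_self[OF assms(4-6)]] same)
qed

lemma stalk_mult:
  assumes "opn X U" "x \<in> U" "s \<in> carrier (sec X U)" "opn X W" "x \<in> W" "t \<in> carrier (sec X W)"
  shows "germ X x U s \<otimes>\<^bsub>stalk X x\<^esub> germ X x W t =
    germ X x (U \<inter> W) (res X U (U \<inter> W) s \<otimes>\<^bsub>sec X (U \<inter> W)\<^esub> res X W (U \<inter> W) t)"
  unfolding stalk_def monoid.simps ring.simps
  using UN_germ_pairs[OF assms, of "\<lambda>M. monoid.mult (sec X M)"] sec_cring
    ring_hom_mult[OF res_hom]
  by (simp add: cring_def ring.ring_simprules)

lemma stalk_add:
  assumes "opn X U" "x \<in> U" "s \<in> carrier (sec X U)" "opn X W" "x \<in> W" "t \<in> carrier (sec X W)"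
  shows "germ X x U s \<oplus>\<^bsub>stalk X x\<^esub> germ X x W t =
    germ X x (U \<inter> W) (res X U (U \<inter> W) s \<oplus>\<^bsub>sec X (U \<inter> W)\<^esub> res X W (U \<inter> W) t)"
  unfolding stalk_def monoid.simps ring.simps
  using UN_germ_pairs[OF assms, of "\<lambda>M. add (sec X M)"] sec_cring
    ring_hom_add[OF res_hom]
  by (simp add: cring_def ring.ring_simprules)

lemma germ_one: "opn X U \<Longrightarrow> x \<in> U \<Longrightarrow> germ X x U \<one>\<^bsub>sec X U\<^esub> = \<one>\<^bsub>stalk X x\<^esub>"
  using germ_res[of "pts X" U x "\<one>\<^bsub>sec X (pts X)\<^esub>"] ring_hom_one[OF res_hom[of "pts X" U]]
    sec_cring[of "pts X"] openin_subset[of "base X" U]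
  by (simp add: stalk_def cring_def ring.ring_simprules)

lemma germ_hom:
  assumes "opn X U" "x \<in> U"
  shows "germ X x U \<in> ring_hom (sec X U) (stalk X x)"
proof -
  interpret cring "sec X U" by (rule sec_cring) fact
  show ?thesis
    by (rule ring_hom_memI) (use assms in \<open>auto simp: germ_closed stalk_mult stalk_add germ_one res_self\<close>)
qed

end

lemma stalk_cring: "locally_ringed X \<Longrightarrow> x \<in> pts X \<Longrightarrow> cring (stalk X x)"
  by (simp add: locally_ringed_def local_ring_def)

section \<open>Morphisms, stalk maps and composition\<close>

text \<open>The conditions of \<open>sch_hom\<close> other than locality on stalks and
  extensionality of \<open>pt\<close> and \<open>sh\<close>. Stalk maps can thus be computed for a
  map whose locality is still to be proved, as happens for the glued morphism.\<close>

definition ringed_hom :: "('p, 'r) rspace \<Rightarrow> ('q, 's) rspace \<Rightarrow> ('p, 'r, 'q, 's) smor set" where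
  "ringed_hom X Y = {f. continuous_map (base X) (base Y) (pt f) \<and>
    (\<forall>W. opn Y W \<longrightarrow> sh f W \<in> rhom (sec Y W) (sec X (preim X f W))) \<and>
    (\<forall>W N. opn Y W \<and> opn Y N \<and> N \<subseteq> W \<longrightarrow>
      (\<forall>t \<in> carrier (sec Y W).
        sh f N (res Y W N t) = res X (preim X f W) (preim X f N) (sh f W t)))}"

lemma sch_hom_ringed: "f \<in> sch_hom X Y \<Longrightarrow> f \<in> ringed_hom X Y"
  by (simp add: sch_hom_def ringed_hom_def)

lemma preim_Int: "preim X f (W \<inter> N) = preim X f W \<inter> preim X f N"
  by (auto simp: preim_def)

context
  fixes X :: "('p, 'r) rspace" and Y :: "('q, 's) rspace" and f :: "('p, 'r, 'q, 's) smor"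
  assumes f: "f \<in> ringed_hom X Y"
begin

lemma ringed_hom_pt: "x \<in> pts X \<Longrightarrow> pt f x \<in> pts Y"
  using f unfolding ringed_hom_def continuous_map_def by auto

lemma ringed_hom_preim_open: "opn Y W \<Longrightarrow> opn X (preim X f W)"
  using f unfolding ringed_hom_def continuous_map_def preim_def by auto

lemma ringed_hom_sh_rhom: "opn Y W \<Longrightarrow> sh f W \<in> rhom (sec Y W) (sec X (preim X f W))"
  using f unfolding ringed_hom_def by auto

lemma ringed_hom_sh: "opn Y W \<Longrightarrow> sh f W \<in> ring_hom (sec Y W) (sec X (preim X f W))"
  using ringed_hom_sh_rhom by (simp add: rhom_def)

lemma ringed_hom_sh_closed: "opn Y W \<Longrightarrow> t \<in> carrier (sec Y W) \<Longrightarrow> sh f W t \<in> carrier (sec X (preim X f W))"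
  by (rule ring_hom_closed[OF ringed_hom_sh])

lemma ringed_hom_sh_res:
  "opn Y W \<Longrightarrow> opn Y N \<Longrightarrow> N \<subseteq> W \<Longrightarrow> t \<in> carrier (sec Y W) \<Longrightarrow>
    sh f N (res Y W N t) = res X (preim X f W) (preim X f N) (sh f W t)"
  using f unfolding ringed_hom_def by auto

lemma ringed_hom_stalk_map_germ:
  assumes "ringed_space X" "ringed_space Y" "x \<in> pts X"
    and "opn Y W" "pt f x \<in> W" "t \<in> carrier (sec Y W)"
  shows "stalk_map X f x (germ Y (pt f x) W t) = germ X x (preim X f W) (sh f W t)"
proof -
  have "germ X x (preim X f W') (sh f W' t') = germ X x (preim X f W) (sh f W t)"
    if "(W', t') \<in> germ Y (pt f x) W t" for W' t'
  proof -
    note a = germ_memD[OF assms(2,4,6) that]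
    obtain N where N: "opn Y N" "pt f x \<in> N" "N \<subseteq> W \<inter> W'" "res Y W N t = res Y W' N t'"
      using germ_eqE[OF assms(2) assms(4-6) a(4)] .
    show ?thesis
    proof (rule germ_eqI[OF assms(1), of _ _ _ _ "preim X f N"])
      show "res X (preim X f W') (preim X f N) (sh f W' t') = res X (preim X f W) (preim X f N) (sh f W t)"
        using N a assms by (simp flip: ringed_hom_sh_res)
    qed (use N a assms in \<open>auto simp: ringed_hom_preim_open ringed_hom_sh_closed\<close>, auto simp: preim_def)
  qed
  then show ?thesis
    unfolding stalk_map_def by (intro UN_pair_eqI[OF germ_self[OF assms(2,4-6)]])
qed

text \<open>Two germs are represented over a common open set \<open>W \<inter> N\<close>; preimages
  commute with this intersection, so the claim becomes that \<open>sh f\<close> is a ring morphism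
  compatible with restriction.\<close>

lemma ringed_hom_stalk_map_hom:
  assumes "ringed_space X" "ringed_space Y" "x \<in> pts X"
  shows "stalk_map X f x \<in> ring_hom (stalk Y (pt f x)) (stalk X x)"
proof (rule ring_hom_memI)
  have px: "x \<in> preim X f W \<longleftrightarrow> pt f x \<in> W" for W using assms(3) by (simp add: preim_def)
  note S = ringed_hom_stalk_map_germ[OF assms]
  show "stalk_map X f x a \<in> carrier (stalk X x)" if "a \<in> carrier (stalk Y (pt f x))" for a
    using that by (elim stalk_carrierE[OF assms(2)]) (simp add: S germ_closed assms ringed_hom_preim_open px ringed_hom_sh_closed)
  fix a b assume "a \<in> carrier (stalk Y (pt f x))" "b \<in> carrier (stalk Y (pt f x))"
  then obtain W t N u where
    p: "opn Y W" "pt f x \<in> W" "t \<in> carrier (sec Y W)" "opn Y N" "pt f x \<in> N" "u \<in> carrier (sec Y N)"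
    and ab: "a = germ Y (pt f x) W t" "b = germ Y (pt f x) N u"
    by (metis stalk_carrierE[OF assms(2)])
  have o: "opn Y (W \<inter> N)" using p by (simp add: openin_Int)
  interpret cring "sec Y (W \<inter> N)" by (rule sec_cring[OF assms(2) o])
  have c: "res Y W (W \<inter> N) t \<in> carrier (sec Y (W \<inter> N))" "res Y N (W \<inter> N) u \<in> carrier (sec Y (W \<inter> N))"
    using p o by (auto intro: res_closed[OF assms(2)])
  show "stalk_map X f x (a \<otimes>\<^bsub>stalk Y (pt f x)\<^esub> b) = stalk_map X f x a \<otimes>\<^bsub>stalk X x\<^esub> stalk_map X f x b"
    unfolding ab using p o c
    by (simp add: S stalk_mult assms(1,2) ringed_hom_preim_open px ringed_hom_sh_closed preim_Int[symmetric]
        ring_hom_mult[OF ringed_hom_sh] ringed_hom_sh_res)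
  show "stalk_map X f x (a \<oplus>\<^bsub>stalk Y (pt f x)\<^esub> b) = stalk_map X f x a \<oplus>\<^bsub>stalk X x\<^esub> stalk_map X f x b"
    unfolding ab using p o c
    by (simp add: S stalk_add assms(1,2) ringed_hom_preim_open px ringed_hom_sh_closed preim_Int[symmetric]
        ring_hom_add[OF ringed_hom_sh] ringed_hom_sh_res)
next
  have Y: "opn Y (pts Y)" "pt f x \<in> pts Y" using ringed_hom_pt[OF assms(3)] by auto
  interpret cring "sec Y (pts Y)" by (rule sec_cring[OF assms(2) Y(1)])
  have "stalk_map X f x (germ Y (pt f x) (pts Y) \<one>\<^bsub>sec Y (pts Y)\<^esub>) = germ X x (preim X f (pts Y)) \<one>\<^bsub>sec X (preim X f (pts Y))\<^esub>"
    using Y by (simp add: ringed_hom_stalk_map_germ[OF assms] ring_hom_one[OF ringed_hom_sh])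
  also have "\<dots> = \<one>\<^bsub>stalk X x\<^esub>"
    by (rule germ_one[OF assms(1) ringed_hom_preim_open[OF Y(1)]]) (use Y assms(3) in \<open>auto simp: preim_def\<close>)
  finally show "stalk_map X f x \<one>\<^bsub>stalk Y (pt f x)\<^esub> = \<one>\<^bsub>stalk X x\<^esub>"
    using germ_one[OF assms(2) Y] by simp
qed

end

lemmas sch_hom_pt = ringed_hom_pt[OF sch_hom_ringed]
lemmas preim_open = ringed_hom_preim_open[OF sch_hom_ringed]
lemmas sch_hom_sh_rhom = ringed_hom_sh_rhom[OF sch_hom_ringed]
lemmas sch_hom_sh = ringed_hom_sh[OF sch_hom_ringed]
lemmas sh_closed = ringed_hom_sh_closed[OF sch_hom_ringed]
lemmas sh_res = ringed_hom_sh_res[OF sch_hom_ringed]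
lemmas stalk_map_germ = ringed_hom_stalk_map_germ[OF sch_hom_ringed]
lemmas stalk_map_hom = ringed_hom_stalk_map_hom[OF sch_hom_ringed]

lemma sch_hom_pt_ext: "f \<in> sch_hom X Y \<Longrightarrow> pt f \<in> extensional (pts X)"
  unfolding sch_hom_def by auto

lemma sch_hom_sh_ext: "f \<in> sch_hom X Y \<Longrightarrow> sh f \<in> extensional {W. opn Y W}"
  unfolding sch_hom_def by auto

lemma sch_hom_local:
  "f \<in> sch_hom X Y \<Longrightarrow> x \<in> pts X \<Longrightarrow> a \<in> carrier (stalk Y (pt f x)) \<Longrightarrow> stalk_map X f x a \<in> Units (stalk X x) \<Longrightarrow>
    a \<in> Units (stalk Y (pt f x))"
  unfolding sch_hom_def by auto

lemma pt_sch_comp: "x \<in> pts X \<Longrightarrow> pt (sch_comp X Y Z g f) x = pt g (pt f x)"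
  by (simp add: sch_comp_def compose_def)

lemma sh_sch_comp:
  "opn Z W \<Longrightarrow> t \<in> carrier (sec Z W) \<Longrightarrow> sh (sch_comp X Y Z g f) W t = sh f (preim Y g W) (sh g W t)"
  by (simp add: sch_comp_def compose_def)

lemma preim_sch_comp:
  "f \<in> sch_hom X Y \<Longrightarrow> preim X (sch_comp X Y Z g f) W = preim X f (preim Y g W)"
  using sch_hom_pt[of f X Y] by (auto simp: preim_def pt_sch_comp)

text \<open>Any representative of the germ a gives the same value on the right, and on it the two
  sides agree by the definition of \<open>sh\<close> for a composite.\<close>

lemma stalk_map_comp:
  assumes X: "ringed_space X" and Y: "ringed_space Y" and Z: "ringed_space Z"
    and f: "f \<in> sch_hom X Y" and g: "g \<in> sch_hom Y Z"
    and x: "x \<in> pts X" and a: "a \<in> carrier (stalk Z (pt g (pt f x)))"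
  shows "stalk_map X (sch_comp X Y Z g f) x a = stalk_map X f x (stalk_map Y g (pt f x) a)"
proof -
  let ?h = "sch_comp X Y Z g f"
  obtain W t where W: "opn Z W" "pt g (pt f x) \<in> W" "t \<in> carrier (sec Z W)" "a = germ Z (pt g (pt f x)) W t"
    using a by (rule stalk_carrierE[OF Z])
  have y: "pt f x \<in> pts Y" by (rule sch_hom_pt[OF f x])
  have yp: "pt f x \<in> preim Y g M \<longleftrightarrow> pt g (pt f x) \<in> M" for M
    using y by (simp add: preim_def)
  have "germ X x (preim X ?h W') (sh ?h W' t') = stalk_map X f x (stalk_map Y g (pt f x) a)"
    if "(W', t') \<in> a" for W' t'
  proof -
    note b = germ_memD[OF Z W(1,3) that[unfolded W(4)]]
    show ?thesis
      unfolding W(4) b(4)[symmetric] using b(1-3) y x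
      by (simp add: stalk_map_germ[OF g Y Z] stalk_map_germ[OF f X Y] preim_open[OF g] sh_closed[OF g] yp
          preim_sch_comp[OF f] sh_sch_comp)
  qed
  then show ?thesis
    unfolding stalk_map_def[of X ?h] W(4) by (intro UN_pair_eqI[OF germ_self[OF Z W(1-3)]]) simp
qed

lemma sch_comp_hom:
  assumes X: "ringed_space X" and Y: "ringed_space Y" and Z: "ringed_space Z"
    and f: "f \<in> sch_hom X Y" and g: "g \<in> sch_hom Y Z"
  shows "sch_comp X Y Z g f \<in> sch_hom X Z"
proof -
  let ?h = "sch_comp X Y Z g f"
  have "continuous_map (base X) (base Z) (pt ?h)"
  proof -
    have "continuous_map (base X) (base Z) (pt g \<circ> pt f)"
      using f g by (intro continuous_map_compose[of _ "base Y"]) (simp_all add: sch_hom_def)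
    then show ?thesis by (rule continuous_map_eq) (simp add: pt_sch_comp)
  qed
  moreover have "sh ?h W \<in> rhom (sec Z W) (sec X (preim X ?h W))" if W: "opn Z W" for W
  proof -
    have "sh ?h W \<in> ring_hom (sec Z W) (sec X (preim X ?h W))"
      unfolding preim_sch_comp[OF f]
    proof (rule ring_hom_memI)
      interpret cring "sec Z W" by (rule sec_cring[OF Z W])
      note G = sch_hom_sh[OF g W] and F = sch_hom_sh[OF f preim_open[OF g W]]
      show "sh ?h W \<one>\<^bsub>sec Z W\<^esub> = \<one>\<^bsub>sec X (preim X f (preim Y g W))\<^esub>"
        using W by (simp add: sh_sch_comp ring_hom_one[OF G] ring_hom_one[OF F])
      fix s t assume st: "s \<in> carrier (sec Z W)" "t \<in> carrier (sec Z W)"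
      note c = ring_hom_closed[OF G st(1)] ring_hom_closed[OF G st(2)]
      show "sh ?h W (s \<otimes>\<^bsub>sec Z W\<^esub> t) = sh ?h W s \<otimes>\<^bsub>sec X (preim X f (preim Y g W))\<^esub> sh ?h W t"
        using W st c by (simp add: sh_sch_comp ring_hom_mult[OF G] ring_hom_mult[OF F])
      show "sh ?h W (s \<oplus>\<^bsub>sec Z W\<^esub> t) = sh ?h W s \<oplus>\<^bsub>sec X (preim X f (preim Y g W))\<^esub> sh ?h W t"
        using W st c by (simp add: sh_sch_comp ring_hom_add[OF G] ring_hom_add[OF F])
    qed (simp add: W sh_sch_comp sh_closed[OF f] sh_closed[OF g] preim_open[OF g])
    then show ?thesis using W by (simp add: rhom_def sch_comp_def)
  qed
  moreover have "sh ?h N (res Z W N t) = res X (preim X ?h W) (preim X ?h N) (sh ?h W t)"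
    if "opn Z W" "opn Z N" "N \<subseteq> W" "t \<in> carrier (sec Z W)" for W N t
  proof -
    have "preim Y g N \<subseteq> preim Y g W" using that(3) by (auto simp: preim_def)
    then show ?thesis using that
      by (simp add: preim_sch_comp[OF f] sh_sch_comp res_closed[OF Z] sh_res[OF g] sh_res[OF f]
          preim_open[OF g] sh_closed[OF g])
  qed
  moreover have "a \<in> Units (stalk Z (pt ?h x))"
    if x: "x \<in> pts X" and a: "a \<in> carrier (stalk Z (pt ?h x))" and u: "stalk_map X ?h x a \<in> Units (stalk X x)" for x a
  proof -
    have y: "pt f x \<in> pts Y" by (rule sch_hom_pt[OF f x])
    have a': "a \<in> carrier (stalk Z (pt g (pt f x)))" using a x by (simp add: pt_sch_comp)
    \<comment> \<open>Locality of f pulls the unit back to the stalk of Y, then locality of g to the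
      stalk of Z.\<close>
    have "stalk_map X f x (stalk_map Y g (pt f x) a) \<in> Units (stalk X x)"
      using u unfolding stalk_map_comp[OF X Y Z f g x a'] .
    then show ?thesis
      using sch_hom_local[OF g y a'] sch_hom_local[OF f x]
        ring_hom_closed[OF stalk_map_hom[OF g Y Z y] a'] x by (simp add: pt_sch_comp)
  qed
  moreover have "pt ?h \<in> extensional (pts X)" "sh ?h \<in> extensional {W. opn Z W}"
    by (simp_all add: sch_comp_def)
  ultimately show ?thesis unfolding sch_hom_def by blast
qed

lemma sch_comp_assoc:
  assumes f: "f \<in> sch_hom X Y" and g: "g \<in> sch_hom Y Z" and h: "h \<in> sch_hom Z W"
  shows "sch_comp X Z W h (sch_comp X Y Z g f) = sch_comp X Y W (sch_comp Y Z W h g) f"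
proof (rule smor.equality)
  show "pt (sch_comp X Z W h (sch_comp X Y Z g f)) = pt (sch_comp X Y W (sch_comp Y Z W h g) f)"
    using sch_hom_pt[OF f] by (auto simp: sch_comp_def compose_def fun_eq_iff)
  show "sh (sch_comp X Z W h (sch_comp X Y Z g f)) = sh (sch_comp X Y W (sch_comp Y Z W h g) f)"
  proof (rule extensionalityI[of _ "{N. opn W N}"])
    fix N assume "N \<in> {N. opn W N}"
    then have N: "opn W N" by simp
    show "sh (sch_comp X Z W h (sch_comp X Y Z g f)) N = sh (sch_comp X Y W (sch_comp Y Z W h g) f) N"
    proof (rule extensionalityI[of _ "carrier (sec W N)"])
      fix t assume t: "t \<in> carrier (sec W N)"
      then show "sh (sch_comp X Z W h (sch_comp X Y Z g f)) N t = sh (sch_comp X Y W (sch_comp Y Z W h g) f) N t"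
        using N by (simp add: sh_sch_comp preim_open[OF h] sh_closed[OF h] preim_sch_comp[OF g])
    qed (use N in \<open>simp_all add: sch_comp_def\<close>)
  qed (simp_all add: sch_comp_def)
qed simp

section \<open>Functions on the complexification of a scheme\<close>

lemma bc_germ_hom:
  assumes "locally_ringed X" "x \<in> pts X" "opn X U" "x \<in> U"
  shows "bc_germ X x U \<in> ring_hom (cplx (sec X U)) (cplx (stalk X x))"
  unfolding bc_germ_def[abs_def]
  by (rule cplx_map_hom[OF sec_cring stalk_cring germ_hom])
    (use assms locally_ringed_ringed in auto)

lemma bc_pts_prime: "(x, P) \<in> bc_pts X \<Longrightarrow> primeideal P (cplx (stalk X x))"
  by (simp add: bc_pts_def)

lemma bc_pts_base: "(x, P) \<in> bc_pts X \<Longrightarrow> x \<in> pts X"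
  by (simp add: bc_pts_def)

text \<open>The unit section over all of X vanishes nowhere, since a prime ideal does not contain 1;
  its non-vanishing locus is a generating set equal to all of \<open>bc_pts X\<close>.\<close>

lemma topspace_bc_top:
  assumes X: "locally_ringed X"
  shows "topspace (bc_top X) = bc_pts X"
proof -
  let ?S = "{{(x, P) \<in> bc_pts X. x \<in> U \<and> bc_germ X x U g \<notin> P} | U g. opn X U \<and> g \<in> carrier (cplx (sec X U))}"
  let ?one = "\<one>\<^bsub>cplx (sec X (pts X))\<^esub>"
  have "topspace (bc_top X) = \<Union> ?S"
    unfolding bc_top_def by (rule topology_generated_by_topspace)
  also have "\<dots> = bc_pts X"
  proof
    have C: "cring (cplx (sec X (pts X)))"
      by (intro cplx_cring sec_cring locally_ringed_ringed X) simp
    have "bc_germ X x (pts X) ?one \<notin> P" if "(x, P) \<in> bc_pts X" for x P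
    proof -
      interpret primeideal P "cplx (stalk X x)" by (rule bc_pts_prime[OF that])
      have "bc_germ X x (pts X) ?one = \<one>\<^bsub>cplx (stalk X x)\<^esub>"
        using ring_hom_one[OF bc_germ_hom[OF X bc_pts_base[OF that] openin_topspace bc_pts_base[OF that]]] .
      then show ?thesis using I_notcarr one_imp_carrier by auto
    qed
    then have "bc_pts X \<subseteq> {(x, P) \<in> bc_pts X. x \<in> pts X \<and> bc_germ X x (pts X) ?one \<notin> P}"
      using bc_pts_base by fastforce
    moreover have "{(x, P) \<in> bc_pts X. x \<in> pts X \<and> bc_germ X x (pts X) ?one \<notin> P} \<in> ?S"
      using C by (auto intro!: exI[of _ "pts X"] exI[of _ ?one] simp: cring_def ring.ring_simprules)
    ultimately show "bc_pts X \<subseteq> \<Union> ?S" by blast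
  qed auto
  finally show ?thesis .
qed

lemma pts_base_change: "locally_ringed X \<Longrightarrow> pts (base_change X) = bc_pts X"
  by (simp add: base_change_def topspace_bc_top)

section \<open>Global functions as local fractions\<close>

text \<open>The local condition on sections in \<open>base_change\<close>, taken over the whole
  space, with its witnesses made explicit.\<close>

definition fraction_at where
  "fraction_at X s q N U a b \<longleftrightarrow> openin (bc_top X) N \<and> q \<in> N \<and> N \<subseteq> bc_pts X \<and> opn X U \<and>
    a \<in> carrier (cplx (sec X U)) \<and> b \<in> carrier (cplx (sec X U)) \<and>
    (\<forall>(y, Q) \<in> N. y \<in> U \<and> bc_germ X y U b \<notin> Q \<and>
      s (y, Q) = loc_frac (cplx (stalk X y)) Q (bc_germ X y U a) (bc_germ X y U b))"

lemma fraction_at_value: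
  assumes X: "locally_ringed X" and fr: "fraction_at X s (x, P) N U a b"
  shows "bc_germ X x U a \<in> carrier (cplx (stalk X x))" "bc_germ X x U b \<in> carrier (cplx (stalk X x)) - P"
    "s (x, P) = loc_frac (cplx (stalk X x)) P (bc_germ X x U a) (bc_germ X x U b)"
proof -
  have x: "x \<in> pts X" "x \<in> U" and U: "opn X U"
    and ab: "a \<in> carrier (cplx (sec X U))" "b \<in> carrier (cplx (sec X U))"
    and v: "bc_germ X x U b \<notin> P"
      "s (x, P) = loc_frac (cplx (stalk X x)) P (bc_germ X x U a) (bc_germ X x U b)"
    using fr bc_pts_base[of x P X] unfolding fraction_at_def by auto
  note H = bc_germ_hom[OF X x(1) U x(2)]
  show "bc_germ X x U a \<in> carrier (cplx (stalk X x))" "bc_germ X x U b \<in> carrier (cplx (stalk X x)) - P"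
    "s (x, P) = loc_frac (cplx (stalk X x)) P (bc_germ X x U a) (bc_germ X x U b)"
    using ring_hom_closed[OF H] ab v by auto
qed

text \<open>A local fraction has all its values in the local rings, so membership reduces to
  extensionality and the existence of local fractions.\<close>

lemma fun_alg_carrier:
  assumes X: "locally_ringed X"
  shows "s \<in> carrier (fun_alg X) \<longleftrightarrow> s \<in> extensional (bc_pts X) \<and>
    (\<forall>q \<in> bc_pts X. \<exists>N U a b. fraction_at X s q N U a b)"
proof -
  have c: "carrier (ring.extend r z) = carrier r" for r :: "'c ring" and z :: 'd
    by (simp add: ring.defs)
  have "s q \<in> carrier (bc_loc X q)" if "fraction_at X s q N U a b" for q N U a b
  proof -
    obtain x P where q: "q = (x, P)" by (cases q)
    show ?thesis
      using fraction_at_value[OF X that[unfolded q]] unfolding q bc_loc_def localisation_def by auto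
  qed
  then have "(\<forall>q \<in> bc_pts X. \<exists>N U a b. fraction_at X s q N U a b) \<Longrightarrow> \<forall>q \<in> bc_pts X. s q \<in> carrier (bc_loc X q)"
    by blast
  moreover have "s \<in> carrier (fun_alg X) \<longleftrightarrow> s \<in> (\<Pi>\<^sub>E q \<in> bc_pts X. carrier (bc_loc X q)) \<and>
      (\<forall>q \<in> bc_pts X. \<exists>N U a b. fraction_at X s q N U a b)"
    unfolding fun_alg_def c pts_base_change[OF X]
    unfolding fraction_at_def by (simp add: base_change_def)
  ultimately show ?thesis by (auto simp: PiE_iff)
qed

lemma fun_alg_valueE:
  assumes X: "locally_ringed X" and s: "s \<in> carrier (fun_alg X)" and q: "(x, P) \<in> bc_pts X"
  obtains a b where "a \<in> carrier (cplx (stalk X x))" "b \<in> carrier (cplx (stalk X x)) - P"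
    "s (x, P) = loc_frac (cplx (stalk X x)) P a b"
  using s q fraction_at_value[OF X] unfolding fun_alg_carrier[OF X] by metis

section \<open>The map of complexifications induced by a morphism, and pullback of functions\<close>

definition bc_stalk_map where
  "bc_stalk_map X f x = cplx_map (stalk X x) (stalk_map X f x)"

text \<open>The morphism from the complexification of X to that of Y on points; the second component
  is the prime called Q in \<open>fun_pull\<close>.\<close>

definition bc_map where
  "bc_map X Y f = (\<lambda>(x, P). (pt f x, {k \<in> carrier (cplx (stalk Y (pt f x))). bc_stalk_map X f x k \<in> P}))"

lemma ring_hom_Units:
  assumes "h \<in> ring_hom R S" "a \<in> Units R" "monoid R"
  shows "h a \<in> Units S"
proof -
  obtain b where b: "a \<in> carrier R" "b \<in> carrier R" "b \<otimes>\<^bsub>R\<^esub> a = \<one>\<^bsub>R\<^esub>" "a \<otimes>\<^bsub>R\<^esub> b = \<one>\<^bsub>R\<^esub>"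
    using assms(2) unfolding Units_def by auto
  have "h b \<otimes>\<^bsub>S\<^esub> h a = \<one>\<^bsub>S\<^esub>" "h a \<otimes>\<^bsub>S\<^esub> h b = \<one>\<^bsub>S\<^esub>"
    using b ring_hom_mult[OF assms(1)] ring_hom_one[OF assms(1)] by metis+
  then show ?thesis
    using b ring_hom_closed[OF assms(1)] unfolding Units_def by blast
qed

context
  fixes X :: "('p, 'r) rspace" and Y :: "('q, 's) rspace" and f :: "('p, 'r, 'q, 's) smor"
  assumes X: "locally_ringed X" and Y: "locally_ringed Y" and f: "f \<in> sch_hom X Y"
begin

lemma bc_stalk_map_hom:
  assumes "x \<in> pts X"
  shows "bc_stalk_map X f x \<in> ring_hom (cplx (stalk Y (pt f x))) (cplx (stalk X x))"
  unfolding bc_stalk_map_def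
  by (rule cplx_map_hom[OF stalk_cring[OF Y sch_hom_pt[OF f assms]] stalk_cring[OF X assms]
        stalk_map_hom[OF f locally_ringed_ringed[OF X] locally_ringed_ringed[OF Y] assms]])

text \<open>The pulled back ideal is prime as a preimage of a prime ideal. That it lies over the
  maximal ideal of the stalk of Y is where locality of f enters.\<close>

lemma bc_map_bc_pts:
  assumes q: "q \<in> bc_pts X"
  shows "bc_map X Y f q \<in> bc_pts Y"
proof -
  obtain x P where q': "q = (x, P)" by (cases q)
  have x: "x \<in> pts X" and P: "primeideal P (cplx (stalk X x))"
    and nonunits: "{a \<in> carrier (stalk X x). cplx_class (stalk X x) (single 1 a) \<in> P} =
      carrier (stalk X x) - Units (stalk X x)"
    using q unfolding q' bc_pts_def by auto
  let ?y = "pt f x" and ?h = "bc_stalk_map X f x"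
  have y: "?y \<in> pts Y" by (rule sch_hom_pt[OF f x])
  interpret SX: cring "stalk X x" by (rule stalk_cring[OF X x])
  interpret SY: cring "stalk Y ?y" by (rule stalk_cring[OF Y y])
  interpret CY: cring "cplx (stalk Y ?y)" by (rule cplx_cring[OF SY.is_cring])
  interpret CX: cring "cplx (stalk X x)" by (rule cplx_cring[OF SX.is_cring])
  interpret H: ring_hom_ring "cplx (stalk Y ?y)" "cplx (stalk X x)" ?h
    by (rule ring_hom_ringI2[OF CY.ring_axioms CX.ring_axioms bc_stalk_map_hom[OF x]])
  let ?Q = "{k \<in> carrier (cplx (stalk Y ?y)). ?h k \<in> P}"
  have "primeideal ?Q (cplx (stalk Y ?y))"
    by (rule H.primeideal_vimage[OF CY.is_cring P])
  moreover have "cplx_class (stalk Y ?y) (single 1 a) \<in> ?Q \<longleftrightarrow> a \<notin> Units (stalk Y ?y)"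
    if a: "a \<in> carrier (stalk Y ?y)" for a
  proof -
    note sm = stalk_map_hom[OF f locally_ringed_ringed[OF X] locally_ringed_ringed[OF Y] x]
    have "?h (cplx_class (stalk Y ?y) (single 1 a)) = cplx_class (stalk X x) (single 1 (stalk_map X f x a))"
      unfolding bc_stalk_map_def
      by (simp add: cplx_map_class[OF SY.is_cring SX.is_cring sm single_closed[OF a]] push_single)
    moreover have "cplx_class (stalk Y ?y) (single 1 a) \<in> carrier (cplx (stalk Y ?y))"
      by (rule ring_hom_closed[OF cplx_class_hom[OF SY.is_cring] single_closed[OF a]])
    moreover have "cplx_class (stalk X x) (single 1 (stalk_map X f x a)) \<in> P \<longleftrightarrow>
        stalk_map X f x a \<notin> Units (stalk X x)"
      using nonunits ring_hom_closed[OF sm a] by blast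
    \<comment> \<open>From left to right this is locality of f; from right to left any ring morphism
      preserves units.\<close>
    moreover have "stalk_map X f x a \<in> Units (stalk X x) \<longleftrightarrow> a \<in> Units (stalk Y ?y)"
      using sch_hom_local[OF f x a] ring_hom_Units[OF sm _ SY.monoid_axioms] by blast
    ultimately show ?thesis by simp
  qed
  ultimately show ?thesis
    unfolding q' bc_map_def bc_pts_def using y by auto
qed

text \<open>Complexification applied to the square relating \<open>sh f W\<close> to the stalk map:
  both paths complexify the same ring morphism from sections over W to the stalk of X.\<close>

lemma bc_stalk_map_germ:
  assumes x: "x \<in> pts X" and W: "opn Y W" "pt f x \<in> W" and k: "k \<in> carrier (cplx (sec Y W))"
  shows "bc_stalk_map X f x (bc_germ Y (pt f x) W k) =
    bc_germ X x (preim X f W) (cplx_map (sec X (preim X f W)) (sh f W) k)"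
proof -
  note RX = locally_ringed_ringed[OF X] and RY = locally_ringed_ringed[OF Y]
  have y: "pt f x \<in> pts Y" by (rule sch_hom_pt[OF f x])
  have xp: "x \<in> preim X f W" using x W by (simp add: preim_def)
  note o = preim_open[OF f W(1)]
  note sX = sec_cring[OF RX o] and sY = sec_cring[OF RY W(1)]
  note tX = stalk_cring[OF X x] and tY = stalk_cring[OF Y y]
  note gY = germ_hom[OF RY W] and gX = germ_hom[OF RX o xp] and sm = stalk_map_hom[OF f RX RY x] and S = sch_hom_sh[OF f W(1)]
  have comp: "(\<lambda>t. germ X x (preim X f W) (sh f W t)) \<in> ring_hom (sec Y W) (stalk X x)"
    using ring_hom_trans[OF S gX] by (simp add: o_def)
  have "bc_germ X x (preim X f W) (cplx_map (sec X (preim X f W)) (sh f W) k) =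
      cplx_map (stalk X x) (\<lambda>t. germ X x (preim X f W) (sh f W t)) k"
    unfolding bc_germ_def by (rule cplx_map_comp[OF sY sX tX S gX comp _ k, symmetric]) simp
  also have "\<dots> = bc_stalk_map X f x (bc_germ Y (pt f x) W k)"
    unfolding bc_germ_def bc_stalk_map_def
    by (rule cplx_map_comp[OF sY tY tX gY sm comp _ k]) (simp add: stalk_map_germ[OF f RX RY x W])
  finally show ?thesis by simp
qed

text \<open>The preimage of the non-vanishing locus of g over U is the non-vanishing locus of the
  pulled back element over the preimage of U, hence a generating set again.\<close>

lemma bc_map_continuous: "continuous_map (bc_top X) (bc_top Y) (bc_map X Y f)"
  unfolding bc_top_def[of Y]
proof (rule continuous_on_generated_topo)
  fix D assume "D \<in> {{(x, P) \<in> bc_pts Y. x \<in> U \<and> bc_germ Y x U g \<notin> P} | U g. opn Y U \<and> g \<in> carrier (cplx (sec Y U))}"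
  then obtain U g where D: "D = {(x, P) \<in> bc_pts Y. x \<in> U \<and> bc_germ Y x U g \<notin> P}"
    and U: "opn Y U" and g: "g \<in> carrier (cplx (sec Y U))" by blast
  let ?g = "cplx_map (sec X (preim X f U)) (sh f U) g"
  note o = preim_open[OF f U]
  have "bc_map X Y f -` D \<inter> topspace (bc_top X) = {(x, P) \<in> bc_pts X. x \<in> preim X f U \<and> bc_germ X x (preim X f U) ?g \<notin> P}"
  proof (rule Set.set_eqI, clarify)
    fix x P
    show "(x, P) \<in> bc_map X Y f -` D \<inter> topspace (bc_top X) \<longleftrightarrow>
        (x, P) \<in> {(x, P) \<in> bc_pts X. x \<in> preim X f U \<and> bc_germ X x (preim X f U) ?g \<notin> P}"
    proof (cases "(x, P) \<in> bc_pts X")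
      case q: True
      have x: "x \<in> pts X" by (rule bc_pts_base[OF q])
      show ?thesis
      proof (cases "pt f x \<in> U")
        case True
        have "bc_germ Y (pt f x) U g \<in> carrier (cplx (stalk Y (pt f x)))"
          by (rule ring_hom_closed[OF bc_germ_hom[OF Y sch_hom_pt[OF f x] U True] g])
        then show ?thesis
          using bc_map_bc_pts[OF q] True x q bc_stalk_map_germ[OF x U True g]
          by (simp add: topspace_bc_top[OF X] bc_map_def D preim_def)
      next
        case False
        then show ?thesis by (simp add: bc_map_def D preim_def)
      qed
    next
      case False
      then show ?thesis by (simp add: topspace_bc_top[OF X])
    qed
  qed
  moreover have "?g \<in> carrier (cplx (sec X (preim X f U)))"
    using ring_hom_closed[OF cplx_map_hom[OF sec_cring[OF locally_ringed_ringed[OF Y] U]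
          sec_cring[OF locally_ringed_ringed[OF X] o] sch_hom_sh[OF f U]] g] .
  ultimately show "openin (bc_top X) (bc_map X Y f -` D \<inter> topspace (bc_top X))"
    using o unfolding bc_top_def by (intro topology_generated_by_Basis) auto
next
  show "bc_map X Y f ` topspace (bc_top X) \<subseteq>
      \<Union> {{(x, P) \<in> bc_pts Y. x \<in> U \<and> bc_germ Y x U g \<notin> P} | U g. opn Y U \<and> g \<in> carrier (cplx (sec Y U))}"
    using bc_map_bc_pts
    unfolding topspace_bc_top[OF X] topspace_bc_top[OF Y, unfolded bc_top_def topology_generated_by_topspace]
    by (rule image_subsetI)
qed

lemma fun_pull_apply:
  assumes "s \<in> carrier (fun_alg Y)" "(x, P) \<in> bc_pts X"
  shows "fun_pull X Y f s (x, P) = loc_map (cplx (stalk X x)) P (bc_stalk_map X f x) (s (bc_map X Y f (x, P)))"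
  using assms by (simp add: fun_pull_def Let_def pts_base_change[OF X] bc_map_def bc_stalk_map_def)

lemma loc_map_bc:
  assumes q: "(x, P) \<in> bc_pts X" and yQ: "bc_map X Y f (x, P) = (y, Q)"
    and a: "a \<in> carrier (cplx (stalk Y y))" "b \<in> carrier (cplx (stalk Y y)) - Q"
  shows "loc_map (cplx (stalk X x)) P (bc_stalk_map X f x) (loc_frac (cplx (stalk Y y)) Q a b) =
    loc_frac (cplx (stalk X x)) P (bc_stalk_map X f x a) (bc_stalk_map X f x b)"
proof -
  have "y = pt f x" "Q = {k \<in> carrier (cplx (stalk Y y)). bc_stalk_map X f x k \<in> P}"
    using yQ by (auto simp: bc_map_def)
  then show ?thesis
    using loc_map_frac[OF bc_pts_prime[OF q] cplx_cring[OF stalk_cring[OF Y sch_hom_pt[OF f bc_pts_base[OF q]]]]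
        bc_stalk_map_hom[OF bc_pts_base[OF q]], of Q a b] a by simp
qed

lemma bc_stalk_map_mem:
  assumes "bc_map X Y f (x, P) = (y, Q)" "k \<in> carrier (cplx (stalk Y y))"
  shows "bc_stalk_map X f x k \<in> P \<longleftrightarrow> k \<in> Q"
  using assms by (auto simp: bc_map_def)

text \<open>If s is c / d near the image point, its pullback is the fraction of the complexified
  pullbacks of c and d on the preimage neighbourhood.\<close>

lemma fun_pull_closed:
  assumes s: "s \<in> carrier (fun_alg Y)"
  shows "fun_pull X Y f s \<in> carrier (fun_alg X)"
  unfolding fun_alg_carrier[OF X]
proof (intro conjI ballI)
  show "fun_pull X Y f s \<in> extensional (bc_pts X)"
    using s by (simp add: fun_pull_def pts_base_change[OF X])
  fix q assume q: "q \<in> bc_pts X"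
  obtain x P where q': "q = (x, P)" by (cases q)
  let ?y = "pt f x"
  obtain Q where bq: "bc_map X Y f (x, P) = (?y, Q)" by (simp add: bc_map_def)
  have m: "(?y, Q) \<in> bc_pts Y" using bc_map_bc_pts[OF q[unfolded q']] unfolding bq .
  obtain N U c d where fr: "fraction_at Y s (?y, Q) N U c d"
    using s m unfolding fun_alg_carrier[OF Y] by blast
  let ?N = "{p \<in> topspace (bc_top X). bc_map X Y f p \<in> N}"
  let ?c = "cplx_map (sec X (preim X f U)) (sh f U) c" and ?d = "cplx_map (sec X (preim X f U)) (sh f U) d"
  have U: "opn Y U" and c: "c \<in> carrier (cplx (sec Y U))" and d: "d \<in> carrier (cplx (sec Y U))"
    using fr by (auto simp: fraction_at_def)
  have "fraction_at X (fun_pull X Y f s) q ?N (preim X f U) ?c ?d"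
    unfolding fraction_at_def
  proof (intro conjI)
    show "q \<in> ?N" using q fr bq by (simp add: topspace_bc_top[OF X] q' fraction_at_def)
    show "openin (bc_top X) ?N"
      by (rule openin_continuous_map_preimage[OF bc_map_continuous]) (use fr in \<open>simp add: fraction_at_def\<close>)
    show "?N \<subseteq> bc_pts X" by (auto simp: topspace_bc_top[OF X])
    show "opn X (preim X f U)" by (rule preim_open[OF f U])
    note H = cplx_map_hom[OF sec_cring[OF locally_ringed_ringed[OF Y] U]
          sec_cring[OF locally_ringed_ringed[OF X] preim_open[OF f U]] sch_hom_sh[OF f U]]
    show "?c \<in> carrier (cplx (sec X (preim X f U)))" "?d \<in> carrier (cplx (sec X (preim X f U)))"
      using ring_hom_closed[OF H] c d by auto
    show "\<forall>(y, Q) \<in> ?N. y \<in> preim X f U \<and> bc_germ X y (preim X f U) ?d \<notin> Q \<and>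
        fun_pull X Y f s (y, Q) = loc_frac (cplx (stalk X y)) Q (bc_germ X y (preim X f U) ?c) (bc_germ X y (preim X f U) ?d)"
    proof clarify
      fix y Q assume "(y, Q) \<in> topspace (bc_top X)" and n: "bc_map X Y f (y, Q) \<in> N"
      then have r: "(y, Q) \<in> bc_pts X" by (simp add: topspace_bc_top[OF X])
      note y = bc_pts_base[OF r]
      let ?z = "pt f y"
      obtain R where br: "bc_map X Y f (y, Q) = (?z, R)" by (simp add: bc_map_def)
      have z: "?z \<in> U" "bc_germ Y ?z U d \<notin> R"
        "s (?z, R) = loc_frac (cplx (stalk Y ?z)) R (bc_germ Y ?z U c) (bc_germ Y ?z U d)"
        using fr n unfolding fraction_at_def br by auto
      note G = bc_germ_hom[OF Y sch_hom_pt[OF f y] U z(1)]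
      have cl: "bc_germ Y ?z U c \<in> carrier (cplx (stalk Y ?z))" "bc_germ Y ?z U d \<in> carrier (cplx (stalk Y ?z)) - R"
        using ring_hom_closed[OF G] c d z(2) by auto
      have "bc_stalk_map X f y (bc_germ Y ?z U d) \<notin> Q"
        using cl(2) bc_stalk_map_mem[OF br] by auto
      moreover have "fun_pull X Y f s (y, Q) = loc_frac (cplx (stalk X y)) Q
          (bc_stalk_map X f y (bc_germ Y ?z U c)) (bc_stalk_map X f y (bc_germ Y ?z U d))"
        unfolding fun_pull_apply[OF s r] br z(3) by (rule loc_map_bc[OF r br cl])
      moreover have "y \<in> preim X f U" using y z(1) by (simp add: preim_def)
      ultimately show "y \<in> preim X f U \<and> bc_germ X y (preim X f U) ?d \<notin> Q \<and>
          fun_pull X Y f s (y, Q) = loc_frac (cplx (stalk X y)) Q (bc_germ X y (preim X f U) ?c) (bc_germ X y (preim X f U) ?d)"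
        by (simp add: bc_stalk_map_germ[OF y U z(1)] c d)
    qed
  qed
  then show "\<exists>N U a b. fraction_at X (fun_pull X Y f s) q N U a b" by blast
qed

end

text \<open>At each point (x, P) the value of s at the image point is a single fraction a / b; both
  sides are the fraction of the images of a and b under the stalk maps, which compose.\<close>

lemma fun_pull_comp:
  assumes X: "locally_ringed X" and Y: "locally_ringed Y" and Z: "locally_ringed Z"
    and f: "f \<in> sch_hom X Y" and g: "g \<in> sch_hom Y Z" and s: "s \<in> carrier (fun_alg Z)"
  shows "fun_pull X Z (sch_comp X Y Z g f) s = fun_pull X Y f (fun_pull Y Z g s)"
proof (rule extensionalityI)
  let ?h = "sch_comp X Y Z g f"
  note RX = locally_ringed_ringed[OF X] and RY = locally_ringed_ringed[OF Y] and RZ = locally_ringed_ringed[OF Z]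
  have h: "?h \<in> sch_hom X Z" by (rule sch_comp_hom[OF RX RY RZ f g])
  have t: "fun_pull Y Z g s \<in> carrier (fun_alg Y)" by (rule fun_pull_closed[OF Y Z g s])
  show "fun_pull X Z ?h s \<in> extensional (bc_pts X)" using fun_pull_closed[OF X Z h s] fun_alg_carrier[OF X] by blast
  show "fun_pull X Y f (fun_pull Y Z g s) \<in> extensional (bc_pts X)"
    using fun_pull_closed[OF X Y f t] fun_alg_carrier[OF X] by blast
  fix q assume q: "q \<in> bc_pts X"
  obtain x P where q': "q = (x, P)" by (cases q)
  note q'' = q[unfolded q'] and x = bc_pts_base[OF q[unfolded q']]
  let ?y = "pt f x"
  have y: "?y \<in> pts Y" by (rule sch_hom_pt[OF f x])
  have z: "pt g ?y \<in> pts Z" by (rule sch_hom_pt[OF g y])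
  obtain Q where bq: "bc_map X Y f (x, P) = (?y, Q)" by (simp add: bc_map_def)
  have m: "(?y, Q) \<in> bc_pts Y" using bc_map_bc_pts[OF X Y f q''] unfolding bq .
  have hx: "pt ?h x = pt g ?y" by (rule pt_sch_comp[OF x])
  have comp: "bc_stalk_map X ?h x k = bc_stalk_map X f x (bc_stalk_map Y g ?y k)"
    if "k \<in> carrier (cplx (stalk Z (pt g ?y)))" for k
    unfolding bc_stalk_map_def
    by (rule cplx_map_comp[OF stalk_cring[OF Z z] stalk_cring[OF Y y] stalk_cring[OF X x]
          stalk_map_hom[OF g RY RZ y] stalk_map_hom[OF f RX RY x] _ _ that])
      (use stalk_map_hom[OF h RX RZ x] stalk_map_comp[OF RX RY RZ f g x] hx in auto)
  \<comment> \<open>The two ways of transporting P to the stalk of Z give one prime ideal R, so both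
    sides evaluate s at the same point.\<close>
  have hR: "bc_map X Z ?h (x, P) = bc_map Y Z g (?y, Q)"
    using ring_hom_closed[OF bc_stalk_map_hom[OF Y Z g y]] comp bc_stalk_map_mem[OF X Y f bq]
    by (auto simp: bc_map_def hx)
  obtain R where bm: "bc_map Y Z g (?y, Q) = (pt g ?y, R)" by (simp add: bc_map_def)
  have mR: "(pt g ?y, R) \<in> bc_pts Z" using bc_map_bc_pts[OF Y Z g m] unfolding bm .
  obtain a b where ab: "a \<in> carrier (cplx (stalk Z (pt g ?y)))" "b \<in> carrier (cplx (stalk Z (pt g ?y))) - R"
    "s (pt g ?y, R) = loc_frac (cplx (stalk Z (pt g ?y))) R a b"
    using fun_alg_valueE[OF Z s mR] .
  have 1: "fun_pull X Z ?h s (x, P) = loc_frac (cplx (stalk X x)) P (bc_stalk_map X ?h x a) (bc_stalk_map X ?h x b)"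
    unfolding fun_pull_apply[OF X Z h s q''] hR bm ab(3)
    by (rule loc_map_bc[OF X Z h q'' hR[unfolded bm] ab(1,2)])
  have 2: "fun_pull Y Z g s (?y, Q) = loc_frac (cplx (stalk Y ?y)) Q (bc_stalk_map Y g ?y a) (bc_stalk_map Y g ?y b)"
    unfolding fun_pull_apply[OF Y Z g s m] bm ab(3) by (rule loc_map_bc[OF Y Z g m bm ab(1,2)])
  have cl: "bc_stalk_map Y g ?y a \<in> carrier (cplx (stalk Y ?y))"
    "bc_stalk_map Y g ?y b \<in> carrier (cplx (stalk Y ?y)) - Q"
    using ab ring_hom_closed[OF bc_stalk_map_hom[OF Y Z g y]] bc_stalk_map_mem[OF Y Z g bm] by auto
  have "fun_pull X Y f (fun_pull Y Z g s) (x, P) =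
      loc_frac (cplx (stalk X x)) P (bc_stalk_map X f x (bc_stalk_map Y g ?y a)) (bc_stalk_map X f x (bc_stalk_map Y g ?y b))"
    unfolding fun_pull_apply[OF X Y f t q''] bq 2 by (rule loc_map_bc[OF X Y f q'' bq cl])
  then show "fun_pull X Z ?h s q = fun_pull X Y f (fun_pull Y Z g s) q"
    unfolding q' 1 using comp ab by simp
qed

section \<open>Gluing morphisms along an open cover\<close>

lemma ft_scheme_locally_ringed: "ft_scheme X \<Longrightarrow> locally_ringed X"
  by (simp add: ft_scheme_def is_scheme_def)

section \<open>Open subspaces and equality of morphisms on a cover\<close>

lemma sec_open_sub [simp]: "sec (open_sub V U) = sec V"
  by (simp add: open_sub_def)

lemma res_open_sub [simp]: "res (open_sub V U) = res V"
  by (simp add: open_sub_def)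

lemma pts_open_sub: "opn V U \<Longrightarrow> pts (open_sub V U) = U"
  using openin_subset[of "base V" U] by (auto simp: open_sub_def)

lemma opn_open_sub: "opn V U \<Longrightarrow> opn (open_sub V U) N \<longleftrightarrow> opn V N \<and> N \<subseteq> U"
  by (simp add: open_sub_def openin_open_subtopology)

lemma preim_open_incl: "opn V U \<Longrightarrow> preim (open_sub V U) (open_incl V U) N = N \<inter> U"
  by (auto simp: preim_def pts_open_sub open_incl_def)

lemma preim_open_sub: "opn V U \<Longrightarrow> preim (open_sub V U) g N = {x \<in> U. pt g x \<in> N}"
  by (simp add: preim_def pts_open_sub)

lemma pt_comp_open_incl:
  "opn V U \<Longrightarrow> x \<in> U \<Longrightarrow> pt (sch_comp (open_sub V U) V W g (open_incl V U)) x = pt g x"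
  by (simp add: pt_sch_comp pts_open_sub open_incl_def)

lemma sh_comp_open_incl:
  assumes "opn V U" "opn W N" "t \<in> carrier (sec W N)" "g \<in> ringed_hom V W"
  shows "sh (sch_comp (open_sub V U) V W g (open_incl V U)) N t =
    res V (preim V g N) (preim V g N \<inter> U) (sh g N t)"
  using assms ringed_hom_preim_open[OF assms(4,2)] ringed_hom_sh_closed[OF assms(4,2,3)]
  by (simp add: sh_sch_comp open_incl_def)

lemma sch_hom_eqI:
  assumes "f \<in> sch_hom X Y" "g \<in> sch_hom X Y"
    and "\<And>x. x \<in> pts X \<Longrightarrow> pt f x = pt g x"
    and "\<And>N t. opn Y N \<Longrightarrow> t \<in> carrier (sec Y N) \<Longrightarrow> sh f N t = sh g N t"
  shows "f = g"
proof (rule smor.equality)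
  show "pt f = pt g"
    using sch_hom_pt_ext[OF assms(1)] sch_hom_pt_ext[OF assms(2)] assms(3) by (rule extensionalityI)
  show "sh f = sh g"
  proof (rule extensionalityI[OF sch_hom_sh_ext[OF assms(1)] sch_hom_sh_ext[OF assms(2)]])
    fix N assume "N \<in> {N. opn Y N}"
    then have N: "opn Y N" by simp
    show "sh f N = sh g N"
      using sch_hom_sh_rhom[OF assms(1) N] sch_hom_sh_rhom[OF assms(2) N] assms(4)[OF N]
      by (intro extensionalityI[of _ "carrier (sec Y N)"]) (auto simp: rhom_def)
  qed
qed simp

text \<open>Agreement of the point maps makes the preimages of N equal, so that
  \<open>sh g N t\<close> and \<open>sh h N t\<close> are sections of one ring and can be compared
  after restriction to the cover.\<close>

lemma sch_hom_eq_on_cover: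
  assumes V: "ringed_space V" and U: "\<And>i. i \<in> I \<Longrightarrow> opn V (U i)" "(\<Union>i \<in> I. U i) = pts V"
    and g: "g \<in> sch_hom V W" and h: "h \<in> sch_hom V W"
    and eq: "\<And>i. i \<in> I \<Longrightarrow> sch_comp (open_sub V (U i)) V W g (open_incl V (U i)) =
      sch_comp (open_sub V (U i)) V W h (open_incl V (U i))"
  shows "g = h"
proof (rule sch_hom_eqI[OF g h])
  have p: "pt g x = pt h x" if x: "x \<in> pts V" for x
  proof -
    obtain i where i: "i \<in> I" "x \<in> U i" using x U(2) by blast
    show ?thesis
      using arg_cong[OF eq[OF i(1)], of "\<lambda>f. pt f x"] by (simp add: pt_comp_open_incl U(1) i)
  qed
  then show "pt g x = pt h x" if "x \<in> pts V" for x using that .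
  fix N t assume N: "opn W N" and t: "t \<in> carrier (sec W N)"
  have pre: "preim V g N = preim V h N" using p by (auto simp: preim_def)
  note o = preim_open[OF g N]
  show "sh g N t = sh h N t"
  proof (rule section_eqI[OF V, of I "\<lambda>i. preim V g N \<inter> U i"])
    show "preim V g N = (\<Union>i \<in> I. preim V g N \<inter> U i)" using U(2) by (auto simp: preim_def)
    show "sh g N t \<in> carrier (sec V (preim V g N))" by (rule sh_closed[OF g N t])
    show "sh h N t \<in> carrier (sec V (preim V g N))" unfolding pre by (rule sh_closed[OF h N t])
    fix i assume i: "i \<in> I"
    show "opn V (preim V g N \<inter> U i)" using o U(1)[OF i] by (rule openin_Int)
    show "res V (preim V g N) (preim V g N \<inter> U i) (sh g N t) = res V (preim V g N) (preim V g N \<inter> U i) (sh h N t)"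
      using arg_cong[OF eq[OF i], of "\<lambda>f. sh f N t"]
      by (simp add: sh_comp_open_incl[OF U(1)[OF i] N t sch_hom_ringed] g h pre)
  qed
qed

section \<open>Construction of the glued morphism\<close>

context
  fixes V :: "('p, 'r) rspace" and W :: "('q, 's) rspace" and I :: "'i set" and U :: "'i \<Rightarrow> 'p set"
    and g :: "'i \<Rightarrow> ('p, 'r, 'q, 's) smor"
  assumes V: "locally_ringed V" and W: "locally_ringed W"
    and U: "\<And>i. i \<in> I \<Longrightarrow> opn V (U i)" "(\<Union>i \<in> I. U i) = pts V"
    and lr: "\<And>i. i \<in> I \<Longrightarrow> locally_ringed (open_sub V (U i))"
    and incl: "\<And>i. i \<in> I \<Longrightarrow> open_incl V (U i) \<in> sch_hom (open_sub V (U i)) V"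
    and g: "\<And>i. i \<in> I \<Longrightarrow> g i \<in> sch_hom (open_sub V (U i)) W"
    and compat: "\<And>i j. i \<in> I \<Longrightarrow> j \<in> I \<Longrightarrow> i \<noteq> j \<Longrightarrow>
      sch_comp (open_sub V (U i \<inter> U j)) (open_sub V (U i)) W (g i) (open_incl (open_sub V (U i)) (U i \<inter> U j)) =
      sch_comp (open_sub V (U i \<inter> U j)) (open_sub V (U j)) W (g j) (open_incl (open_sub V (U j)) (U i \<inter> U j))"
begin

text \<open>The preimage of N under \<open>g i\<close>, viewed as an open set of V.
  \<open>open_sub\<close> keeps the sections of V, so \<open>sh (g i) N\<close> takes values in
  sections of V over it.\<close>

private abbreviation (input) P where "P i N \<equiv> {x \<in> U i. pt (g i) x \<in> N}"

private lemma preim_g: "i \<in> I \<Longrightarrow> preim (open_sub V (U i)) (g i) N = P i N"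
  by (rule preim_open_sub[OF U(1)])

private lemma open_P: "i \<in> I \<Longrightarrow> opn W N \<Longrightarrow> opn V (P i N)"
  using preim_open[OF g, of i N] by (simp add: preim_g opn_open_sub U(1))

private lemma sh_g: "i \<in> I \<Longrightarrow> opn W N \<Longrightarrow> sh (g i) N \<in> ring_hom (sec W N) (sec V (P i N))"
  using sch_hom_sh[OF g, of i N] by (simp add: preim_g)

private lemma compat_pt:
  assumes "i \<in> I" "j \<in> I" "x \<in> U i" "x \<in> U j"
  shows "pt (g i) x = pt (g j) x"
proof (cases "i = j")
  case False
  have o: "opn V (U i \<inter> U j)" using assms U(1) by (simp add: openin_Int)
  show ?thesis
    using arg_cong[OF compat[OF assms(1,2) False], of "\<lambda>f. pt f x"] assms(3,4)
    by (simp add: pt_sch_comp pts_open_sub[OF o]) (simp add: open_incl_def)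
qed simp

text \<open>The compatibility hypothesis compares restrictions to \<open>U i \<inter> U j\<close>;
  this rephrases it over the sets where sections of V will be glued.\<close>

private lemma compat_sh:
  assumes i: "i \<in> I" and j: "j \<in> I" and N: "opn W N" and t: "t \<in> carrier (sec W N)"
  shows "res V (P i N) (P i N \<inter> P j N) (sh (g i) N t) = res V (P j N) (P i N \<inter> P j N) (sh (g j) N t)"
proof (cases "i = j")
  case False
  \<comment> \<open>On \<open>U i \<inter> U j\<close> the maps \<open>g i\<close> and
    \<open>g j\<close> have the same values, so a point there is sent into N by one exactly when it
    is by the other.\<close>
  have eq: "P i N \<inter> (U i \<inter> U j) = P i N \<inter> P j N" "P j N \<inter> (U i \<inter> U j) = P i N \<inter> P j N"
    using compat_pt[OF i j] by auto
  have o: "opn (open_sub V (U i)) (P i N)" "opn (open_sub V (U j)) (P j N)"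
    using open_P[OF i N] open_P[OF j N] by (auto simp: opn_open_sub U(1) i j)
  show ?thesis
    using arg_cong[OF compat[OF i j False], of "\<lambda>f. sh f N t"] o
      ring_hom_closed[OF sh_g[OF i N] t] ring_hom_closed[OF sh_g[OF j N] t]
    by (simp add: sh_sch_comp[OF N t] preim_g i j) (simp add: open_incl_def eq)
qed simp

text \<open>The chart containing x is chosen arbitrarily; \<open>compat_pt\<close> makes the value
  independent of the choice.\<close>

private definition G_pt where
  "G_pt = (\<lambda>x \<in> pts V. pt (g (SOME i. i \<in> I \<and> x \<in> U i)) x)"

private definition G_preim where "G_preim N = (\<Union>i \<in> I. P i N)"

text \<open>The described section is the unique gluing of the local pullbacks of t; existence and
  uniqueness come from \<open>glue_sections\<close>. \<open>G_preim N\<close> is a union of the sets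
  on which these pullbacks live, which suits gluing, and turns out to be the preimage of N.\<close>

private definition G_sh where
  "G_sh = (\<lambda>N \<in> {N. opn W N}. \<lambda>t \<in> carrier (sec W N).
    THE s. s \<in> carrier (sec V (G_preim N)) \<and> (\<forall>i \<in> I. res V (G_preim N) (P i N) s = sh (g i) N t))"

private definition G where "G = \<lparr>pt = G_pt, sh = G_sh\<rparr>"

private lemma pt_G:
  assumes i: "i \<in> I" and x: "x \<in> U i"
  shows "pt G x = pt (g i) x"
proof -
  have "x \<in> pts V" using U(2) assms by blast
  moreover have "(SOME i. i \<in> I \<and> x \<in> U i) \<in> I \<and> x \<in> U (SOME i. i \<in> I \<and> x \<in> U i)"
    by (rule someI[of "\<lambda>i. i \<in> I \<and> x \<in> U i"]) (use assms in blast)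
  ultimately show ?thesis
    using compat_pt[OF _ i _ x] by (simp add: G_def G_pt_def)
qed

private lemma preim_G: "preim V G N = G_preim N"
proof
  show "preim V G N \<subseteq> G_preim N"
    unfolding preim_def G_preim_def U(2)[symmetric] using pt_G by auto
  show "G_preim N \<subseteq> preim V G N"
    unfolding preim_def G_preim_def U(2)[symmetric] using pt_G by auto
qed

private lemma open_G: "opn W N \<Longrightarrow> opn V (G_preim N)"
  unfolding G_preim_def by (rule openin_Union) (use open_P in blast)

private lemma P_G: "i \<in> I \<Longrightarrow> P i N \<subseteq> G_preim N"
  unfolding G_preim_def by blast

private lemma sh_G:
  assumes N: "opn W N" and t: "t \<in> carrier (sec W N)"
  shows "sh G N t \<in> carrier (sec V (G_preim N))"
    and "i \<in> I \<Longrightarrow> res V (G_preim N) (P i N) (sh G N t) = sh (g i) N t"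
proof -
  have "\<exists>!s. s \<in> carrier (sec V (G_preim N)) \<and> (\<forall>i \<in> I. res V (G_preim N) (P i N) s = sh (g i) N t)"
    unfolding G_preim_def
    by (rule glue_sections[OF locally_ringed_ringed[OF V], of I "\<lambda>i. P i N" "\<lambda>i. sh (g i) N t"])
      (use open_P[OF _ N] ring_hom_closed[OF sh_g[OF _ N] t] compat_sh[OF _ _ N t] in auto)
  from theI'[OF this] show "sh G N t \<in> carrier (sec V (G_preim N))"
    and "i \<in> I \<Longrightarrow> res V (G_preim N) (P i N) (sh G N t) = sh (g i) N t"
    using N t by (simp_all add: G_def G_sh_def)
qed

private lemma G_sec_eqI:
  assumes "opn W N" "s \<in> carrier (sec V (G_preim N))" "t \<in> carrier (sec V (G_preim N))"
    and "\<And>i. i \<in> I \<Longrightarrow> res V (G_preim N) (P i N) s = res V (G_preim N) (P i N) t"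
  shows "s = t"
  by (rule section_eqI[OF locally_ringed_ringed[OF V] open_P[OF _ assms(1)] G_preim_def assms(2-4)])

text \<open>Every identity between sections over \<open>G_preim N\<close> is tested on the pieces
  \<open>P i N\<close>, where \<open>sh G\<close> restricts to \<open>sh (g i)\<close> and the
  identity holds because \<open>g i\<close> is a morphism.\<close>

private lemma G_ringed_hom: "G \<in> ringed_hom V W"
  unfolding ringed_hom_def
proof (intro CollectI conjI allI impI ballI)
  note RV = locally_ringed_ringed[OF V] and RW = locally_ringed_ringed[OF W]
  show "continuous_map (base V) (base W) (pt G)"
    unfolding continuous_map_def
  proof (intro conjI allI impI Pi_I)
    fix x assume "x \<in> pts V"
    then obtain i where i: "i \<in> I" "x \<in> U i" using U(2) by blast
    then show "pt G x \<in> pts W" using sch_hom_pt[OF g, of i x] by (simp add: pt_G pts_open_sub U(1))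
  next
    fix N assume "opn W N"
    then show "opn V {x \<in> pts V. pt G x \<in> N}" using open_G preim_G by (simp add: preim_def)
  qed
  show "sh G N \<in> rhom (sec W N) (sec V (preim V G N))" if N: "opn W N" for N
    unfolding rhom_def preim_G
  proof (intro IntI ring_hom_memI)
    interpret N: cring "sec W N" by (rule sec_cring[OF RW N])
    interpret GN: cring "sec V (G_preim N)" by (rule sec_cring[OF RV open_G[OF N]])
    note R = res_hom[OF RV open_G[OF N] open_P[OF _ N] P_G] and S = sh_g[OF _ N]
    note H = ring_hom_mult[OF R] ring_hom_add[OF R] ring_hom_one[OF R]
      ring_hom_mult[OF S] ring_hom_add[OF S] ring_hom_one[OF S]
    show "sh G N \<one>\<^bsub>sec W N\<^esub> = \<one>\<^bsub>sec V (G_preim N)\<^esub>"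
      by (rule G_sec_eqI[OF N]) (simp_all add: sh_G[OF N] H)
    show "sh G N t \<in> carrier (sec V (G_preim N))" if "t \<in> carrier (sec W N)" for t
      by (rule sh_G(1)[OF N that])
    show "sh G N \<in> extensional (carrier (sec W N))"
      using N by (simp add: G_def G_sh_def)
    fix t u assume tu: "t \<in> carrier (sec W N)" "u \<in> carrier (sec W N)"
    then show "sh G N (t \<otimes>\<^bsub>sec W N\<^esub> u) = sh G N t \<otimes>\<^bsub>sec V (G_preim N)\<^esub> sh G N u"
      by (rule_tac G_sec_eqI[OF N]) (simp_all add: sh_G[OF N] H)
    from tu
    show "sh G N (t \<oplus>\<^bsub>sec W N\<^esub> u) = sh G N t \<oplus>\<^bsub>sec V (G_preim N)\<^esub> sh G N u"
      by (rule_tac G_sec_eqI[OF N]) (simp_all add: sh_G[OF N] H)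
  qed
  fix N M t assume a: "opn W N \<and> opn W M \<and> M \<subseteq> N" and t: "t \<in> carrier (sec W N)"
  have N: "opn W N" and M: "opn W M" and MN: "M \<subseteq> N" using a by auto
  have sub: "G_preim M \<subseteq> G_preim N" using MN by (auto simp: G_preim_def)
  have rt: "res W N M t \<in> carrier (sec W M)" by (rule res_closed[OF RW N M MN t])
  show "sh G M (res W N M t) = res V (preim V G N) (preim V G M) (sh G N t)"
    unfolding preim_G
  proof (rule G_sec_eqI[OF M sh_G(1)[OF M rt] res_closed[OF RV open_G[OF N] open_G[OF M] sub sh_G(1)[OF N t]]])
    fix i assume i: "i \<in> I"
    have PS: "P i M \<subseteq> P i N" using MN by auto
    have "res V (G_preim M) (P i M) (res V (G_preim N) (G_preim M) (sh G N t)) = res V (G_preim N) (P i M) (sh G N t)"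
      by (rule res_res[OF RV open_G[OF N] open_G[OF M] open_P[OF i M] P_G[OF i] sub sh_G(1)[OF N t]])
    also have "\<dots> = res V (P i N) (P i M) (res V (G_preim N) (P i N) (sh G N t))"
      by (rule res_res[OF RV open_G[OF N] open_P[OF i N] open_P[OF i M] PS P_G[OF i] sh_G(1)[OF N t], symmetric])
    also have "\<dots> = sh (g i) M (res W N M t)"
      using sh_res[OF g[OF i] N M MN t] by (simp add: sh_G(2)[OF N t i] preim_g i)
    finally show "res V (G_preim M) (P i M) (sh G M (res W N M t)) =
        res V (G_preim M) (P i M) (res V (G_preim N) (G_preim M) (sh G N t))"
      by (simp add: sh_G(2)[OF M rt i])
  qed
qed

text \<open>Makes the restriction of \<open>sh G\<close> to the open subspace \<open>U i\<close> the
  same as its restriction to \<open>P i N\<close>, namely \<open>sh (g i)\<close>.\<close>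

private lemma G_preim_Int:
  assumes i: "i \<in> I"
  shows "G_preim N \<inter> U i = P i N"
proof
  show "P i N \<subseteq> G_preim N \<inter> U i" using P_G[OF i] by blast
  show "G_preim N \<inter> U i \<subseteq> P i N"
  proof
    fix x assume x: "x \<in> G_preim N \<inter> U i"
    then obtain j where "j \<in> I" "x \<in> U j" "pt (g j) x \<in> N" unfolding G_preim_def by blast
    then show "x \<in> P i N" using compat_pt[OF i, of j x] x by simp
  qed
qed

text \<open>The stalks of \<open>V\<close> and of its open subspaces are different sets; locality of the glued morphism
  is tested after mapping to the stalks of \<open>U i\<close>.\<close>

private lemma G_sch_hom: "G \<in> sch_hom V W"
proof -
  note RV = locally_ringed_ringed[OF V] and RW = locally_ringed_ringed[OF W]
  have "a \<in> Units (stalk W (pt G x))"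
    if x: "x \<in> pts V" and a: "a \<in> carrier (stalk W (pt G x))" and u: "stalk_map V G x a \<in> Units (stalk V x)" for x a
  proof -
    obtain i where i: "i \<in> I" "x \<in> U i" using x U(2) by blast
    let ?Vi = "open_sub V (U i)" and ?inc = "open_incl V (U i)"
    note RVi = locally_ringed_ringed[OF lr[OF i(1)]]
    have xi: "x \<in> pts ?Vi" using i by (simp add: pts_open_sub U(1))
    have incx: "pt ?inc x = x" using i by (simp add: open_incl_def)
    have incsh: "sh ?inc M s = res V M (M \<inter> U i) s" if "opn V M" "s \<in> carrier (sec V M)" for M s
      using that by (simp add: open_incl_def)
    obtain N t where N: "opn W N" "pt G x \<in> N" "t \<in> carrier (sec W N)" "a = germ W (pt G x) N t"
      using a by (rule stalk_carrierE[OF RW])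
    have xN: "x \<in> preim V G N" using x N(2) by (simp add: preim_def)
    \<comment> \<open>The factorisation of the stalk map of \<open>g i\<close> through that of G is
      computed on a representative (N, t): \<open>stalk_map_comp\<close> asks for a
      \<open>sch_hom\<close>, which G is only about to become.\<close>
    have "stalk_map ?Vi ?inc x (stalk_map V G x a) = stalk_map ?Vi ?inc x (germ V (pt ?inc x) (G_preim N) (sh G N t))"
      unfolding N(4) ringed_hom_stalk_map_germ[OF G_ringed_hom RV RW x N(1-3)] preim_G incx ..
    also have "\<dots> = germ ?Vi x (G_preim N \<inter> U i) (res V (G_preim N) (G_preim N \<inter> U i) (sh G N t))"
      using sh_G(1)[OF N(1,3)] open_G[OF N(1)] xN
      by (subst stalk_map_germ[OF incl[OF i(1)] RVi RV xi])
        (simp_all add: incx incsh preim_G preim_open_incl[OF U(1)[OF i(1)]])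
    also have "\<dots> = stalk_map ?Vi (g i) x (germ W (pt (g i) x) N t)"
      using N i by (subst stalk_map_germ[OF g[OF i(1)] RVi RW xi])
        (simp_all add: sh_G(2) preim_g pt_G G_preim_Int)
    also have "\<dots> = stalk_map ?Vi (g i) x a" using N(4) i by (simp add: pt_G)
    finally have e: "stalk_map ?Vi ?inc x (stalk_map V G x a) = stalk_map ?Vi (g i) x a" .
    \<comment> \<open>The unit of the stalk of V is carried to a unit of the stalk of
      \<open>U i\<close>, where locality of \<open>g i\<close> applies.\<close>
    have "stalk_map ?Vi ?inc x (stalk_map V G x a) \<in> Units (stalk ?Vi x)"
      using ring_hom_Units[OF stalk_map_hom[OF incl[OF i(1)] RVi RV xi]] u stalk_cring[OF V x]
      by (simp add: incx cring_def ring_def)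
    then show ?thesis
      using sch_hom_local[OF g[OF i(1)] xi] a i unfolding e by (simp add: pt_G)
  qed
  moreover have "pt G \<in> extensional (pts V)" "sh G \<in> extensional {N. opn W N}"
    by (simp_all add: G_def G_pt_def G_sh_def)
  ultimately show ?thesis
    using G_ringed_hom unfolding ringed_hom_def sch_hom_def by simp
qed

lemma glue_sch_hom:
  "\<exists>h \<in> sch_hom V W. \<forall>i \<in> I. sch_comp (open_sub V (U i)) V W h (open_incl V (U i)) = g i"
proof (rule bexI[OF _ G_sch_hom], rule ballI)
  fix i assume i: "i \<in> I"
  note RV = locally_ringed_ringed[OF V] and RW = locally_ringed_ringed[OF W]
  show "sch_comp (open_sub V (U i)) V W G (open_incl V (U i)) = g i"
  proof (rule sch_hom_eqI[OF sch_comp_hom[OF locally_ringed_ringed[OF lr[OF i]] RV RW incl[OF i] G_sch_hom] g[OF i]])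
    show "pt (sch_comp (open_sub V (U i)) V W G (open_incl V (U i))) x = pt (g i) x"
      if "x \<in> pts (open_sub V (U i))" for x
      using that i by (simp add: pts_open_sub U(1) pt_comp_open_incl pt_G)
    show "sh (sch_comp (open_sub V (U i)) V W G (open_incl V (U i))) N t = sh (g i) N t"
      if "opn W N" "t \<in> carrier (sec W N)" for N t
      using that by (simp add: sh_comp_open_incl[OF U(1)[OF i] _ _ G_ringed_hom] preim_G G_preim_Int[OF i] sh_G(2)[OF _ _ i])
  qed
qed

end

section \<open>Closure properties of the algebra of functions\<close>

text \<open>If t and u witness the equivalence of the representatives of the two factors, t u
  witnesses that of the products. The same multiplier serves for sums.\<close>

lemma loc_frac_mult:
  assumes P: "primeideal P R" and a: "a \<in> carrier R" "b \<in> carrier R - P"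
    and c: "c \<in> carrier R" "d \<in> carrier R - P"
  shows "loc_frac R P a b \<otimes>\<^bsub>localisation R P\<^esub> loc_frac R P c d = loc_frac R P (a \<otimes>\<^bsub>R\<^esub> c) (b \<otimes>\<^bsub>R\<^esub> d)"
proof -
  interpret primeideal P R by fact
  have mclosed: "s \<otimes>\<^bsub>R\<^esub> t \<in> carrier R - P" if "s \<in> carrier R - P" "t \<in> carrier R - P" for s t
    using that I_prime by auto
  have "loc_frac R P (a' \<otimes>\<^bsub>R\<^esub> c') (b' \<otimes>\<^bsub>R\<^esub> d') = loc_frac R P (a \<otimes>\<^bsub>R\<^esub> c) (b \<otimes>\<^bsub>R\<^esub> d)"
    if m: "(a', b') \<in> loc_frac R P a b" "(c', d') \<in> loc_frac R P c d" for a' b' c' d'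
  proof (rule loc_frac_eqI[OF P m_closed[OF a(1) c(1)] mclosed[OF a(2) c(2)]])
    obtain t u where t: "a' \<in> carrier R" "b' \<in> carrier R - P" "t \<in> carrier R - P"
      "t \<otimes>\<^bsub>R\<^esub> (a \<otimes>\<^bsub>R\<^esub> b') = t \<otimes>\<^bsub>R\<^esub> (a' \<otimes>\<^bsub>R\<^esub> b)"
      and u: "c' \<in> carrier R" "d' \<in> carrier R - P" "u \<in> carrier R - P"
      "u \<otimes>\<^bsub>R\<^esub> (c \<otimes>\<^bsub>R\<^esub> d') = u \<otimes>\<^bsub>R\<^esub> (c' \<otimes>\<^bsub>R\<^esub> d)"
      using m unfolding loc_frac_def by blast
    have k: "b \<in> carrier R" "d \<in> carrier R" "b' \<in> carrier R" "d' \<in> carrier R" "t \<in> carrier R" "u \<in> carrier R"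
      using a c t u by auto
    have "(t \<otimes>\<^bsub>R\<^esub> u) \<otimes>\<^bsub>R\<^esub> ((a \<otimes>\<^bsub>R\<^esub> c) \<otimes>\<^bsub>R\<^esub> (b' \<otimes>\<^bsub>R\<^esub> d')) = (t \<otimes>\<^bsub>R\<^esub> (a \<otimes>\<^bsub>R\<^esub> b')) \<otimes>\<^bsub>R\<^esub> (u \<otimes>\<^bsub>R\<^esub> (c \<otimes>\<^bsub>R\<^esub> d'))"
      using a(1) c(1) k by (simp add: m_ac)
    also have "\<dots> = (t \<otimes>\<^bsub>R\<^esub> u) \<otimes>\<^bsub>R\<^esub> ((a' \<otimes>\<^bsub>R\<^esub> c') \<otimes>\<^bsub>R\<^esub> (b \<otimes>\<^bsub>R\<^esub> d))"
      unfolding t(4) u(4) using t(1) u(1) k by (simp add: m_ac)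
    finally show "(a' \<otimes>\<^bsub>R\<^esub> c', b' \<otimes>\<^bsub>R\<^esub> d') \<in> loc_frac R P (a \<otimes>\<^bsub>R\<^esub> c) (b \<otimes>\<^bsub>R\<^esub> d)"
      using mclosed[OF t(3) u(3)] mclosed[OF t(2) u(2)] m_closed[OF t(1) u(1)] unfolding loc_frac_def by auto
  qed
  then show ?thesis
    unfolding localisation_def monoid.simps
    by (intro UN_pair_eqI[OF loc_frac_self[OF P a]] UN_pair_eqI[OF loc_frac_self[OF P c]])
qed

lemma loc_frac_add:
  assumes P: "primeideal P R" and a: "a \<in> carrier R" "b \<in> carrier R - P"
    and c: "c \<in> carrier R" "d \<in> carrier R - P"
  shows "loc_frac R P a b \<oplus>\<^bsub>localisation R P\<^esub> loc_frac R P c d =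
    loc_frac R P ((a \<otimes>\<^bsub>R\<^esub> d) \<oplus>\<^bsub>R\<^esub> (c \<otimes>\<^bsub>R\<^esub> b)) (b \<otimes>\<^bsub>R\<^esub> d)"
proof -
  interpret primeideal P R by fact
  have mclosed: "s \<otimes>\<^bsub>R\<^esub> t \<in> carrier R - P" if "s \<in> carrier R - P" "t \<in> carrier R - P" for s t
    using that I_prime by auto
  have bd: "b \<in> carrier R" "d \<in> carrier R" using a c by auto
  have sum: "(a \<otimes>\<^bsub>R\<^esub> d) \<oplus>\<^bsub>R\<^esub> (c \<otimes>\<^bsub>R\<^esub> b) \<in> carrier R" using a c bd by simp
  have "loc_frac R P ((a' \<otimes>\<^bsub>R\<^esub> d') \<oplus>\<^bsub>R\<^esub> (c' \<otimes>\<^bsub>R\<^esub> b')) (b' \<otimes>\<^bsub>R\<^esub> d') =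
      loc_frac R P ((a \<otimes>\<^bsub>R\<^esub> d) \<oplus>\<^bsub>R\<^esub> (c \<otimes>\<^bsub>R\<^esub> b)) (b \<otimes>\<^bsub>R\<^esub> d)"
    if m: "(a', b') \<in> loc_frac R P a b" "(c', d') \<in> loc_frac R P c d" for a' b' c' d'
  proof (rule loc_frac_eqI[OF P sum mclosed[OF a(2) c(2)]])
    obtain t u where t: "a' \<in> carrier R" "b' \<in> carrier R - P" "t \<in> carrier R - P"
      "t \<otimes>\<^bsub>R\<^esub> (a \<otimes>\<^bsub>R\<^esub> b') = t \<otimes>\<^bsub>R\<^esub> (a' \<otimes>\<^bsub>R\<^esub> b)"
      and u: "c' \<in> carrier R" "d' \<in> carrier R - P" "u \<in> carrier R - P"
      "u \<otimes>\<^bsub>R\<^esub> (c \<otimes>\<^bsub>R\<^esub> d') = u \<otimes>\<^bsub>R\<^esub> (c' \<otimes>\<^bsub>R\<^esub> d)"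
      using m unfolding loc_frac_def by blast
    have k: "b' \<in> carrier R" "d' \<in> carrier R" "t \<in> carrier R" "u \<in> carrier R"
      using t u by auto
    \<comment> \<open>Each summand is regrouped to isolate one side of a given equation: a b' with t
      in the first, c d' with u in the second.\<close>
    have "(t \<otimes>\<^bsub>R\<^esub> u) \<otimes>\<^bsub>R\<^esub> (((a \<otimes>\<^bsub>R\<^esub> d) \<oplus>\<^bsub>R\<^esub> (c \<otimes>\<^bsub>R\<^esub> b)) \<otimes>\<^bsub>R\<^esub> (b' \<otimes>\<^bsub>R\<^esub> d')) =
        (t \<otimes>\<^bsub>R\<^esub> (a \<otimes>\<^bsub>R\<^esub> b')) \<otimes>\<^bsub>R\<^esub> (u \<otimes>\<^bsub>R\<^esub> (d \<otimes>\<^bsub>R\<^esub> d')) \<oplus>\<^bsub>R\<^esub> (u \<otimes>\<^bsub>R\<^esub> (c \<otimes>\<^bsub>R\<^esub> d')) \<otimes>\<^bsub>R\<^esub> (t \<otimes>\<^bsub>R\<^esub> (b \<otimes>\<^bsub>R\<^esub> b'))"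
      using a(1) c(1) k bd by (simp add: m_ac l_distr r_distr)
    also have "\<dots> = (t \<otimes>\<^bsub>R\<^esub> u) \<otimes>\<^bsub>R\<^esub> (((a' \<otimes>\<^bsub>R\<^esub> d') \<oplus>\<^bsub>R\<^esub> (c' \<otimes>\<^bsub>R\<^esub> b')) \<otimes>\<^bsub>R\<^esub> (b \<otimes>\<^bsub>R\<^esub> d))"
      unfolding t(4) u(4) using t(1) u(1) k bd by (simp add: m_ac l_distr r_distr)
    finally show "((a' \<otimes>\<^bsub>R\<^esub> d') \<oplus>\<^bsub>R\<^esub> (c' \<otimes>\<^bsub>R\<^esub> b'), b' \<otimes>\<^bsub>R\<^esub> d') \<in>
        loc_frac R P ((a \<otimes>\<^bsub>R\<^esub> d) \<oplus>\<^bsub>R\<^esub> (c \<otimes>\<^bsub>R\<^esub> b)) (b \<otimes>\<^bsub>R\<^esub> d)"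
      using mclosed[OF t(3) u(3)] mclosed[OF t(2) u(2)] t(1) u(1) k unfolding loc_frac_def by auto
  qed
  then show ?thesis
    unfolding localisation_def ring.simps
    by (intro UN_pair_eqI[OF loc_frac_self[OF P a]] UN_pair_eqI[OF loc_frac_self[OF P c]])
qed

section \<open>Functions on the complexification are closed under the algebra operations\<close>

context
  fixes X :: "('p, 'r) rspace"
  assumes X: "locally_ringed X"
begin

private lemma bc_germ_res:
  assumes "opn X U" "opn X W" "W \<subseteq> U" "x \<in> W" "k \<in> carrier (cplx (sec X U))"
  shows "bc_germ X x W (cplx_map (sec X W) (res X U W) k) = bc_germ X x U k"
proof -
  note R = locally_ringed_ringed[OF X]
  have x: "x \<in> pts X" "x \<in> U" using assms openin_subset[of "base X" W] by auto
  show ?thesis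
    unfolding bc_germ_def
    by (rule cplx_map_comp[OF sec_cring[OF R] sec_cring[OF R] stalk_cring[OF X] res_hom[OF R] germ_hom[OF R]
          germ_hom[OF R], symmetric])
      (use assms x germ_res[OF R] in auto)
qed

text \<open>Restricting numerator and denominator to W leaves their germs over N' unchanged, so the
  local expression survives on a smaller neighbourhood and with sections of a smaller open
  set.\<close>

private lemma fraction_at_restrict:
  assumes fr: "fraction_at X s q N U a b"
    and N: "openin (bc_top X) N'" "q \<in> N'" "N' \<subseteq> N"
    and W: "opn X W" "W \<subseteq> U" "\<And>y Q. (y, Q) \<in> N' \<Longrightarrow> y \<in> W"
  shows "fraction_at X s q N' W (cplx_map (sec X W) (res X U W) a) (cplx_map (sec X W) (res X U W) b)"
proof -
  note R = locally_ringed_ringed[OF X]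
  have U: "opn X U" and ab: "a \<in> carrier (cplx (sec X U))" "b \<in> carrier (cplx (sec X U))"
    using fr by (auto simp: fraction_at_def)
  note H = cplx_map_hom[OF sec_cring[OF R U] sec_cring[OF R W(1)] res_hom[OF R U W(1,2)]]
  have "\<forall>(y, Q) \<in> N'. y \<in> W \<and> bc_germ X y W (cplx_map (sec X W) (res X U W) b) \<notin> Q \<and>
      s (y, Q) = loc_frac (cplx (stalk X y)) Q (bc_germ X y W (cplx_map (sec X W) (res X U W) a))
        (bc_germ X y W (cplx_map (sec X W) (res X U W) b))"
  proof clarify
    fix y Q assume n: "(y, Q) \<in> N'"
    show "y \<in> W \<and> bc_germ X y W (cplx_map (sec X W) (res X U W) b) \<notin> Q \<and>
      s (y, Q) = loc_frac (cplx (stalk X y)) Q (bc_germ X y W (cplx_map (sec X W) (res X U W) a))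
        (bc_germ X y W (cplx_map (sec X W) (res X U W) b))"
      using fr n N(3) W(3)[OF n] unfolding bc_germ_res[OF U W(1,2) W(3)[OF n] ab(1)] bc_germ_res[OF U W(1,2) W(3)[OF n] ab(2)]
      unfolding fraction_at_def by blast
  qed
  then show ?thesis
    using fr N W(1) ring_hom_closed[OF H] ab unfolding fraction_at_def by auto
qed

text \<open>Numerators and denominators of s and t are brought into the same complexified ring over
  one U, where they can be added and multiplied.\<close>

private lemma fraction_at_common:
  assumes "s \<in> carrier (fun_alg X)" "t \<in> carrier (fun_alg X)" "q \<in> bc_pts X"
  obtains N U a b c d where "fraction_at X s q N U a b" "fraction_at X t q N U c d"
proof -
  obtain N U a b where f1: "fraction_at X s q N U a b"
    using assms unfolding fun_alg_carrier[OF X] by blast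
  obtain M W c d where f2: "fraction_at X t q M W c d"
    using assms unfolding fun_alg_carrier[OF X] by blast
  have "openin (bc_top X) (N \<inter> M)" "q \<in> N \<inter> M" "opn X (U \<inter> W)"
    using f1 f2 by (auto simp: fraction_at_def openin_Int)
  moreover have "y \<in> U \<inter> W" if "(y, Q) \<in> N \<inter> M" for y Q
    using f1 f2 that by (auto simp: fraction_at_def)
  ultimately show ?thesis
    using that fraction_at_restrict[OF f1, of "N \<inter> M" "U \<inter> W"] fraction_at_restrict[OF f2, of "N \<inter> M" "U \<inter> W"]
    by blast
qed

private lemma fraction_atI:
  assumes "fraction_at X s q N U a b"
    and "c \<in> carrier (cplx (sec X U))" "d \<in> carrier (cplx (sec X U))"
    and "\<And>y Q. (y, Q) \<in> N \<Longrightarrow> bc_germ X y U d \<notin> Q \<and>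
      t (y, Q) = loc_frac (cplx (stalk X y)) Q (bc_germ X y U c) (bc_germ X y U d)"
  shows "fraction_at X t q N U c d"
  using assms unfolding fraction_at_def by auto

private lemma fraction_at_at:
  assumes "fraction_at X s q N U a b" "(y, Q) \<in> N"
  shows "fraction_at X s (y, Q) N U a b" "(y, Q) \<in> bc_pts X" "y \<in> U" "opn X U"
    "a \<in> carrier (cplx (sec X U))" "b \<in> carrier (cplx (sec X U))"
  using assms unfolding fraction_at_def by auto

lemma fun_alg_mult_closed:
  assumes s: "s \<in> carrier (fun_alg X)" and t: "t \<in> carrier (fun_alg X)"
  shows "s \<otimes>\<^bsub>fun_alg X\<^esub> t \<in> carrier (fun_alg X)"
proof -
  have e: "s \<otimes>\<^bsub>fun_alg X\<^esub> t = (\<lambda>q \<in> bc_pts X. s q \<otimes>\<^bsub>bc_loc X q\<^esub> t q)"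
    unfolding fun_alg_def pts_base_change[OF X] by (simp add: base_change_def prod_ring_def ring.defs)
  have "\<exists>N U a b. fraction_at X (s \<otimes>\<^bsub>fun_alg X\<^esub> t) q N U a b" if q: "q \<in> bc_pts X" for q
  proof -
    obtain N U a b c d where f1: "fraction_at X s q N U a b" and f2: "fraction_at X t q N U c d"
      using fraction_at_common[OF s t q] .
    have U: "opn X U" and ab: "a \<in> carrier (cplx (sec X U))" "b \<in> carrier (cplx (sec X U))"
      "c \<in> carrier (cplx (sec X U))" "d \<in> carrier (cplx (sec X U))"
      using f1 f2 by (auto simp: fraction_at_def)
    interpret cring "cplx (sec X U)" by (rule cplx_cring[OF sec_cring[OF locally_ringed_ringed[OF X] U]])
    have "fraction_at X (s \<otimes>\<^bsub>fun_alg X\<^esub> t) q N U (a \<otimes>\<^bsub>cplx (sec X U)\<^esub> c) (b \<otimes>\<^bsub>cplx (sec X U)\<^esub> d)"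
    proof (rule fraction_atI[OF f1])
      fix y Q assume n: "(y, Q) \<in> N"
      note v1 = fraction_at_value[OF X fraction_at_at(1)[OF f1 n]] and v2 = fraction_at_value[OF X fraction_at_at(1)[OF f2 n]]
      note at = fraction_at_at(2-4)[OF f1 n]
      note H = bc_germ_hom[OF X bc_pts_base[OF at(1)] at(3,2)]
      note P = bc_pts_prime[OF at(1)]
      show "bc_germ X y U (b \<otimes>\<^bsub>cplx (sec X U)\<^esub> d) \<notin> Q \<and>
        (s \<otimes>\<^bsub>fun_alg X\<^esub> t) (y, Q) = loc_frac (cplx (stalk X y)) Q (bc_germ X y U (a \<otimes>\<^bsub>cplx (sec X U)\<^esub> c)) (bc_germ X y U (b \<otimes>\<^bsub>cplx (sec X U)\<^esub> d))"
        using v1 v2 at(1) loc_frac_mult[OF P v1(1,2) v2(1,2)] primeideal.I_prime[OF P, of "bc_germ X y U b" "bc_germ X y U d"]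
        by (auto simp: e bc_loc_def ring_hom_mult[OF H] ab)
    qed (use ab in auto)
    then show ?thesis by blast
  qed
  then show ?thesis unfolding fun_alg_carrier[OF X] by (simp add: e)
qed

lemma fun_alg_add_closed:
  assumes s: "s \<in> carrier (fun_alg X)" and t: "t \<in> carrier (fun_alg X)"
  shows "s \<oplus>\<^bsub>fun_alg X\<^esub> t \<in> carrier (fun_alg X)"
proof -
  have e: "s \<oplus>\<^bsub>fun_alg X\<^esub> t = (\<lambda>q \<in> bc_pts X. s q \<oplus>\<^bsub>bc_loc X q\<^esub> t q)"
    unfolding fun_alg_def pts_base_change[OF X] by (simp add: base_change_def prod_ring_def ring.defs)
  have "\<exists>N U a b. fraction_at X (s \<oplus>\<^bsub>fun_alg X\<^esub> t) q N U a b" if q: "q \<in> bc_pts X" for q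
  proof -
    obtain N U a b c d where f1: "fraction_at X s q N U a b" and f2: "fraction_at X t q N U c d"
      using fraction_at_common[OF s t q] .
    have U: "opn X U" and ab: "a \<in> carrier (cplx (sec X U))" "b \<in> carrier (cplx (sec X U))"
      "c \<in> carrier (cplx (sec X U))" "d \<in> carrier (cplx (sec X U))"
      using f1 f2 by (auto simp: fraction_at_def)
    interpret cring "cplx (sec X U)" by (rule cplx_cring[OF sec_cring[OF locally_ringed_ringed[OF X] U]])
    let ?n = "(a \<otimes>\<^bsub>cplx (sec X U)\<^esub> d) \<oplus>\<^bsub>cplx (sec X U)\<^esub> (c \<otimes>\<^bsub>cplx (sec X U)\<^esub> b)"
    have "fraction_at X (s \<oplus>\<^bsub>fun_alg X\<^esub> t) q N U ?n (b \<otimes>\<^bsub>cplx (sec X U)\<^esub> d)"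
    proof (rule fraction_atI[OF f1])
      fix y Q assume n: "(y, Q) \<in> N"
      note v1 = fraction_at_value[OF X fraction_at_at(1)[OF f1 n]] and v2 = fraction_at_value[OF X fraction_at_at(1)[OF f2 n]]
      note at = fraction_at_at(2-4)[OF f1 n]
      note H = bc_germ_hom[OF X bc_pts_base[OF at(1)] at(3,2)]
      note P = bc_pts_prime[OF at(1)]
      show "bc_germ X y U (b \<otimes>\<^bsub>cplx (sec X U)\<^esub> d) \<notin> Q \<and>
        (s \<oplus>\<^bsub>fun_alg X\<^esub> t) (y, Q) = loc_frac (cplx (stalk X y)) Q (bc_germ X y U ?n) (bc_germ X y U (b \<otimes>\<^bsub>cplx (sec X U)\<^esub> d))"
        using v1 v2 at(1) loc_frac_add[OF P v1(1,2) v2(1,2)] primeideal.I_prime[OF P, of "bc_germ X y U b" "bc_germ X y U d"]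
        by (auto simp: e bc_loc_def ring_hom_mult[OF H] ring_hom_add[OF H] ab)
    qed (use ab in auto)
    then show ?thesis by blast
  qed
  then show ?thesis unfolding fun_alg_carrier[OF X] by (simp add: e)
qed

text \<open>The scalar acts stalkwise in \<open>fun_alg\<close>; it is the germ of an element over
  U, so a scalar multiple remains a fraction of elements over U.\<close>

private lemma bc_germ_scalar:
  assumes "x \<in> pts X" "opn X U" "x \<in> U"
  shows "bc_germ X x U (cplx_class (sec X U) (single z \<one>\<^bsub>sec X U\<^esub>)) =
    cplx_class (stalk X x) (single z \<one>\<^bsub>stalk X x\<^esub>)"
proof -
  note R = locally_ringed_ringed[OF X]
  interpret cring "sec X U" by (rule sec_cring[OF R assms(2)])
  show ?thesis
    unfolding bc_germ_def
    by (simp add: cplx_map_class[OF is_cring stalk_cring[OF X assms(1)] germ_hom[OF R assms(2,3)] single_closed]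
        push_single germ_one[OF R assms(2,3)])
qed

lemma fun_alg_smult_closed:
  assumes s: "s \<in> carrier (fun_alg X)"
  shows "z \<odot>\<^bsub>fun_alg X\<^esub> s \<in> carrier (fun_alg X)"
proof -
  note R = locally_ringed_ringed[OF X]
  have e: "z \<odot>\<^bsub>fun_alg X\<^esub> s = (\<lambda>(x, P) \<in> bc_pts X.
      loc_frac (cplx (stalk X x)) P (cplx_class (stalk X x) (single z \<one>\<^bsub>stalk X x\<^esub>)) \<one>\<^bsub>cplx (stalk X x)\<^esub>
        \<otimes>\<^bsub>bc_loc X (x, P)\<^esub> s (x, P))"
    unfolding fun_alg_def pts_base_change[OF X] by (simp add: module.defs ring.defs)
  have "\<exists>N U a b. fraction_at X (z \<odot>\<^bsub>fun_alg X\<^esub> s) q N U a b" if q: "q \<in> bc_pts X" for q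
  proof -
    obtain N U a b where f1: "fraction_at X s q N U a b"
      using s q unfolding fun_alg_carrier[OF X] by blast
    have U: "opn X U" and ab: "a \<in> carrier (cplx (sec X U))" "b \<in> carrier (cplx (sec X U))"
      using f1 by (auto simp: fraction_at_def)
    interpret S: cring "sec X U" by (rule sec_cring[OF R U])
    interpret cring "cplx (sec X U)" by (rule cplx_cring[OF S.is_cring])
    let ?z = "cplx_class (sec X U) (single z \<one>\<^bsub>sec X U\<^esub>)"
    have zc: "?z \<in> carrier (cplx (sec X U))"
      by (rule ring_hom_closed[OF cplx_class_hom[OF S.is_cring] single_closed[OF S.one_closed]])
    have "fraction_at X (z \<odot>\<^bsub>fun_alg X\<^esub> s) q N U (?z \<otimes>\<^bsub>cplx (sec X U)\<^esub> a) b"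
    proof (rule fraction_atI[OF f1])
      fix y Q assume n: "(y, Q) \<in> N"
      note v1 = fraction_at_value[OF X fraction_at_at(1)[OF f1 n]]
      note at = fraction_at_at(2-4)[OF f1 n]
      note H = bc_germ_hom[OF X bc_pts_base[OF at(1)] at(3,2)]
      note zz = bc_germ_scalar[OF bc_pts_base[OF at(1)] at(3,2), of z]
      note P = bc_pts_prime[OF at(1)]
      interpret Q: primeideal Q "cplx (stalk X y)" by (rule P)
      have one: "\<one>\<^bsub>cplx (stalk X y)\<^esub> \<in> carrier (cplx (stalk X y)) - Q"
        using Q.I_notcarr Q.one_imp_carrier by auto
      show "bc_germ X y U b \<notin> Q \<and>
        (z \<odot>\<^bsub>fun_alg X\<^esub> s) (y, Q) = loc_frac (cplx (stalk X y)) Q (bc_germ X y U (?z \<otimes>\<^bsub>cplx (sec X U)\<^esub> a)) (bc_germ X y U b)"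
        using v1 at(1) loc_frac_mult[OF P ring_hom_closed[OF H zc] one v1(1,2)]
        by (auto simp: e bc_loc_def ring_hom_mult[OF H zc ab(1)] zz)
    qed (use ab zc in auto)
    then show ?thesis by blast
  qed
  then show ?thesis unfolding fun_alg_carrier[OF X] by (simp add: e)
qed

lemma fun_alg_one_closed: "\<one>\<^bsub>fun_alg X\<^esub> \<in> carrier (fun_alg X)"
proof -
  note R = locally_ringed_ringed[OF X]
  have e: "\<one>\<^bsub>fun_alg X\<^esub> = (\<lambda>q \<in> bc_pts X. \<one>\<^bsub>bc_loc X q\<^esub>)"
    unfolding fun_alg_def pts_base_change[OF X] by (simp add: base_change_def prod_ring_def ring.defs)
  interpret cring "cplx (sec X (pts X))" by (rule cplx_cring[OF sec_cring[OF R openin_topspace]])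
  let ?one = "\<one>\<^bsub>cplx (sec X (pts X))\<^esub>"
  have "fraction_at X (\<one>\<^bsub>fun_alg X\<^esub>) q (bc_pts X) (pts X) ?one ?one" if q: "q \<in> bc_pts X" for q
    unfolding fraction_at_def
  proof (intro conjI)
    show "openin (bc_top X) (bc_pts X)" using topspace_bc_top[OF X] openin_topspace by metis
    show "\<forall>(y, Q) \<in> bc_pts X. y \<in> pts X \<and> bc_germ X y (pts X) ?one \<notin> Q \<and>
      (\<one>\<^bsub>fun_alg X\<^esub>) (y, Q) = loc_frac (cplx (stalk X y)) Q (bc_germ X y (pts X) ?one) (bc_germ X y (pts X) ?one)"
    proof clarify
      fix y Q assume r: "(y, Q) \<in> bc_pts X"
      interpret Q: primeideal Q "cplx (stalk X y)" by (rule bc_pts_prime[OF r])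
      have "bc_germ X y (pts X) ?one = \<one>\<^bsub>cplx (stalk X y)\<^esub>"
        by (rule ring_hom_one[OF bc_germ_hom[OF X bc_pts_base[OF r] openin_topspace bc_pts_base[OF r]]])
      then show "y \<in> pts X \<and> bc_germ X y (pts X) ?one \<notin> Q \<and>
        (\<one>\<^bsub>fun_alg X\<^esub>) (y, Q) = loc_frac (cplx (stalk X y)) Q (bc_germ X y (pts X) ?one) (bc_germ X y (pts X) ?one)"
        using r bc_pts_base[OF r] Q.I_notcarr Q.one_imp_carrier
        by (auto simp: e bc_loc_def localisation_def)
    qed
  qed (use q in auto)
  then have "\<forall>q \<in> bc_pts X. \<exists>N U a b. fraction_at X (\<one>\<^bsub>fun_alg X\<^esub>) q N U a b" by blast
  then show ?thesis unfolding fun_alg_carrier[OF X] by (simp add: e)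
qed

end

section \<open>Algebra morphisms and objects\<close>

text \<open>The closure properties used in composing algebra morphisms: composites are undefined
  outside the carrier of the source, so products, sums, multiples and 1 must stay in it. For
  \<open>fun_alg\<close> these are the properties proved above.\<close>

definition alg_closed :: "(complex, 'a) module \<Rightarrow> bool" where
  "alg_closed A \<longleftrightarrow> \<one>\<^bsub>A\<^esub> \<in> carrier A \<and>
    (\<forall>a \<in> carrier A. \<forall>b \<in> carrier A. a \<otimes>\<^bsub>A\<^esub> b \<in> carrier A \<and> a \<oplus>\<^bsub>A\<^esub> b \<in> carrier A) \<and>
    (\<forall>z. \<forall>a \<in> carrier A. z \<odot>\<^bsub>A\<^esub> a \<in> carrier A)"

lemma alg_closed_fun_alg: "locally_ringed X \<Longrightarrow> alg_closed (fun_alg X)"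
  by (simp add: alg_closed_def fun_alg_one_closed fun_alg_mult_closed fun_alg_add_closed fun_alg_smult_closed)

lemma carrier_CC [simp]: "carrier CC = UNIV"
  by (simp add: ring_of_type_algebra_def)

lemma C_algebra_cring: "C_algebra A \<Longrightarrow> cring A"
  by (simp add: C_algebra_def algebra_def)

lemma C_algebra_closed:
  assumes "C_algebra A"
  shows "alg_closed A"
proof -
  interpret algebra CC A using assms by (simp add: C_algebra_def)
  show ?thesis by (simp add: alg_closed_def)
qed

lemma alg_hom_ring_hom: "h \<in> alg_hom A B \<Longrightarrow> h \<in> ring_hom A B"
  by (simp add: alg_hom_def rhom_def)

lemma alg_hom_ext: "h \<in> alg_hom A B \<Longrightarrow> h \<in> extensional (carrier A)"
  by (simp add: alg_hom_def rhom_def)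

lemma alg_hom_smult: "h \<in> alg_hom A B \<Longrightarrow> a \<in> carrier A \<Longrightarrow> h (z \<odot>\<^bsub>A\<^esub> a) = z \<odot>\<^bsub>B\<^esub> h a"
  by (simp add: alg_hom_def)

lemmas alg_hom_closed = ring_hom_closed[OF alg_hom_ring_hom]

lemma alg_hom_compose:
  assumes A: "alg_closed A" and h: "h \<in> alg_hom A B" and g: "g \<in> alg_hom B C"
  shows "compose (carrier A) g h \<in> alg_hom A C"
proof -
  note H = alg_hom_ring_hom[OF h] and G = alg_hom_ring_hom[OF g]
  have "compose (carrier A) g h \<in> ring_hom A C"
    using A ring_hom_closed[OF H]
    by (intro ring_hom_memI)
      (auto simp: compose_def alg_closed_def ring_hom_closed[OF G] ring_hom_mult[OF H] ring_hom_mult[OF G]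
        ring_hom_add[OF H] ring_hom_add[OF G] ring_hom_one[OF H] ring_hom_one[OF G])
  then show ?thesis
    using A ring_hom_closed[OF H]
    by (auto simp: alg_hom_def rhom_def compose_def alg_closed_def alg_hom_smult[OF h] alg_hom_smult[OF g])
qed

context
  fixes X :: "('u, 's, 'a) fobj"
  assumes X: "is_object X"
begin

lemma omap_closed: "A \<in> AffF1 \<Longrightarrow> B \<in> AffF1 \<Longrightarrow> f \<in> gadget_hom A B \<Longrightarrow> x \<in> ofun X B \<Longrightarrow> omap X A B f x \<in> ofun X A"
  using X by (simp add: is_object_def)

lemma omap_id: "A \<in> AffF1 \<Longrightarrow> x \<in> ofun X A \<Longrightarrow> omap X A A (gadget_id A) x = x"
  using X by (simp add: is_object_def)

lemma omap_comp:
  "A \<in> AffF1 \<Longrightarrow> B \<in> AffF1 \<Longrightarrow> C \<in> AffF1 \<Longrightarrow> f \<in> gadget_hom A B \<Longrightarrow> g \<in> gadget_hom B C \<Longrightarrow> x \<in> ofun X C \<Longrightarrow>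
    omap X A C (gadget_comp A C g f) x = omap X A B f (omap X B C g x)"
  using X by (simp add: is_object_def)

lemma oalg_C_algebra: "C_algebra (oalg X)"
  using X by (simp add: is_object_def)

lemma oev_alg_hom: "A \<in> AffF1 \<Longrightarrow> x \<in> ofun X A \<Longrightarrow> oev X A x \<in> alg_hom (oalg X) (galg A)"
  using X by (simp add: is_object_def)

lemma oev_omap:
  "A \<in> AffF1 \<Longrightarrow> B \<in> AffF1 \<Longrightarrow> f \<in> gadget_hom A B \<Longrightarrow> x \<in> ofun X B \<Longrightarrow>
    oev X A (omap X A B f x) = compose (carrier (oalg X)) (gpull f) (oev X B x)"
  using X by (simp add: is_object_def)

end

context
  fixes X :: "('u, 's, 'a) fobj" and Y :: "('u, 't, 'b) fobj" and \<phi> :: "('u, 's, 't, 'a, 'b) omor"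
  assumes phi: "\<phi> \<in> obj_hom X Y"
begin

lemma obj_hom_otr_PiE: "otr \<phi> \<in> (\<Pi>\<^sub>E A \<in> AffF1. ofun X A \<rightarrow>\<^sub>E ofun Y A)"
  using phi by (simp add: obj_hom_def)

lemma otr_closed: "A \<in> AffF1 \<Longrightarrow> x \<in> ofun X A \<Longrightarrow> otr \<phi> A x \<in> ofun Y A"
  using obj_hom_otr_PiE by (auto simp: PiE_iff)

lemma otr_omap:
  "A \<in> AffF1 \<Longrightarrow> B \<in> AffF1 \<Longrightarrow> f \<in> gadget_hom A B \<Longrightarrow> x \<in> ofun X B \<Longrightarrow>
    otr \<phi> A (omap X A B f x) = omap Y A B f (otr \<phi> B x)"
  using phi by (simp add: obj_hom_def)

lemma opull_alg_hom: "opull \<phi> \<in> alg_hom (oalg Y) (oalg X)"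
  using phi by (simp add: obj_hom_def)

lemma oev_otr: "A \<in> AffF1 \<Longrightarrow> x \<in> ofun X A \<Longrightarrow> oev Y A (otr \<phi> A x) = compose (carrier (oalg Y)) (oev X A x) (opull \<phi>)"
  using phi by (simp add: obj_hom_def)

end

lemma obj_homI:
  assumes "otr \<phi> \<in> (\<Pi>\<^sub>E A \<in> AffF1. ofun X A \<rightarrow>\<^sub>E ofun Y A)"
    and "\<And>A B f x. A \<in> AffF1 \<Longrightarrow> B \<in> AffF1 \<Longrightarrow> f \<in> gadget_hom A B \<Longrightarrow> x \<in> ofun X B \<Longrightarrow>
      otr \<phi> A (omap X A B f x) = omap Y A B f (otr \<phi> B x)"
    and "opull \<phi> \<in> alg_hom (oalg Y) (oalg X)"
    and "\<And>A x. A \<in> AffF1 \<Longrightarrow> x \<in> ofun X A \<Longrightarrow>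
      oev Y A (otr \<phi> A x) = compose (carrier (oalg Y)) (oev X A x) (opull \<phi>)"
  shows "\<phi> \<in> obj_hom X Y"
  using assms by (simp add: obj_hom_def)

lemma otr_obj_comp: "A \<in> AffF1 \<Longrightarrow> x \<in> ofun X A \<Longrightarrow> otr (obj_comp X Z \<psi> \<phi>) A x = otr \<psi> A (otr \<phi> A x)"
  by (simp add: obj_comp_def compose_def)

lemma opull_obj_comp: "\<gamma> \<in> carrier (oalg Z) \<Longrightarrow> opull (obj_comp X Z \<psi> \<phi>) \<gamma> = opull \<phi> (opull \<psi> \<gamma>)"
  by (simp add: obj_comp_def compose_def)

lemma obj_comp_hom:
  assumes X: "is_object X" and Z: "alg_closed (oalg Z)" and f: "\<phi> \<in> obj_hom X Y" and g: "\<psi> \<in> obj_hom Y Z"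
  shows "obj_comp X Z \<psi> \<phi> \<in> obj_hom X Z"
proof (rule obj_homI)
  show "otr (obj_comp X Z \<psi> \<phi>) \<in> (\<Pi>\<^sub>E A \<in> AffF1. ofun X A \<rightarrow>\<^sub>E ofun Z A)"
    using otr_closed[OF f] otr_closed[OF g] by (auto simp: obj_comp_def compose_def)
  show "otr (obj_comp X Z \<psi> \<phi>) A (omap X A B h x) = omap Z A B h (otr (obj_comp X Z \<psi> \<phi>) B x)"
    if "A \<in> AffF1" "B \<in> AffF1" "h \<in> gadget_hom A B" "x \<in> ofun X B" for A B h x
    using that by (simp add: otr_obj_comp omap_closed[OF X] otr_omap[OF f] otr_omap[OF g] otr_closed[OF f])
  show "opull (obj_comp X Z \<psi> \<phi>) \<in> alg_hom (oalg Z) (oalg X)"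
    using alg_hom_compose[OF Z opull_alg_hom[OF g] opull_alg_hom[OF f]] by (simp add: obj_comp_def)
  show "oev Z A (otr (obj_comp X Z \<psi> \<phi>) A x) = compose (carrier (oalg Z)) (oev X A x) (opull (obj_comp X Z \<psi> \<phi>))"
    if "A \<in> AffF1" "x \<in> ofun X A" for A x
    using that alg_hom_closed[OF opull_alg_hom[OF g]]
    by (simp add: otr_obj_comp oev_otr[OF g] oev_otr[OF f] otr_closed[OF f]) (simp add: compose_def obj_comp_def fun_eq_iff)
qed

text \<open>Together with \<open>gadget_comp_hom\<close> this allows naturality of the immersions to
  be applied to identities and composites, which transfers the functor laws from the pieces to the
  glued object.\<close>

lemma gadget_id_hom:
  assumes A: "is_gadget A"
  shows "gadget_id A \<in> gadget_hom A A"
proof -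
  have "C_algebra (galg A)" using A by (simp add: is_gadget_def)
  from C_algebra_closed[OF this]
  have "(\<lambda>\<alpha> \<in> carrier (galg A). \<alpha>) \<in> alg_hom (galg A) (galg A)"
    by (auto simp: alg_hom_def rhom_def alg_closed_def intro!: ring_hom_memI)
  moreover have "gmap A R' R f x \<in> gfun A R" if "R' \<in> RZ" "R \<in> RZ" "f \<in> rhom R' R" "x \<in> gfun A R'" for R' R f x
    using A that by (simp add: is_gadget_def)
  ultimately show ?thesis by (simp add: gadget_hom_def gadget_id_def)
qed

lemma gadget_comp_hom:
  assumes A: "is_gadget A" and C: "is_gadget C" and f: "f \<in> gadget_hom A B" and g: "g \<in> gadget_hom B C"
  shows "gadget_comp A C g f \<in> gadget_hom A C"
proof -
  have "C_algebra (galg C)" using C by (simp add: is_gadget_def)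
  note closed = C_algebra_closed[OF this]
  have gm: "gmap A R' R h x \<in> gfun A R" if "R' \<in> RZ" "R \<in> RZ" "h \<in> rhom R' R" "x \<in> gfun A R'" for R' R h x
    using A that by (simp add: is_gadget_def)
  have fc: "gtr f R x \<in> gfun B R" if "R \<in> RZ" "x \<in> gfun A R" for R x
    using f that by (auto simp: gadget_hom_def PiE_iff)
  have gc: "gtr g R x \<in> gfun C R" if "R \<in> RZ" "x \<in> gfun B R" for R x
    using g that by (auto simp: gadget_hom_def PiE_iff)
  have fp: "gpull f \<in> alg_hom (galg B) (galg A)" and gp: "gpull g \<in> alg_hom (galg C) (galg B)"
    using f g by (simp_all add: gadget_hom_def)
  have fn: "gtr f R (gmap A R' R h x) = gmap B R' R h (gtr f R' x)"
    if "R' \<in> RZ" "R \<in> RZ" "h \<in> rhom R' R" "x \<in> gfun A R'" for R' R h x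
    using f that by (simp add: gadget_hom_def)
  have gn: "gtr g R (gmap B R' R h x) = gmap C R' R h (gtr g R' x)"
    if "R' \<in> RZ" "R \<in> RZ" "h \<in> rhom R' R" "x \<in> gfun B R'" for R' R h x
    using g that by (simp add: gadget_hom_def)
  have fe: "gev B R (gtr f R x) \<sigma> \<alpha> = gev A R x \<sigma> (gpull f \<alpha>)"
    if "R \<in> RZ" "\<sigma> \<in> rhom R CC" "x \<in> gfun A R" "\<alpha> \<in> carrier (galg B)" for R \<sigma> x \<alpha>
    using f that by (simp add: gadget_hom_def)
  have ge: "gev C R (gtr g R x) \<sigma> \<alpha> = gev B R x \<sigma> (gpull g \<alpha>)"
    if "R \<in> RZ" "\<sigma> \<in> rhom R CC" "x \<in> gfun B R" "\<alpha> \<in> carrier (galg C)" for R \<sigma> x \<alpha>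
    using g that by (simp add: gadget_hom_def)
  show ?thesis
    using alg_hom_compose[OF closed gp fp]
    by (simp add: gadget_hom_def gadget_comp_def compose_def gm fc gc fn gn fe ge alg_hom_closed[OF gp])
qed

section \<open>Morphisms to schemes and their extensions\<close>

lemma oalg_sch_obj [simp]: "oalg (sch_obj V) = fun_alg V"
  by (simp add: sch_obj_def)

lemma ofun_sch_obj [simp]: "ofun (sch_obj V) A = sch_hom (aff_Z A) V"
  by (simp add: sch_obj_def)

text \<open>The pointwise form of \<open>\<psi> = g \<circ> \<iota>\<close> for \<open>\<iota> : X \<rightarrow> Z\<close> and \<open>g : Z \<rightarrow> W\<close>.\<close>

definition factors_via ::
  "('u, 's, 'a) fobj \<Rightarrow> 'u sch \<Rightarrow> 'u sch \<Rightarrow> ('u, 's, 'a) to_sch \<Rightarrow> 'u sch_mor \<Rightarrow> ('u, 's, 'a) to_sch \<Rightarrow> bool" where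
  "factors_via X Z W \<iota> g \<psi> \<longleftrightarrow>
    (\<forall>A \<in> AffF1. \<forall>x \<in> ofun X A. otr \<psi> A x = sch_comp (aff_Z A) Z W g (otr \<iota> A x)) \<and>
    (\<forall>\<gamma> \<in> carrier (fun_alg W). opull \<psi> \<gamma> = opull \<iota> (fun_pull Z W g \<gamma>))"

text \<open>Both morphisms have extensional components, so equality amounts to equality at points
  and on functions.\<close>

lemma obj_comp_eq_iff_factors_via:
  fixes X :: "('u, 's, 'a) fobj"
  assumes \<psi>: "\<psi> \<in> obj_hom X (sch_obj W)" and \<iota>: "\<iota> \<in> obj_hom X (sch_obj Z)"
  shows "\<psi> = obj_comp X (sch_obj W) (sch_omor Z W g) \<iota> \<longleftrightarrow> factors_via X Z W \<iota> g \<psi>"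
proof
  let ?c = "obj_comp X (sch_obj W) (sch_omor Z W g) \<iota>"
  have c: "otr ?c A x = sch_comp (aff_Z A) Z W g (otr \<iota> A x)" if "A \<in> AffF1" "x \<in> ofun X A" for A x
    using that otr_closed[OF \<iota> that] by (simp add: otr_obj_comp sch_omor_def)
  have p: "opull ?c \<gamma> = opull \<iota> (fun_pull Z W g \<gamma>)" if "\<gamma> \<in> carrier (fun_alg W)" for \<gamma>
    using that by (simp add: opull_obj_comp sch_omor_def)
  show "factors_via X Z W \<iota> g \<psi>" if "\<psi> = ?c"
    unfolding factors_via_def that using c p by simp
  assume f: "factors_via X Z W \<iota> g \<psi>"
  show "\<psi> = ?c"
  proof (rule omor.equality)
    show "otr \<psi> = otr ?c"
    proof (rule extensionalityI[of _ AffF1])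
      show "otr \<psi> \<in> extensional AffF1" using obj_hom_otr_PiE[OF \<psi>] by (simp add: PiE_iff)
      show "otr ?c \<in> extensional AffF1" by (simp add: obj_comp_def)
      fix A :: "'u agad" assume A: "A \<in> AffF1"
      show "otr \<psi> A = otr ?c A"
      proof (rule extensionalityI[of _ "ofun X A"])
        show "otr \<psi> A \<in> extensional (ofun X A)" using obj_hom_otr_PiE[OF \<psi>] A by (auto simp: PiE_iff)
        show "otr ?c A \<in> extensional (ofun X A)" using A by (simp add: obj_comp_def)
      qed (use f A c in \<open>simp add: factors_via_def\<close>)
    qed
    show "opull \<psi> = opull ?c"
      by (rule extensionalityI[of _ "carrier (fun_alg W)"])
        (use alg_hom_ext[OF opull_alg_hom[OF \<psi>]] f p in \<open>simp_all add: factors_via_def, simp add: obj_comp_def\<close>)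
  qed simp
qed

text \<open>When \<iota> is f after \<iota>', a factorisation through \<iota> by g is the same as
  one through \<iota>' by the composite. It serves both for \<open>U i\<close> inside V and for the
  overlap inside \<open>U i\<close>.\<close>

lemma factors_via_comp_iff:
  assumes lr: "locally_ringed Z'" "locally_ringed Z" "locally_ringed W"
    and f: "f \<in> sch_hom Z' Z" and g: "g \<in> sch_hom Z W"
    and \<iota>': "\<iota>' \<in> obj_hom Y (sch_obj Z')" and \<iota>: "factors_via Y Z' Z \<iota>' f \<iota>"
  shows "factors_via Y Z W \<iota> g \<psi> \<longleftrightarrow> factors_via Y Z' W \<iota>' (sch_comp Z' Z W g f) \<psi>"
proof -
  have "sch_comp (aff_Z A) Z W g (otr \<iota> A x) = sch_comp (aff_Z A) Z' W (sch_comp Z' Z W g f) (otr \<iota>' A x)"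
    if "A \<in> AffF1" "x \<in> ofun Y A" for A x
    using \<iota> that sch_comp_assoc[OF _ f g, of "otr \<iota>' A x" "aff_Z A"] otr_closed[OF \<iota>' that] by (simp add: factors_via_def)
  moreover have "opull \<iota> (fun_pull Z W g \<gamma>) = opull \<iota>' (fun_pull Z' W (sch_comp Z' Z W g f) \<gamma>)"
    if "\<gamma> \<in> carrier (fun_alg W)" for \<gamma>
    using \<iota> fun_pull_closed[OF lr(2,3) g that] fun_pull_comp[OF lr f g that] by (simp add: factors_via_def)
  ultimately show ?thesis by (simp add: factors_via_def)
qed

context
  fixes X :: "('u, 's, 'a) fobj" and Z :: "'u sch" and \<iota> :: "('u, 's, 'a) to_sch"
  assumes ext: "scalar_ext X Z \<iota>"
begin

lemma scalar_ext_ft: "ft_scheme Z"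
  using ext by (simp add: scalar_ext_def)

lemma scalar_ext_hom: "\<iota> \<in> obj_hom X (sch_obj Z)"
  using ext by (simp add: scalar_ext_def obj_immersion_def)

text \<open>The universal property in the form used for gluing: existence yields the local
  morphisms, uniqueness their agreement on overlaps and the uniqueness of the glued one.\<close>

lemma scalar_ext_ex1:
  assumes "ft_scheme V" "\<phi> \<in> obj_hom X (sch_obj V)"
  shows "\<exists>!\<psi>. \<psi> \<in> sch_hom Z V \<and> factors_via X Z V \<iota> \<psi> \<phi>"
  using ext assms unfolding scalar_ext_def obj_comp_eq_iff_factors_via[OF assms(2) scalar_ext_hom, symmetric] by blast

lemma ext_to_sch_factors_via:
  assumes "ft_scheme V" "\<phi> \<in> obj_hom X (sch_obj V)"
  shows "ext_to_sch X Z \<iota> V \<phi> \<in> sch_hom Z V" "factors_via X Z V \<iota> (ext_to_sch X Z \<iota> V \<phi>) \<phi>"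
  using theI'[OF scalar_ext_ex1[OF assms]]
  unfolding ext_to_sch_def obj_comp_eq_iff_factors_via[OF assms(2) scalar_ext_hom] by auto

end

section \<open>The glued object\<close>

lemma glued_alg_simps:
  "carrier (glued_alg I X \<kappa>) = {\<alpha> \<in> (\<Pi>\<^sub>E i \<in> I. carrier (oalg (X i))).
      \<forall>i \<in> I. \<forall>j \<in> I. i \<noteq> j \<longrightarrow> opull (\<kappa> i j) (\<alpha> i) = opull (\<kappa> j i) (\<alpha> j)}"
  "\<alpha> \<otimes>\<^bsub>glued_alg I X \<kappa>\<^esub> \<beta> = (\<lambda>i \<in> I. \<alpha> i \<otimes>\<^bsub>oalg (X i)\<^esub> \<beta> i)"
  "\<alpha> \<oplus>\<^bsub>glued_alg I X \<kappa>\<^esub> \<beta> = (\<lambda>i \<in> I. \<alpha> i \<oplus>\<^bsub>oalg (X i)\<^esub> \<beta> i)"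
  "\<one>\<^bsub>glued_alg I X \<kappa>\<^esub> = (\<lambda>i \<in> I. \<one>\<^bsub>oalg (X i)\<^esub>)"
  "\<zero>\<^bsub>glued_alg I X \<kappa>\<^esub> = (\<lambda>i \<in> I. \<zero>\<^bsub>oalg (X i)\<^esub>)"
  "z \<odot>\<^bsub>glued_alg I X \<kappa>\<^esub> \<alpha> = (\<lambda>i \<in> I. z \<odot>\<^bsub>oalg (X i)\<^esub> \<alpha> i)"
  by (simp_all add: glued_alg_def prod_alg_def prod_ring_def ring.defs module.defs)

text \<open>Since \<open>B i j = B j i\<close>, the two maps in each compatibility condition are
  algebra morphisms into one algebra, so compatible families form a subalgebra of the
  product.\<close>

lemma glued_alg_C_algebra:
  assumes alg: "\<And>i. i \<in> I \<Longrightarrow> C_algebra (oalg (X i))"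
    and algB: "\<And>i j. i \<in> I \<Longrightarrow> j \<in> I \<Longrightarrow> i \<noteq> j \<Longrightarrow> C_algebra (B i j)"
    and symB: "\<And>i j. i \<in> I \<Longrightarrow> j \<in> I \<Longrightarrow> i \<noteq> j \<Longrightarrow> B i j = B j i"
    and \<kappa>: "\<And>i j. i \<in> I \<Longrightarrow> j \<in> I \<Longrightarrow> i \<noteq> j \<Longrightarrow> opull (\<kappa> i j) \<in> alg_hom (oalg (X i)) (B i j)"
  shows "C_algebra (glued_alg I X \<kappa>)"
proof -
  let ?G = "glued_alg I X \<kappa>"
  have A: "algebra CC (oalg (X i))" if "i \<in> I" for i using alg[OF that] by (simp add: C_algebra_def)
  have R: "ring (oalg (X i))" if "i \<in> I" for i using C_algebra_cring[OF alg[OF that]] by (rule cring.axioms(1))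
  have cl: "\<alpha> i \<in> carrier (oalg (X i))" if "\<alpha> \<in> carrier ?G" "i \<in> I" for \<alpha> i
    using that by (auto simp: glued_alg_simps)
  have agree: "opull (\<kappa> i j) (\<alpha> i) = opull (\<kappa> j i) (\<alpha> j)" if "\<alpha> \<in> carrier ?G" "i \<in> I" "j \<in> I" "i \<noteq> j" for \<alpha> i j
    using that by (simp add: glued_alg_simps)
  have memI: "(\<lambda>i \<in> I. \<alpha> i) \<in> carrier ?G"
    if "\<And>i. i \<in> I \<Longrightarrow> \<alpha> i \<in> carrier (oalg (X i))"
      "\<And>i j. i \<in> I \<Longrightarrow> j \<in> I \<Longrightarrow> i \<noteq> j \<Longrightarrow> opull (\<kappa> i j) (\<alpha> i) = opull (\<kappa> j i) (\<alpha> j)" for \<alpha>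
    using that by (simp add: glued_alg_simps)
  have eqI: "\<alpha> = \<beta>" if "\<alpha> \<in> carrier ?G" "\<beta> \<in> carrier ?G" "\<And>i. i \<in> I \<Longrightarrow> \<alpha> i = \<beta> i" for \<alpha> \<beta>
    using that by (auto simp: glued_alg_simps intro: PiE_ext)
  note H = alg_hom_ring_hom[OF \<kappa>]
  have mult: "\<alpha> \<otimes>\<^bsub>?G\<^esub> \<beta> \<in> carrier ?G" if a: "\<alpha> \<in> carrier ?G" and b: "\<beta> \<in> carrier ?G" for \<alpha> \<beta>
    unfolding glued_alg_simps(2)
  proof (rule memI)
    show "\<alpha> i \<otimes>\<^bsub>oalg (X i)\<^esub> \<beta> i \<in> carrier (oalg (X i))" if "i \<in> I" for i
      using ring.ring_simprules(5)[OF R[OF that] cl[OF a that] cl[OF b that]] .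
    show "opull (\<kappa> i j) (\<alpha> i \<otimes>\<^bsub>oalg (X i)\<^esub> \<beta> i) = opull (\<kappa> j i) (\<alpha> j \<otimes>\<^bsub>oalg (X j)\<^esub> \<beta> j)"
      if "i \<in> I" "j \<in> I" "i \<noteq> j" for i j
      using that cl[OF a] cl[OF b]
      by (simp add: ring_hom_mult[OF H] symB[of j i] agree[OF a that] agree[OF b that])
  qed
  have add: "\<alpha> \<oplus>\<^bsub>?G\<^esub> \<beta> \<in> carrier ?G" if a: "\<alpha> \<in> carrier ?G" and b: "\<beta> \<in> carrier ?G" for \<alpha> \<beta>
    unfolding glued_alg_simps(3)
  proof (rule memI)
    show "\<alpha> i \<oplus>\<^bsub>oalg (X i)\<^esub> \<beta> i \<in> carrier (oalg (X i))" if "i \<in> I" for i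
      using ring.ring_simprules(1)[OF R[OF that] cl[OF a that] cl[OF b that]] .
    show "opull (\<kappa> i j) (\<alpha> i \<oplus>\<^bsub>oalg (X i)\<^esub> \<beta> i) = opull (\<kappa> j i) (\<alpha> j \<oplus>\<^bsub>oalg (X j)\<^esub> \<beta> j)"
      if "i \<in> I" "j \<in> I" "i \<noteq> j" for i j
      using that cl[OF a] cl[OF b]
      by (simp add: ring_hom_add[OF H] symB[of j i] agree[OF a that] agree[OF b that])
  qed
  have smult: "z \<odot>\<^bsub>?G\<^esub> \<alpha> \<in> carrier ?G" if a: "\<alpha> \<in> carrier ?G" for z \<alpha>
    unfolding glued_alg_simps(6)
  proof (rule memI)
    show "z \<odot>\<^bsub>oalg (X i)\<^esub> \<alpha> i \<in> carrier (oalg (X i))" if "i \<in> I" for i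
      using C_algebra_closed[OF alg[OF that]] cl[OF a that] by (simp add: alg_closed_def)
    show "opull (\<kappa> i j) (z \<odot>\<^bsub>oalg (X i)\<^esub> \<alpha> i) = opull (\<kappa> j i) (z \<odot>\<^bsub>oalg (X j)\<^esub> \<alpha> j)"
      if "i \<in> I" "j \<in> I" "i \<noteq> j" for i j
      using that cl[OF a] by (simp add: alg_hom_smult[OF \<kappa>] symB[of j i] agree[OF a that])
  qed
  have one: "\<one>\<^bsub>?G\<^esub> \<in> carrier ?G"
    unfolding glued_alg_simps(4)
  proof (rule memI)
    show "\<one>\<^bsub>oalg (X i)\<^esub> \<in> carrier (oalg (X i))" if "i \<in> I" for i
      using ring.ring_simprules(6)[OF R[OF that]] .
    show "opull (\<kappa> i j) \<one>\<^bsub>oalg (X i)\<^esub> = opull (\<kappa> j i) \<one>\<^bsub>oalg (X j)\<^esub>" if "i \<in> I" "j \<in> I" "i \<noteq> j" for i j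
      using that by (simp add: ring_hom_one[OF H] symB[of j i])
  qed
  have zero: "\<zero>\<^bsub>?G\<^esub> \<in> carrier ?G"
    unfolding glued_alg_simps(5)
  proof (rule memI)
    show "\<zero>\<^bsub>oalg (X i)\<^esub> \<in> carrier (oalg (X i))" if "i \<in> I" for i
      using ring.ring_simprules(2)[OF R[OF that]] .
    \<comment> \<open>\<open>ring_hom\<close> includes no clause for zero; it is preserved because
      source and target are rings.\<close>
    show "opull (\<kappa> i j) \<zero>\<^bsub>oalg (X i)\<^esub> = opull (\<kappa> j i) \<zero>\<^bsub>oalg (X j)\<^esub>" if "i \<in> I" "j \<in> I" "i \<noteq> j" for i j
      using that ring_hom_zero[OF H[OF that] R[OF that(1)] cring.axioms(1)[OF C_algebra_cring[OF algB[OF that]]]]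
        ring_hom_zero[OF H[OF that(2,1) that(3)[symmetric]] R[OF that(2)]
          cring.axioms(1)[OF C_algebra_cring[OF algB[OF that(2,1) that(3)[symmetric]]]]]
      by (simp add: symB[of j i])
  qed
  have neg: "(\<lambda>i \<in> I. \<ominus>\<^bsub>oalg (X i)\<^esub> \<alpha> i) \<in> carrier ?G" if a: "\<alpha> \<in> carrier ?G" for \<alpha>
  proof -
    \<comment> \<open>Writing the negative as the multiple by -1 reduces its compatibility to that
      of scalar multiples.\<close>
    have "(\<lambda>i \<in> I. \<ominus>\<^bsub>oalg (X i)\<^esub> \<alpha> i) = (- 1) \<odot>\<^bsub>?G\<^esub> \<alpha>"
    proof
      fix i
      show "(\<lambda>i \<in> I. \<ominus>\<^bsub>oalg (X i)\<^esub> \<alpha> i) i = ((- 1) \<odot>\<^bsub>?G\<^esub> \<alpha>) i"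
      proof (cases "i \<in> I")
        case True
        interpret algebra CC "oalg (X i)" by (rule A[OF True])
        have "(- 1) \<odot>\<^bsub>oalg (X i)\<^esub> \<alpha> i \<oplus>\<^bsub>oalg (X i)\<^esub> \<alpha> i = ((- 1) \<oplus>\<^bsub>CC\<^esub> \<one>\<^bsub>CC\<^esub>) \<odot>\<^bsub>oalg (X i)\<^esub> \<alpha> i"
          using smult_l_distr[of "- 1" "\<one>\<^bsub>CC\<^esub>" "\<alpha> i"] cl[OF a True] by simp
        also have "(- 1) \<oplus>\<^bsub>CC\<^esub> \<one>\<^bsub>CC\<^esub> = \<zero>\<^bsub>CC\<^esub>" by (simp add: ring_of_type_algebra_def)
        finally have "(- 1) \<odot>\<^bsub>oalg (X i)\<^esub> \<alpha> i \<oplus>\<^bsub>oalg (X i)\<^esub> \<alpha> i = \<zero>\<^bsub>oalg (X i)\<^esub>"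
          using cl[OF a True] by simp
        then have "\<ominus>\<^bsub>oalg (X i)\<^esub> \<alpha> i = (- 1) \<odot>\<^bsub>oalg (X i)\<^esub> \<alpha> i"
          using cl[OF a True] by (intro M.minus_equality) simp_all
        then show ?thesis using True by (simp add: glued_alg_simps)
      qed (simp add: glued_alg_simps)
    qed
    then show ?thesis using smult[OF a] by simp
  qed
  have "cring ?G"
  proof (intro cringI abelian_groupI comm_monoidI mult add one zero)
    fix \<alpha> \<beta> \<gamma> assume a: "\<alpha> \<in> carrier ?G" "\<beta> \<in> carrier ?G" "\<gamma> \<in> carrier ?G"
    show "\<alpha> \<oplus>\<^bsub>?G\<^esub> \<beta> \<oplus>\<^bsub>?G\<^esub> \<gamma> = \<alpha> \<oplus>\<^bsub>?G\<^esub> (\<beta> \<oplus>\<^bsub>?G\<^esub> \<gamma>)"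
      by (rule eqI[OF add[OF add] add[OF _ add]])
        (use a in \<open>simp_all add: glued_alg_simps(3) ring.ring_simprules[OF R] cl\<close>)
    show "\<alpha> \<otimes>\<^bsub>?G\<^esub> \<beta> \<otimes>\<^bsub>?G\<^esub> \<gamma> = \<alpha> \<otimes>\<^bsub>?G\<^esub> (\<beta> \<otimes>\<^bsub>?G\<^esub> \<gamma>)"
      by (rule eqI[OF mult[OF mult] mult[OF _ mult]])
        (use a in \<open>simp_all add: glued_alg_simps(2) ring.ring_simprules[OF R] cl\<close>)
    show "(\<alpha> \<oplus>\<^bsub>?G\<^esub> \<beta>) \<otimes>\<^bsub>?G\<^esub> \<gamma> = \<alpha> \<otimes>\<^bsub>?G\<^esub> \<gamma> \<oplus>\<^bsub>?G\<^esub> \<beta> \<otimes>\<^bsub>?G\<^esub> \<gamma>"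
      by (rule eqI[OF mult[OF add] add[OF mult mult]])
        (use a in \<open>simp_all add: glued_alg_simps(2,3) ring.ring_simprules[OF R] cl\<close>)
  next
    fix \<alpha> \<beta> assume a: "\<alpha> \<in> carrier ?G" "\<beta> \<in> carrier ?G"
    show "\<alpha> \<oplus>\<^bsub>?G\<^esub> \<beta> = \<beta> \<oplus>\<^bsub>?G\<^esub> \<alpha>"
      by (rule eqI[OF add add]) (use a in \<open>simp_all add: glued_alg_simps(3) ring.ring_simprules[OF R] cl\<close>)
    show "\<alpha> \<otimes>\<^bsub>?G\<^esub> \<beta> = \<beta> \<otimes>\<^bsub>?G\<^esub> \<alpha>"
      by (rule eqI[OF mult mult])
        (use a in \<open>simp_all add: glued_alg_simps(2) cring.cring_simprules(14)[OF C_algebra_cring[OF alg]] cl\<close>)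
  next
    fix \<alpha> assume a: "\<alpha> \<in> carrier ?G"
    show "\<zero>\<^bsub>?G\<^esub> \<oplus>\<^bsub>?G\<^esub> \<alpha> = \<alpha>"
      by (rule eqI[OF add[OF zero]]) (use a in \<open>simp_all add: glued_alg_simps(3,5) ring.ring_simprules[OF R] cl\<close>)
    show "\<one>\<^bsub>?G\<^esub> \<otimes>\<^bsub>?G\<^esub> \<alpha> = \<alpha>"
      by (rule eqI[OF mult[OF one]]) (use a in \<open>simp_all add: glued_alg_simps(2,4) ring.ring_simprules[OF R] cl\<close>)
    show "\<exists>\<beta> \<in> carrier ?G. \<beta> \<oplus>\<^bsub>?G\<^esub> \<alpha> = \<zero>\<^bsub>?G\<^esub>"
      by (rule bexI[OF _ neg[OF a]], rule eqI[OF add[OF neg[OF a] a] zero])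
        (use a in \<open>simp add: glued_alg_simps(3,5) ring.ring_simprules[OF R] cl\<close>)
  qed
  then have "algebra CC ?G"
  proof (rule algebraI[OF cring_from_type_algebra])
    fix z w :: complex and \<alpha> \<beta> assume a: "\<alpha> \<in> carrier ?G"
    show "z \<odot>\<^bsub>?G\<^esub> \<alpha> \<in> carrier ?G" by (rule smult[OF a])
    show "(z \<oplus>\<^bsub>CC\<^esub> w) \<odot>\<^bsub>?G\<^esub> \<alpha> = z \<odot>\<^bsub>?G\<^esub> \<alpha> \<oplus>\<^bsub>?G\<^esub> w \<odot>\<^bsub>?G\<^esub> \<alpha>"
      by (rule eqI[OF smult[OF a] add[OF smult[OF a] smult[OF a]]])
        (simp add: glued_alg_simps(3,6) module.smult_l_distr[OF algebra.module[OF A]] cl[OF a])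
    show "(z \<otimes>\<^bsub>CC\<^esub> w) \<odot>\<^bsub>?G\<^esub> \<alpha> = z \<odot>\<^bsub>?G\<^esub> (w \<odot>\<^bsub>?G\<^esub> \<alpha>)"
      by (rule eqI[OF smult[OF a] smult[OF smult[OF a]]])
        (simp add: glued_alg_simps(6) module.smult_assoc1[OF algebra.module[OF A]] cl[OF a])
    show "\<one>\<^bsub>CC\<^esub> \<odot>\<^bsub>?G\<^esub> \<alpha> = \<alpha>"
      by (rule eqI[OF smult[OF a] a])
        (simp add: glued_alg_simps(6) module.smult_one[OF algebra.module[OF A]] cl[OF a])
    assume b: "\<beta> \<in> carrier ?G"
    show "z \<odot>\<^bsub>?G\<^esub> (\<alpha> \<oplus>\<^bsub>?G\<^esub> \<beta>) = z \<odot>\<^bsub>?G\<^esub> \<alpha> \<oplus>\<^bsub>?G\<^esub> z \<odot>\<^bsub>?G\<^esub> \<beta>"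
      by (rule eqI[OF smult[OF add[OF a b]] add[OF smult[OF a] smult[OF b]]])
        (simp add: glued_alg_simps(3,6) module.smult_r_distr[OF algebra.module[OF A]] cl[OF a] cl[OF b])
    show "(z \<odot>\<^bsub>?G\<^esub> \<alpha>) \<otimes>\<^bsub>?G\<^esub> \<beta> = z \<odot>\<^bsub>?G\<^esub> (\<alpha> \<otimes>\<^bsub>?G\<^esub> \<beta>)"
      by (rule eqI[OF mult[OF smult[OF a] b] smult[OF mult[OF a b]]])
        (simp add: glued_alg_simps(2,6) algebra.smult_assoc2[OF A] cl[OF a] cl[OF b])
  qed
  then show ?thesis by (simp add: C_algebra_def)
qed

section \<open>The glued object and its immersion into V\<close>

context
  fixes V :: "'u sch"
    and I :: "'i set"
    and U :: "'i \<Rightarrow> 'u set"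
    and Xi :: "'i \<Rightarrow> ('u, 's, 'a) fobj"
    and Xij :: "'i \<Rightarrow> 'i \<Rightarrow> ('u, 't, 'b) fobj"
    and \<iota> :: "'i \<Rightarrow> ('u, 's, 'a) to_sch"
    and \<iota>ij :: "'i \<Rightarrow> 'i \<Rightarrow> ('u, 't, 'b) to_sch"
    and \<phi> :: "'i \<Rightarrow> ('u, 's, 'a) to_sch"
    and \<kappa> :: "'i \<Rightarrow> 'i \<Rightarrow> ('u, 't, 's, 'b, 'a) omor"
    and e :: "'u agad \<Rightarrow> 'u sch_mor \<Rightarrow> ('i \<Rightarrow> 'a) \<Rightarrow> 'u"
  assumes V: "ft_scheme V"
    and U: "\<And>i. i \<in> I \<Longrightarrow> opn V (U i)"
    and cover: "(\<Union>i \<in> I. U i) = pts V"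
    and Xi: "\<And>i. i \<in> I \<Longrightarrow> variety_F1 (Xi i)"
    and \<iota>: "\<And>i. i \<in> I \<Longrightarrow> scalar_ext (Xi i) (open_sub V (U i)) (\<iota> i)"
    and Xij: "\<And>i j. i \<in> I \<Longrightarrow> j \<in> I \<Longrightarrow> i \<noteq> j \<Longrightarrow> variety_F1 (Xij i j)"
    and \<iota>ij: "\<And>i j. i \<in> I \<Longrightarrow> j \<in> I \<Longrightarrow> i \<noteq> j \<Longrightarrow>
      scalar_ext (Xij i j) (open_sub V (U i \<inter> U j)) (\<iota>ij i j)"
    and sym: "\<And>i j. i \<in> I \<Longrightarrow> j \<in> I \<Longrightarrow> i \<noteq> j \<Longrightarrow> Xij i j = Xij j i \<and> \<iota>ij i j = \<iota>ij j i"
    and \<phi>: "\<And>i. i \<in> I \<Longrightarrow> obj_immersion (Xi i) (sch_obj V) (\<phi> i)"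
    and ext_\<phi>: "\<And>i. i \<in> I \<Longrightarrow>
      ext_to_sch (Xi i) (open_sub V (U i)) (\<iota> i) V (\<phi> i) = open_incl V (U i)"
    and \<kappa>: "\<And>i j. i \<in> I \<Longrightarrow> j \<in> I \<Longrightarrow> i \<noteq> j \<Longrightarrow> obj_immersion (Xij i j) (Xi i) (\<kappa> i j)"
    and ext_\<kappa>: "\<And>i j. i \<in> I \<Longrightarrow> j \<in> I \<Longrightarrow> i \<noteq> j \<Longrightarrow>
      ext_mor (Xij i j) (open_sub V (U i \<inter> U j)) (\<iota>ij i j) (open_sub V (U i)) (\<iota> i) (\<kappa> i j) =
      open_incl (open_sub V (U i)) (U i \<inter> U j)"
    and agree: "\<And>i j. i \<in> I \<Longrightarrow> j \<in> I \<Longrightarrow> i \<noteq> j \<Longrightarrow>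
      obj_comp (Xij i j) (sch_obj V) (\<phi> i) (\<kappa> i j) =
      obj_comp (Xij j i) (sch_obj V) (\<phi> j) (\<kappa> j i)"
    and e: "evident_evaluation I Xi \<phi> \<kappa> e"
begin

private abbreviation (input) GX where "GX \<equiv> glued_obj V I Xi \<phi> \<kappa> e"
private abbreviation (input) Vi where "Vi i \<equiv> open_sub V (U i)"
private abbreviation (input) Vij where "Vij i j \<equiv> open_sub V (U i \<inter> U j)"
private abbreviation (input) inc where "inc i j \<equiv> open_incl (Vi i) (U i \<inter> U j)"

private lemma lr: "locally_ringed V"
  by (rule ft_scheme_locally_ringed[OF V])

private lemma lr_i: "i \<in> I \<Longrightarrow> locally_ringed (Vi i)"
  by (rule ft_scheme_locally_ringed[OF scalar_ext_ft[OF \<iota>]])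

private lemma lr_ij: "i \<in> I \<Longrightarrow> j \<in> I \<Longrightarrow> i \<noteq> j \<Longrightarrow> locally_ringed (Vij i j)"
  by (rule ft_scheme_locally_ringed[OF scalar_ext_ft[OF \<iota>ij]])

private lemma obj_i: "i \<in> I \<Longrightarrow> is_object (Xi i)"
  using Xi by (simp add: variety_F1_def)

private lemma obj_ij: "i \<in> I \<Longrightarrow> j \<in> I \<Longrightarrow> i \<noteq> j \<Longrightarrow> is_object (Xij i j)"
  using Xij by (simp add: variety_F1_def)

private lemma \<phi>_hom: "i \<in> I \<Longrightarrow> \<phi> i \<in> obj_hom (Xi i) (sch_obj V)"
  using \<phi> by (simp add: obj_immersion_def)

private lemma \<kappa>_hom: "i \<in> I \<Longrightarrow> j \<in> I \<Longrightarrow> i \<noteq> j \<Longrightarrow> \<kappa> i j \<in> obj_hom (Xij i j) (Xi i)"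
  using \<kappa> by (simp add: obj_immersion_def)

text \<open>The extension of \<open>\<phi> i\<close> is by definition a morphism of schemes through
  which \<open>\<phi> i\<close> factors; the hypothesis that it equals the open inclusion gives both
  facts for the inclusion.\<close>

private lemma incl_i:
  assumes i: "i \<in> I"
  shows "open_incl V (U i) \<in> sch_hom (Vi i) V" "factors_via (Xi i) (Vi i) V (\<iota> i) (open_incl V (U i)) (\<phi> i)"
  using ext_to_sch_factors_via[OF \<iota>[OF i] V \<phi>_hom[OF i]] unfolding ext_\<phi>[OF i] by auto

private abbreviation (input) res_\<iota> where "res_\<iota> i j \<equiv> obj_comp (Xij i j) (sch_obj (Vi i)) (\<iota> i) (\<kappa> i j)"

text \<open>The analogue for the overlap, applied to the composite \<open>res_\<iota>\<close> of
  \<open>\<kappa> i j\<close> with \<open>\<iota> i\<close>, whose extension is what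
  \<open>ext_mor\<close> denotes.\<close>

private lemma incl_ij:
  assumes ij: "i \<in> I" "j \<in> I" "i \<noteq> j"
  shows "inc i j \<in> sch_hom (Vij i j) (Vi i)" "factors_via (Xij i j) (Vij i j) (Vi i) (\<iota>ij i j) (inc i j) (res_\<iota> i j)"
proof -
  have "res_\<iota> i j \<in> obj_hom (Xij i j) (sch_obj (Vi i))"
    by (rule obj_comp_hom[OF obj_ij[OF ij] _ \<kappa>_hom[OF ij] scalar_ext_hom[OF \<iota>[OF ij(1)]]])
      (simp add: alg_closed_fun_alg lr_i ij)
  from ext_to_sch_factors_via[OF \<iota>ij[OF ij] scalar_ext_ft[OF \<iota>[OF ij(1)]] this]
  show "inc i j \<in> sch_hom (Vij i j) (Vi i)" "factors_via (Xij i j) (Vij i j) (Vi i) (\<iota>ij i j) (inc i j) (res_\<iota> i j)"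
    using ext_\<kappa>[OF ij] unfolding ext_mor_def by simp_all
qed

text \<open>The two composites have source \<open>Xij i j\<close> and \<open>Xij j i\<close>;
  \<open>sym\<close> identifies these, so z can be fed to both.\<close>

private lemma agree_otr:
  assumes "i \<in> I" "j \<in> I" "i \<noteq> j" "A \<in> AffF1" "z \<in> ofun (Xij i j) A"
  shows "otr (\<phi> i) A (otr (\<kappa> i j) A z) = otr (\<phi> j) A (otr (\<kappa> j i) A z)"
  using arg_cong[OF agree[OF assms(1-3)], of "\<lambda>f. otr f A z"] assms sym[OF assms(1-3)]
  by (simp add: otr_obj_comp)

private lemma agree_opull:
  assumes "i \<in> I" "j \<in> I" "i \<noteq> j" "\<beta> \<in> carrier (fun_alg V)"
  shows "opull (\<kappa> i j) (opull (\<phi> i) \<beta>) = opull (\<kappa> j i) (opull (\<phi> j) \<beta>)"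
  using arg_cong[OF agree[OF assms(1-3)], of "\<lambda>f. opull f \<beta>"] assms(4)
  by (simp add: opull_obj_comp)

private lemma oalg_G: "oalg GX = glued_alg I Xi \<kappa>"
  by (simp add: glued_obj_def)

text \<open>The projection of \<open>evident_evaluation\<close> is cut down to the carrier, which
  leaves the composite unchanged and makes the projection an element of
  \<open>alg_hom\<close>.\<close>

private lemma oev_G:
  "i \<in> I \<Longrightarrow> A \<in> AffF1 \<Longrightarrow> x \<in> ofun (Xi i) A \<Longrightarrow>
    oev GX A (otr (\<phi> i) A x) = compose (carrier (oalg GX)) (oev (Xi i) A x) (\<lambda>\<alpha> \<in> carrier (oalg GX). \<alpha> i)"
  using e by (simp add: glued_obj_def evident_evaluation_def compose_def cong: restrict_cong)

private lemma ofun_G_I: "i \<in> I \<Longrightarrow> x \<in> ofun (Xi i) A \<Longrightarrow> otr (\<phi> i) A x \<in> ofun GX A"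
  by (auto simp: glued_obj_def)

private lemma ofun_G_E:
  assumes "y \<in> ofun GX A"
  obtains i x where "i \<in> I" "x \<in> ofun (Xi i) A" "y = otr (\<phi> i) A x"
  using assms by (auto simp: glued_obj_def)

private lemma omap_G:
  "i \<in> I \<Longrightarrow> A \<in> AffF1 \<Longrightarrow> B \<in> AffF1 \<Longrightarrow> f \<in> gadget_hom A B \<Longrightarrow> x \<in> ofun (Xi i) B \<Longrightarrow>
    omap GX A B f (otr (\<phi> i) B x) = otr (\<phi> i) A (omap (Xi i) A B f x)"
  by (simp add: glued_obj_def otr_omap[OF \<phi>_hom])

private lemma C_algebra_G: "C_algebra (oalg GX)"
  unfolding oalg_G
proof (rule glued_alg_C_algebra)
  show "C_algebra (oalg (Xi i))" if "i \<in> I" for i using oalg_C_algebra[OF obj_i[OF that]] .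
  show "C_algebra (oalg (Xij i j))" if "i \<in> I" "j \<in> I" "i \<noteq> j" for i j using oalg_C_algebra[OF obj_ij[OF that]] .
  show "oalg (Xij i j) = oalg (Xij j i)" if "i \<in> I" "j \<in> I" "i \<noteq> j" for i j using sym[OF that] by simp
  show "opull (\<kappa> i j) \<in> alg_hom (oalg (Xi i)) (oalg (Xij i j))" if "i \<in> I" "j \<in> I" "i \<noteq> j" for i j
    using opull_alg_hom[OF \<kappa>_hom[OF that]] .
qed

private lemma G_component: "\<alpha> \<in> carrier (oalg GX) \<Longrightarrow> i \<in> I \<Longrightarrow> \<alpha> i \<in> carrier (oalg (Xi i))"
  by (auto simp: oalg_G glued_alg_simps)

private lemma G_compat:
  "\<alpha> \<in> carrier (oalg GX) \<Longrightarrow> i \<in> I \<Longrightarrow> j \<in> I \<Longrightarrow> i \<noteq> j \<Longrightarrow> opull (\<kappa> i j) (\<alpha> i) = opull (\<kappa> j i) (\<alpha> j)"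
  by (simp add: oalg_G glued_alg_simps)

private lemma proj_alg_hom:
  assumes i: "i \<in> I"
  shows "(\<lambda>\<alpha> \<in> carrier (oalg GX). \<alpha> i) \<in> alg_hom (oalg GX) (oalg (Xi i))"
proof -
  have "(\<lambda>\<alpha> \<in> carrier (oalg GX). \<alpha> i) \<in> ring_hom (oalg GX) (oalg (Xi i))"
    using C_algebra_closed[OF C_algebra_G] i G_component
    by (intro ring_hom_memI) (auto simp: alg_closed_def, simp_all add: oalg_G glued_alg_simps(2,3,4))
  then show ?thesis
    using C_algebra_closed[OF C_algebra_G] i
    by (auto simp: alg_hom_def rhom_def alg_closed_def, simp add: oalg_G glued_alg_simps(6))
qed

text \<open>Each law is checked on a piece containing the given point. Different pieces cannot
  conflict: points and their pullbacks are taken inside V, and the evaluation is a single e subject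
  to the condition of every piece.\<close>

private lemma is_object_G: "is_object GX"
  unfolding is_object_def
proof (intro conjI ballI)
  show "omap GX A B f x \<in> ofun GX A" if "A \<in> AffF1" "B \<in> AffF1" "f \<in> gadget_hom A B" "x \<in> ofun GX B" for A B f x
    using that(4)
  proof (rule ofun_G_E)
    fix i y assume "i \<in> I" "y \<in> ofun (Xi i) B" "x = otr (\<phi> i) B y"
    then show ?thesis using that by (simp add: omap_G ofun_G_I omap_closed[OF obj_i])
  qed
  show "omap GX A A (gadget_id A) x = x" if "A \<in> AffF1" "x \<in> ofun GX A" for A x
    using that(2)
  proof (rule ofun_G_E)
    fix i y assume i: "i \<in> I" "y \<in> ofun (Xi i) A" "x = otr (\<phi> i) A y"
    have "gadget_id A \<in> gadget_hom A A"
      using that(1) by (intro gadget_id_hom) (simp add: AffF1_def finite_gadget_def)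
    then show ?thesis using that i by (simp add: omap_G omap_id[OF obj_i])
  qed
  show "omap GX A C (gadget_comp A C g f) x = omap GX A B f (omap GX B C g x)"
    if "A \<in> AffF1" "B \<in> AffF1" "C \<in> AffF1" "f \<in> gadget_hom A B" "g \<in> gadget_hom B C" "x \<in> ofun GX C" for A B C f g x
    using that(6)
  proof (rule ofun_G_E)
    fix i y assume i: "i \<in> I" "y \<in> ofun (Xi i) C" "x = otr (\<phi> i) C y"
    have "gadget_comp A C g f \<in> gadget_hom A C"
      by (rule gadget_comp_hom[OF _ _ that(4,5)]) (use that in \<open>auto simp: AffF1_def finite_gadget_def\<close>)
    then show ?thesis using that i by (simp add: omap_G omap_comp[OF obj_i] omap_closed[OF obj_i])
  qed
  show "C_algebra (oalg GX)" by (rule C_algebra_G)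
  show "oev GX A x \<in> alg_hom (oalg GX) (galg A)" if "A \<in> AffF1" "x \<in> ofun GX A" for A x
    using that(2)
  proof (rule ofun_G_E)
    fix i y assume i: "i \<in> I" "y \<in> ofun (Xi i) A" "x = otr (\<phi> i) A y"
    show ?thesis
      unfolding i(3) oev_G[OF i(1) that(1) i(2)]
      by (rule alg_hom_compose[OF C_algebra_closed[OF C_algebra_G] proj_alg_hom[OF i(1)]
            oev_alg_hom[OF obj_i[OF i(1)] that(1) i(2)]])
  qed
  show "oev GX A (omap GX A B f x) = compose (carrier (oalg GX)) (gpull f) (oev GX B x)"
    if "A \<in> AffF1" "B \<in> AffF1" "f \<in> gadget_hom A B" "x \<in> ofun GX B" for A B f x
    using that(4)
  proof (rule ofun_G_E)
    fix i y assume i: "i \<in> I" "y \<in> ofun (Xi i) B" "x = otr (\<phi> i) B y"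
    then show ?thesis
      using that G_component[OF _ i(1)]
      by (simp add: omap_G oev_G omap_closed[OF obj_i] oev_omap[OF obj_i]) (auto simp: compose_def fun_eq_iff)
  qed
qed

text \<open>The morphism of the i-th variety into the glued object; composing with it restricts a
  morphism to the i-th piece.\<close>

private definition piece where
  "piece i = \<lparr>otr = otr (\<phi> i), opull = \<lambda>\<alpha> \<in> carrier (oalg GX). \<alpha> i\<rparr>"

private lemma piece_hom:
  assumes i: "i \<in> I"
  shows "piece i \<in> obj_hom (Xi i) GX"
proof (rule obj_homI)
  show "otr (piece i) \<in> (\<Pi>\<^sub>E A \<in> AffF1. ofun (Xi i) A \<rightarrow>\<^sub>E ofun GX A)"
    using obj_hom_otr_PiE[OF \<phi>_hom[OF i]] ofun_G_I[OF i] by (auto simp: piece_def PiE_iff)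
  show "opull (piece i) \<in> alg_hom (oalg GX) (oalg (Xi i))"
    using proj_alg_hom[OF i] by (simp add: piece_def)
qed (simp_all add: piece_def i omap_G oev_G)

private lemma glued_incl_hom: "glued_incl V I Xi \<phi> \<in> obj_hom GX (sch_obj V)"
proof (rule obj_homI)
  have otr: "otr (glued_incl V I Xi \<phi>) A x = x" if "A \<in> AffF1" "x \<in> ofun GX A" for A x
    using that by (simp add: glued_incl_def glued_obj_def)
  have sub: "ofun GX A \<subseteq> sch_hom (aff_Z A) V" if "A \<in> AffF1" for A
    using otr_closed[OF \<phi>_hom that] by (auto simp: glued_obj_def)
  show "otr (glued_incl V I Xi \<phi>) \<in> (\<Pi>\<^sub>E A \<in> AffF1. ofun GX A \<rightarrow>\<^sub>E ofun (sch_obj V) A)"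
    using sub otr by (auto simp: PiE_iff) (auto simp: glued_incl_def glued_obj_def)
  show "otr (glued_incl V I Xi \<phi>) A (omap GX A B f x) = omap (sch_obj V) A B f (otr (glued_incl V I Xi \<phi>) B x)"
    if "A \<in> AffF1" "B \<in> AffF1" "f \<in> gadget_hom A B" "x \<in> ofun GX B" for A B f x
    using that by (simp add: otr omap_closed[OF is_object_G]) (simp add: glued_obj_def)
  note \<phi>h = alg_hom_ring_hom[OF opull_alg_hom[OF \<phi>_hom], unfolded oalg_sch_obj]
  note cl = alg_closed_fun_alg[OF lr, unfolded alg_closed_def]
  have "(\<lambda>\<beta> \<in> carrier (fun_alg V). \<lambda>i \<in> I. opull (\<phi> i) \<beta>) \<in> ring_hom (fun_alg V) (glued_alg I Xi \<kappa>)"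
  proof (rule ring_hom_memI)
    fix \<beta> assume "\<beta> \<in> carrier (fun_alg V)"
    then show "(\<lambda>\<beta> \<in> carrier (fun_alg V). \<lambda>i \<in> I. opull (\<phi> i) \<beta>) \<beta> \<in> carrier (glued_alg I Xi \<kappa>)"
      by (simp add: glued_alg_simps ring_hom_closed[OF \<phi>h] agree_opull)
  qed (use cl in \<open>simp_all add: glued_alg_simps(2,3,4) ring_hom_mult[OF \<phi>h] ring_hom_add[OF \<phi>h]
      ring_hom_one[OF \<phi>h] cong: restrict_cong\<close>)
  then show "opull (glued_incl V I Xi \<phi>) \<in> alg_hom (oalg (sch_obj V)) (oalg GX)"
    using cl alg_hom_smult[OF opull_alg_hom[OF \<phi>_hom], unfolded oalg_sch_obj]
    by (simp add: alg_hom_def rhom_def glued_incl_def oalg_G glued_alg_simps(6) cong: restrict_cong)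
  show "oev (sch_obj V) A (otr (glued_incl V I Xi \<phi>) A x) =
      compose (carrier (oalg (sch_obj V))) (oev GX A x) (opull (glued_incl V I Xi \<phi>))"
    if "A \<in> AffF1" "x \<in> ofun GX A" for A x
    using that(2)
  proof (rule ofun_G_E)
    fix i y assume i: "i \<in> I" "y \<in> ofun (Xi i) A" "x = otr (\<phi> i) A y"
    \<comment> \<open>The restrictions of a function on V form a compatible family by the hypothesis
      \<open>agree\<close>, here in its algebra half \<open>agree_opull\<close>.\<close>
    have "(\<lambda>i \<in> I. opull (\<phi> i) \<beta>) \<in> carrier (oalg GX)" if "\<beta> \<in> carrier (fun_alg V)" for \<beta>
      using that by (simp add: oalg_G glued_alg_simps ring_hom_closed[OF \<phi>h] agree_opull)
    then show ?thesis
      unfolding otr[OF that] unfolding i(3) oev_G[OF i(1) that(1) i(2)] oev_otr[OF \<phi>_hom[OF i(1)] that(1) i(2)]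
      using i(1) by (auto simp: compose_def glued_incl_def fun_eq_iff)
  qed
qed

private lemma glued_immersion: "obj_immersion GX (sch_obj V) (glued_incl V I Xi \<phi>)"
  unfolding obj_immersion_def
proof (intro conjI ballI glued_incl_hom)
  show "inj_on (otr (glued_incl V I Xi \<phi>) A) (ofun GX A)" if "A \<in> AffF1" for A
    using that by (auto simp: inj_on_def glued_incl_def glued_obj_def)
  show "inj_on (opull (glued_incl V I Xi \<phi>)) (carrier (oalg (sch_obj V)))"
  proof (rule inj_onI)
    fix \<beta> \<gamma> assume b: "\<beta> \<in> carrier (oalg (sch_obj V))" "\<gamma> \<in> carrier (oalg (sch_obj V))"
      and eq: "opull (glued_incl V I Xi \<phi>) \<beta> = opull (glued_incl V I Xi \<phi>) \<gamma>"
    show "\<beta> = \<gamma>"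
    proof (cases "I = {}")
      case True
      \<comment> \<open>An empty index set forces V to have no points, so there is only one
        extensional function on its complexification.\<close>
      then have "bc_pts V = {}" using cover by (auto simp: bc_pts_def)
      then show ?thesis using b by (auto simp: fun_alg_carrier[OF lr])
    next
      case False
      then obtain i where i: "i \<in> I" by blast
      have "opull (\<phi> i) \<beta> = opull (\<phi> i) \<gamma>"
        using fun_cong[OF eq, of i] b i by (simp add: glued_incl_def)
      moreover have "inj_on (opull (\<phi> i)) (carrier (oalg (sch_obj V)))"
        using \<phi>[OF i] by (simp add: obj_immersion_def)
      ultimately show ?thesis using b by (simp add: inj_on_def)
    qed
  qed
qed

section \<open>The universal property of the glued object\<close>

context
  fixes W :: "'u sch" and \<psi> :: "('u, 'u sch_mor, 'i \<Rightarrow> 'a) to_sch"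
  assumes W: "ft_scheme W" and \<psi>: "\<psi> \<in> obj_hom GX (sch_obj W)"
begin

private abbreviation (input) \<psi>i where "\<psi>i i \<equiv> obj_comp (Xi i) (sch_obj W) \<psi> (piece i)"

private lemma lrW: "locally_ringed W"
  by (rule ft_scheme_locally_ringed[OF W])

private lemma algW: "alg_closed (oalg (sch_obj W))"
  by (simp add: alg_closed_fun_alg lrW)

private lemma \<psi>i_hom: "i \<in> I \<Longrightarrow> \<psi>i i \<in> obj_hom (Xi i) (sch_obj W)"
  by (rule obj_comp_hom[OF obj_i algW piece_hom \<psi>])

private lemma \<psi>_closed: "\<gamma> \<in> carrier (fun_alg W) \<Longrightarrow> opull \<psi> \<gamma> \<in> carrier (oalg GX)"
  using alg_hom_closed[OF opull_alg_hom[OF \<psi>]] by simp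

private lemma otr_\<psi>i: "A \<in> AffF1 \<Longrightarrow> x \<in> ofun (Xi i) A \<Longrightarrow> otr (\<psi>i i) A x = otr \<psi> A (otr (\<phi> i) A x)"
  by (simp add: otr_obj_comp piece_def)

private lemma opull_\<psi>i: "\<gamma> \<in> carrier (fun_alg W) \<Longrightarrow> opull (\<psi>i i) \<gamma> = opull \<psi> \<gamma> i"
  by (simp add: opull_obj_comp piece_def \<psi>_closed)

text \<open>Points of the glued object are the points of its pieces, and its functions are families
  over the pieces, so the factorisation splits over I. The passage from \<open>\<phi> i\<close> to
  \<open>\<iota> i\<close> absorbs the open inclusion into the scheme morphism.\<close>

private lemma factors_via_G_iff:
  assumes g: "g \<in> sch_hom V W"
  shows "factors_via GX V W (glued_incl V I Xi \<phi>) g \<psi> \<longleftrightarrow>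
    (\<forall>i \<in> I. factors_via (Xi i) (Vi i) W (\<iota> i) (sch_comp (Vi i) V W g (open_incl V (U i))) (\<psi>i i))"
proof -
  have t: "otr (glued_incl V I Xi \<phi>) A x = x" if "A \<in> AffF1" "x \<in> ofun GX A" for A x
    using that by (simp add: glued_incl_def glued_obj_def)
  have c: "fun_pull V W g \<gamma> \<in> carrier (fun_alg V)" if "\<gamma> \<in> carrier (fun_alg W)" for \<gamma>
    by (rule fun_pull_closed[OF lr lrW g that])
  \<comment> \<open>Elements of the glued algebra are extensional on I, so they are determined by
    their components.\<close>
  have ext: "\<alpha> = (\<lambda>i \<in> I. \<beta> i) \<longleftrightarrow> (\<forall>i \<in> I. \<alpha> i = \<beta> i)" if "\<alpha> \<in> carrier (oalg GX)" for \<alpha> \<beta>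
  proof
    assume "\<forall>i \<in> I. \<alpha> i = \<beta> i"
    then show "\<alpha> = (\<lambda>i \<in> I. \<beta> i)"
      using that by (intro extensionalityI[of \<alpha> I]) (auto simp: oalg_G glued_alg_simps PiE_iff)
  qed simp
  have "(\<forall>A \<in> AffF1. \<forall>x \<in> ofun GX A. otr \<psi> A x = sch_comp (aff_Z A) V W g (otr (glued_incl V I Xi \<phi>) A x)) \<longleftrightarrow>
      (\<forall>i \<in> I. \<forall>A \<in> AffF1. \<forall>x \<in> ofun (Xi i) A. otr (\<psi>i i) A x = sch_comp (aff_Z A) V W g (otr (\<phi> i) A x))"
    (is "?L \<longleftrightarrow> ?R")
  proof
    assume L: ?L
    show ?R using L by (simp add: otr_\<psi>i t ofun_G_I)
  next
    assume R: ?R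
    show ?L
    proof (intro ballI)
      fix A x assume A: "A \<in> AffF1" and x: "x \<in> ofun GX A"
      obtain i y where "i \<in> I" "y \<in> ofun (Xi i) A" "x = otr (\<phi> i) A y" using ofun_G_E[OF x] .
      then show "otr \<psi> A x = sch_comp (aff_Z A) V W g (otr (glued_incl V I Xi \<phi>) A x)"
        using R A x by (simp add: t otr_\<psi>i[symmetric])
    qed
  qed
  moreover have "(\<forall>\<gamma> \<in> carrier (fun_alg W). opull \<psi> \<gamma> = opull (glued_incl V I Xi \<phi>) (fun_pull V W g \<gamma>)) \<longleftrightarrow>
      (\<forall>i \<in> I. \<forall>\<gamma> \<in> carrier (fun_alg W). opull (\<psi>i i) \<gamma> = opull (\<phi> i) (fun_pull V W g \<gamma>))"
  proof -
    have "opull \<psi> \<gamma> = opull (glued_incl V I Xi \<phi>) (fun_pull V W g \<gamma>) \<longleftrightarrow>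
        (\<forall>i \<in> I. opull (\<psi>i i) \<gamma> = opull (\<phi> i) (fun_pull V W g \<gamma>))" if "\<gamma> \<in> carrier (fun_alg W)" for \<gamma>
      using ext[OF \<psi>_closed[OF that]] that c[OF that] by (simp add: glued_incl_def opull_\<psi>i)
    then show ?thesis by blast
  qed
  ultimately have "factors_via GX V W (glued_incl V I Xi \<phi>) g \<psi> \<longleftrightarrow> (\<forall>i \<in> I. factors_via (Xi i) V W (\<phi> i) g (\<psi>i i))"
    unfolding factors_via_def by blast
  then show ?thesis
    using factors_via_comp_iff[OF lr_i lr lrW incl_i(1) g scalar_ext_hom[OF \<iota>] incl_i(2)] by simp
qed

text \<open>Precomposing the factorisation over \<open>U i\<close> with \<open>\<kappa> i j\<close>
  gives one through \<open>res_\<iota>\<close>, which itself is \<open>\<iota>ij i j\<close>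
  followed by the inclusion of the overlap into \<open>U i\<close>.\<close>

private lemma overlap:
  assumes ij: "i \<in> I" "j \<in> I" "i \<noteq> j" and g: "g \<in> sch_hom (Vi i) W" "factors_via (Xi i) (Vi i) W (\<iota> i) g (\<psi>i i)"
  shows "factors_via (Xij i j) (Vij i j) W (\<iota>ij i j) (sch_comp (Vij i j) (Vi i) W g (inc i j))
    (obj_comp (Xij i j) (sch_obj W) (\<psi>i i) (\<kappa> i j))"
proof -
  have "factors_via (Xij i j) (Vi i) W (res_\<iota> i j) g (obj_comp (Xij i j) (sch_obj W) (\<psi>i i) (\<kappa> i j))"
    unfolding factors_via_def
  proof (intro conjI ballI)
    fix A x assume A: "A \<in> AffF1" and x: "x \<in> ofun (Xij i j) A"
    show "otr (obj_comp (Xij i j) (sch_obj W) (\<psi>i i) (\<kappa> i j)) A x = sch_comp (aff_Z A) (Vi i) W g (otr (res_\<iota> i j) A x)"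
      using g(2) A otr_closed[OF \<kappa>_hom[OF ij] A x] unfolding otr_obj_comp[OF A x] factors_via_def by blast
  next
    fix \<gamma> assume \<gamma>: "\<gamma> \<in> carrier (fun_alg W)"
    have c: "fun_pull (Vi i) W g \<gamma> \<in> carrier (oalg (sch_obj (Vi i)))"
      using fun_pull_closed[OF lr_i[OF ij(1)] lrW g(1) \<gamma>] by simp
    have \<gamma>': "\<gamma> \<in> carrier (oalg (sch_obj W))" using \<gamma> by simp
    show "opull (obj_comp (Xij i j) (sch_obj W) (\<psi>i i) (\<kappa> i j)) \<gamma> = opull (res_\<iota> i j) (fun_pull (Vi i) W g \<gamma>)"
      using g(2) \<gamma> unfolding opull_obj_comp[OF c] opull_obj_comp[OF \<gamma>', of "Xij i j"] factors_via_def by simp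
  qed
  then show ?thesis
    using factors_via_comp_iff[OF lr_ij[OF ij] lr_i[OF ij(1)] lrW incl_ij(1)[OF ij] g(1)
        scalar_ext_hom[OF \<iota>ij[OF ij]] incl_ij(2)[OF ij]]
    by simp
qed

text \<open>On points this is \<open>agree\<close>; on functions it is the compatibility condition
  of the glued algebra, applied to the family \<open>opull \<psi> \<gamma>\<close>.\<close>

private lemma \<psi>_overlap:
  assumes ij: "i \<in> I" "j \<in> I" "i \<noteq> j"
  shows "obj_comp (Xij i j) (sch_obj W) (\<psi>i i) (\<kappa> i j) = obj_comp (Xij j i) (sch_obj W) (\<psi>i j) (\<kappa> j i)"
proof (rule omor.equality)
  note ji = ij(2,1) ij(3)[symmetric]
  have X: "Xij j i = Xij i j" using sym[OF ij] by simp
  have "otr (\<psi>i i) A (otr (\<kappa> i j) A x) = otr (\<psi>i j) A (otr (\<kappa> j i) A x)"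
    if A: "A \<in> AffF1" and x: "x \<in> ofun (Xij i j) A" for A x
    using otr_closed[OF \<kappa>_hom[OF ij] A x] otr_closed[OF \<kappa>_hom[OF ji] A] x
    by (simp add: otr_\<psi>i A X agree_otr[OF ij A x])
  then show "otr (obj_comp (Xij i j) (sch_obj W) (\<psi>i i) (\<kappa> i j)) = otr (obj_comp (Xij j i) (sch_obj W) (\<psi>i j) (\<kappa> j i))"
    unfolding X by (auto simp: obj_comp_def[of "Xij i j"] compose_def fun_eq_iff)
  have "opull (\<kappa> i j) (opull (\<psi>i i) \<gamma>) = opull (\<kappa> j i) (opull (\<psi>i j) \<gamma>)" if "\<gamma> \<in> carrier (fun_alg W)" for \<gamma>
    using that by (simp add: opull_\<psi>i G_compat[OF \<psi>_closed ij])
  then show "opull (obj_comp (Xij i j) (sch_obj W) (\<psi>i i) (\<kappa> i j)) = opull (obj_comp (Xij j i) (sch_obj W) (\<psi>i j) (\<kappa> j i))"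
    by (auto simp: obj_comp_def[of "Xij i j"] obj_comp_def[of "Xij j i"] compose_def fun_eq_iff)
qed simp

lemma glued_universal: "\<exists>!g. g \<in> sch_hom V W \<and> factors_via GX V W (glued_incl V I Xi \<phi>) g \<psi>"
proof -
  have comp_hom: "sch_comp (Vi i) V W g (open_incl V (U i)) \<in> sch_hom (Vi i) W" if "i \<in> I" "g \<in> sch_hom V W" for i g
    by (rule sch_comp_hom[OF locally_ringed_ringed[OF lr_i[OF that(1)]] locally_ringed_ringed[OF lr]
          locally_ringed_ringed[OF lrW] incl_i(1)[OF that(1)] that(2)])
  define g where "g i = ext_to_sch (Xi i) (Vi i) (\<iota> i) W (\<psi>i i)" for i
  have g: "g i \<in> sch_hom (Vi i) W" "factors_via (Xi i) (Vi i) W (\<iota> i) (g i) (\<psi>i i)" if "i \<in> I" for i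
    using ext_to_sch_factors_via[OF \<iota>[OF that] W \<psi>i_hom[OF that]] by (simp_all add: g_def)
  have compat: "sch_comp (Vij i j) (Vi i) W (g i) (inc i j) =
      sch_comp (Vij i j) (Vi j) W (g j) (open_incl (Vi j) (U i \<inter> U j))" (is "?a = ?b")
    if ij: "i \<in> I" "j \<in> I" "i \<noteq> j" for i j
  proof -
    note ji = ij(2,1) ij(3)[symmetric]
    let ?\<chi> = "obj_comp (Xij i j) (sch_obj W) (\<psi>i i) (\<kappa> i j)"
    \<comment> \<open>Facts for the pair (j, i) speak of \<open>U j \<inter> U i\<close>; this
      equation and \<open>sym\<close> move them to the scheme and the variety attached to (i,
      j).\<close>
    have comm: "U j \<inter> U i = U i \<inter> U j" by blast
    have X: "Xij j i = Xij i j" "\<iota>ij j i = \<iota>ij i j" using sym[OF ij] by auto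
    have "?\<chi> \<in> obj_hom (Xij i j) (sch_obj W)"
      by (rule obj_comp_hom[OF obj_ij[OF ij] algW \<kappa>_hom[OF ij] \<psi>i_hom[OF ij(1)]])
    then have "\<exists>!h. h \<in> sch_hom (Vij i j) W \<and> factors_via (Xij i j) (Vij i j) W (\<iota>ij i j) h ?\<chi>"
      by (rule scalar_ext_ex1[OF \<iota>ij[OF ij] W])
    moreover have "?a \<in> sch_hom (Vij i j) W"
      by (rule sch_comp_hom[OF locally_ringed_ringed[OF lr_ij[OF ij]] locally_ringed_ringed[OF lr_i[OF ij(1)]]
            locally_ringed_ringed[OF lrW] incl_ij(1)[OF ij] g(1)[OF ij(1)]])
    moreover have "?b \<in> sch_hom (Vij i j) W"
      using sch_comp_hom[OF locally_ringed_ringed[OF lr_ij[OF ji]] locally_ringed_ringed[OF lr_i[OF ij(2)]]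
            locally_ringed_ringed[OF lrW] incl_ij(1)[OF ji] g(1)[OF ij(2)]] unfolding comm .
    moreover have "factors_via (Xij i j) (Vij i j) W (\<iota>ij i j) ?a ?\<chi>"
      by (rule overlap[OF ij g(1)[OF ij(1)] g(2)[OF ij(1)]])
    moreover have "factors_via (Xij i j) (Vij i j) W (\<iota>ij i j) ?b ?\<chi>"
      using overlap[OF ji g(1)[OF ij(2)] g(2)[OF ij(2)]] unfolding comm X \<psi>_overlap[OF ij, unfolded X] .
    ultimately show ?thesis by blast
  qed
  obtain h where h: "h \<in> sch_hom V W" "\<And>i. i \<in> I \<Longrightarrow> sch_comp (Vi i) V W h (open_incl V (U i)) = g i"
    using glue_sch_hom[OF lr lrW U cover lr_i incl_i(1) g(1) compat] by blast
  show ?thesis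
  proof (rule ex1I)
    show "h \<in> sch_hom V W \<and> factors_via GX V W (glued_incl V I Xi \<phi>) h \<psi>"
      using h g(2) by (simp add: factors_via_G_iff)
    fix k assume k: "k \<in> sch_hom V W \<and> factors_via GX V W (glued_incl V I Xi \<phi>) k \<psi>"
    show "k = h"
    proof (rule sch_hom_eq_on_cover[OF locally_ringed_ringed[OF lr] U cover conjunct1[OF k] h(1)])
      fix i assume i: "i \<in> I"
      have "factors_via (Xi i) (Vi i) W (\<iota> i) (sch_comp (Vi i) V W k (open_incl V (U i))) (\<psi>i i)"
        using k factors_via_G_iff[OF conjunct1[OF k]] i by blast
      \<comment> \<open>Both \<open>g i\<close> and the restriction of k to \<open>U i\<close>
        extend the same morphism \<open>\<psi>i i\<close>, so uniqueness of the extension of scalars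
        identifies them.\<close>
      then show "sch_comp (Vi i) V W k (open_incl V (U i)) = sch_comp (Vi i) V W h (open_incl V (U i))"
        unfolding h(2)[OF i]
        using scalar_ext_ex1[OF \<iota>[OF i] W \<psi>i_hom[OF i]] comp_hom[OF i conjunct1[OF k]] g[OF i] by blast
    qed
  qed
qed

end

lemma glued_scalar_ext:
  "is_object (glued_obj V I Xi \<phi> \<kappa> e)"
  "scalar_ext (glued_obj V I Xi \<phi> \<kappa> e) V (glued_incl V I Xi \<phi>)"
proof -
  show "is_object GX" by (rule is_object_G)
  show "scalar_ext GX V (glued_incl V I Xi \<phi>)"
    unfolding scalar_ext_def
  proof (intro conjI allI impI ballI V glued_immersion)
    fix W :: "'u sch" and \<psi> assume W: "ft_scheme W" and \<psi>: "\<psi> \<in> obj_hom GX (sch_obj W)"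
    show "\<exists>!g. g \<in> sch_hom V W \<and> \<psi> = obj_comp GX (sch_obj W) (sch_omor V W g) (glued_incl V I Xi \<phi>)"
      using glued_universal[OF W \<psi>] unfolding obj_comp_eq_iff_factors_via[OF \<psi> glued_incl_hom] .
  qed
qed

end

theorem proposition5:
  fixes V :: "'u sch"
    and I :: "'i set"
    and U :: "'i \<Rightarrow> 'u set"
    and Xi :: "'i \<Rightarrow> ('u, 's, 'a) fobj"
    and Xij :: "'i \<Rightarrow> 'i \<Rightarrow> ('u, 't, 'b) fobj"
    and \<iota> :: "'i \<Rightarrow> ('u, 's, 'a) to_sch"
    and \<iota>ij :: "'i \<Rightarrow> 'i \<Rightarrow> ('u, 't, 'b) to_sch"
    and \<phi> :: "'i \<Rightarrow> ('u, 's, 'a) to_sch"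
    and \<kappa> :: "'i \<Rightarrow> 'i \<Rightarrow> ('u, 't, 's, 'b, 'a) omor"
    and e :: "'u agad \<Rightarrow> 'u sch_mor \<Rightarrow> ('i \<Rightarrow> 'a) \<Rightarrow> 'u"
  assumes "ft_scheme V"
    and "finite I"
    and "\<And>i. i \<in> I \<Longrightarrow> opn V (U i)"
    and "(\<Union>i \<in> I. U i) = pts V"
    and "\<And>i. i \<in> I \<Longrightarrow> variety_F1 (Xi i)"
    and "\<And>i. i \<in> I \<Longrightarrow> scalar_ext (Xi i) (open_sub V (U i)) (\<iota> i)"
    and "\<And>i j. i \<in> I \<Longrightarrow> j \<in> I \<Longrightarrow> i \<noteq> j \<Longrightarrow> variety_F1 (Xij i j)"
    and "\<And>i j. i \<in> I \<Longrightarrow> j \<in> I \<Longrightarrow> i \<noteq> j \<Longrightarrow>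
      scalar_ext (Xij i j) (open_sub V (U i \<inter> U j)) (\<iota>ij i j)"
    and "\<And>i j. i \<in> I \<Longrightarrow> j \<in> I \<Longrightarrow> i \<noteq> j \<Longrightarrow> Xij i j = Xij j i \<and> \<iota>ij i j = \<iota>ij j i"
    and "\<And>i. i \<in> I \<Longrightarrow> obj_immersion (Xi i) (sch_obj V) (\<phi> i)"
    and "\<And>i. i \<in> I \<Longrightarrow>
      ext_to_sch (Xi i) (open_sub V (U i)) (\<iota> i) V (\<phi> i) = open_incl V (U i)"
    and "\<And>i j. i \<in> I \<Longrightarrow> j \<in> I \<Longrightarrow> i \<noteq> j \<Longrightarrow> obj_immersion (Xij i j) (Xi i) (\<kappa> i j)"
    and "\<And>i j. i \<in> I \<Longrightarrow> j \<in> I \<Longrightarrow> i \<noteq> j \<Longrightarrow>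
      ext_mor (Xij i j) (open_sub V (U i \<inter> U j)) (\<iota>ij i j) (open_sub V (U i)) (\<iota> i) (\<kappa> i j) =
      open_incl (open_sub V (U i)) (U i \<inter> U j)"
    and "\<And>i j. i \<in> I \<Longrightarrow> j \<in> I \<Longrightarrow> i \<noteq> j \<Longrightarrow>
      obj_comp (Xij i j) (sch_obj V) (\<phi> i) (\<kappa> i j) =
      obj_comp (Xij j i) (sch_obj V) (\<phi> j) (\<kappa> j i)"
    and "evident_evaluation I Xi \<phi> \<kappa> e"
  shows "variety_F1 (glued_obj V I Xi \<phi> \<kappa> e) \<and>
    scalar_ext (glued_obj V I Xi \<phi> \<kappa> e) V (glued_incl V I Xi \<phi>)"
proof -
  have "is_object (glued_obj V I Xi \<phi> \<kappa> e)"
    "scalar_ext (glued_obj V I Xi \<phi> \<kappa> e) V (glued_incl V I Xi \<phi>)"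
    using glued_scalar_ext[of V I U Xi \<iota> Xij \<iota>ij \<phi> \<kappa> e] assms by blast+
  then show ?thesis unfolding variety_F1_def by blast
qed

end
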